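(* Let $\nu\ge 1$ be an integer, let $\omega\in\mathbb{R}^\nu$ have entries linearly independent over $\mathbb{Z}$, let $P$ be a polynomial of two variables, and let $k>\kappa>0$. Let $L$ be a Fourier multiplier operator with purely imaginary symbol $m:\mathbb{R}\to i\mathbb{R}$ satisfying the growth bound $$\sup_{\xi\in\mathbb{R}}|m(\xi)|\,e^{-\frac{k-\varepsilon}{|\omega|}|\xi|}<\infty\quad\text{for some }\varepsilon>0.$$ Then, for initial data in $V^{\omega,k}$, the Cauchy problem $$\partial_t u+Lu+\partial_x(P(u,\bar u))=0,\qquad u(0,x)=u_0(x)$$ is unconditionally locally well-posed in $V^{\omega,\kappa}$ both forward and backward in time. That is: for every $u_0\in V^{\omega,k}$ there exist an open ball $B\subseteq V^{\omega,k}$ containing $u_0$ and a $T>0$ such that for every $\tilde u_0\in B$ there exists a unique classical solution $u\in C([-T,T],V^{\omega,\kappa})$ with $u(0,\cdot)=\tilde u_0$, and the data-to-solution map $B\to C([-T,T],V^{\omega,\kappa})$ is Lipschitz continuous.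
   Context: $|\cdot|$ on $\mathbb{R}^\nu$ and $\mathbb{Z}^\nu$ is the Euclidean norm, $\langle\cdot,\cdot\rangle$ the Euclidean inner product. For $s>0$, $V^{\omega,s}$ is the space of functions $u:\mathbb{R}\to\mathbb{C}$ of the form $u(x)=\sum_{n\in\mathbb{Z}^\nu}\widehat u(n)e^{i\langle\omega,n\rangle x}$ with finite norm $\|u\|_{\omega,s}=\sum_{n\in\mathbb{Z}^\nu}|\widehat u(n)|e^{s|n|}$. The coefficients are uniquely determined by $u$, via $\widehat u(n)=\lim_{N\to\infty}\frac{1}{2N}\int_{-N}^N u(x)e^{-i\langle\omega,n\rangle x}dx$. $C([-T,T],V^{\omega,s})$ is the space of continuous functions $[-T,T]\to V^{\omega,s}$ with norm $\sup_{t\in[-T,T]}\|u(t,\cdot)\|_{\omega,s}$. The multiplier operator $L$ with symbol $m$ acts by $Lu(x)=\sum_{n\in\mathbb{Z}^\nu}m(\langle\omega,n\rangle)\widehat u(n)e^{i\langle\omega,n\rangle x}$. The growth bound ensures that $L$ maps $V^{\omega,k}$ into $V^{\omega,\varepsilon}$. A function $u\in C([-T,T],V^{\omega,\kappa})$ is a classical solution of the equation if it is at least once continuously differentiable in the time variable and satisfies the equation pointwise. *)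

theory Defs
  imports "HOL-Analysis.Analysis" "HOL-Computational_Algebra.Polynomial"
begin

definition int_vec :: "int ^ 'nu \<Rightarrow> real ^ 'nu::finite" where
  "int_vec n = (\<chi> i. real_of_int (n $ i))"

definition int_independent :: "real ^ 'nu::finite \<Rightarrow> bool" where
  "int_independent \<omega> \<longleftrightarrow> (\<forall>n :: int ^ 'nu. (\<Sum>i\<in>UNIV. real_of_int (n $ i) * \<omega> $ i) = 0 \<longrightarrow> n = 0)"

definition wave :: "real ^ 'nu::finite \<Rightarrow> int ^ 'nu \<Rightarrow> real \<Rightarrow> complex" where
  "wave \<omega> n x = exp (\<i> * complex_of_real ((\<omega> \<bullet> int_vec n) * x))"

definition qp_coeff :: "real ^ 'nu::finite \<Rightarrow> (real \<Rightarrow> complex) \<Rightarrow> int ^ 'nu \<Rightarrow> complex" where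
  "qp_coeff \<omega> u n =
     Lim at_top (\<lambda>N::real. (1 / complex_of_real (2 * N)) *
       integral {-N..N} (\<lambda>x. u x * exp (- \<i> * complex_of_real ((\<omega> \<bullet> int_vec n) * x))))"

definition qp_space :: "real ^ 'nu::finite \<Rightarrow> real \<Rightarrow> (real \<Rightarrow> complex) set" where
  "qp_space \<omega> s = {u. \<exists>c :: int ^ 'nu \<Rightarrow> complex.
     (\<lambda>n. norm (c n) * exp (s * norm (int_vec n))) summable_on UNIV \<and>
     (\<forall>x. ((\<lambda>n. c n * wave \<omega> n x) has_sum u x) UNIV)}"

definition qp_norm :: "real ^ 'nu::finite \<Rightarrow> real \<Rightarrow> (real \<Rightarrow> complex) \<Rightarrow> real" where
  "qp_norm \<omega> s u = (\<Sum>\<^sub>\<infinity>n. norm (qp_coeff \<omega> u n) * exp (s * norm (int_vec n)))"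

definition qp_ball ::
  "real ^ 'nu::finite \<Rightarrow> real \<Rightarrow> (real \<Rightarrow> complex) \<Rightarrow> real \<Rightarrow> (real \<Rightarrow> complex) set" where
  "qp_ball \<omega> s a r = {v \<in> qp_space \<omega> s. qp_norm \<omega> s (\<lambda>x. v x - a x) < r}"

text \<open>Elements of \<open>C([-T,T], V)\<close> are functions on all of \<open>\<real>\<close> whose values
  outside \<open>[-T,T]\<close> are irrelevant.\<close>

definition qp_curves ::
  "real ^ 'nu::finite \<Rightarrow> real \<Rightarrow> real \<Rightarrow> (real \<Rightarrow> real \<Rightarrow> complex) set" where
  "qp_curves \<omega> s T = {u. (\<forall>t\<in>{-T..T}. u t \<in> qp_space \<omega> s) \<and>
     (\<forall>t\<in>{-T..T}. ((\<lambda>r. qp_norm \<omega> s (\<lambda>x. u r x - u t x)) \<longlongrightarrow> 0) (at t within {-T..T}))}"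

definition qp_curve_norm ::
  "real ^ 'nu::finite \<Rightarrow> real \<Rightarrow> real \<Rightarrow> (real \<Rightarrow> real \<Rightarrow> complex) \<Rightarrow> real" where
  "qp_curve_norm \<omega> s T u = (SUP t\<in>{-T..T}. qp_norm \<omega> s (u t))"

definition multiplier ::
  "real ^ 'nu::finite \<Rightarrow> (real \<Rightarrow> complex) \<Rightarrow> (real \<Rightarrow> complex) \<Rightarrow> real \<Rightarrow> complex" where
  "multiplier \<omega> m u x = (\<Sum>\<^sub>\<infinity>n. m (\<omega> \<bullet> int_vec n) * qp_coeff \<omega> u n * wave \<omega> n x)"

text \<open>A polynomial in two variables is a polynomial in the first variable with coefficients
  polynomial in the second.\<close>

definition poly2 :: "complex poly poly \<Rightarrow> complex \<Rightarrow> complex \<Rightarrow> complex" where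
  "poly2 P z w = poly (poly P [:z:]) w"

text \<open>The growth bound on the symbol with exponent \<open>k\<close> does not by itself make the series
  of \<open>Lu\<close> converge for \<open>u \<in> V\<^sup>\<omega>\<^sup>,\<^sup>\<kappa>\<close> with \<open>\<kappa> < k\<close>, and a divergent \<open>infsum\<close> is 0.
  That \<open>u\<close> satisfies the equation pointwise therefore includes convergence of that series.
  Time derivatives at \<open>\<plusminus>T\<close> are one-sided.\<close>

definition classical_solution ::
  "real ^ 'nu::finite \<Rightarrow> (real \<Rightarrow> complex) \<Rightarrow> complex poly poly \<Rightarrow> real \<Rightarrow> real \<Rightarrow>
     (real \<Rightarrow> real \<Rightarrow> complex) \<Rightarrow> bool" where
  "classical_solution \<omega> m P \<kappa> T u \<longleftrightarrow>
     u \<in> qp_curves \<omega> \<kappa> T \<and>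
     (\<exists>ut :: real \<Rightarrow> real \<Rightarrow> complex.
        continuous_on ({-T..T} \<times> UNIV) (\<lambda>(t, x). ut t x) \<and>
        (\<forall>t\<in>{-T..T}. \<forall>x.
           ((\<lambda>r. u r x) has_vector_derivative ut t x) (at t within {-T..T}) \<and>
           (\<lambda>n. m (\<omega> \<bullet> int_vec n) * qp_coeff \<omega> (u t) n * wave \<omega> n x) summable_on UNIV \<and>
           (\<lambda>y. poly2 P (u t y) (cnj (u t y))) differentiable (at x) \<and>
           ut t x + multiplier \<omega> m (u t) x
             + vector_derivative (\<lambda>y. poly2 P (u t y) (cnj (u t y))) (at x) = 0))"

end

theory Submission
  imports Defs
begin

text \<open>
  On the level of Fourier coefficients the equation is the system
  \<open>c\<^sub>n' = - m(\<omega> \<bullet> n) c\<^sub>n - i (\<omega> \<bullet> n) P(c)\<^sub>n\<close>, whose linear part is a rotation of every coefficient. With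
  the time dependent weight \<open>exp((k - \<rho>\<bar>t\<bar>)\<bar>n\<bar>)\<close> and the supremum over time taken inside the sum over
  \<open>n\<close>, the Duhamel integral gains a factor \<open>1 / (\<rho>\<bar>n\<bar>)\<close>, which pays for the derivative. For large \<open>\<rho>\<close> it is a
  contraction, which gives existence, Lipschitz dependence, and uniqueness on short time intervals
  whose length depends only on the size of the solutions, hence uniqueness on all of \<open>[-T, T]\<close>.

  The delicate point is that an arbitrary classical solution satisfies the system. Its time
  derivative is bounded only locally in \<open>x\<close>, and the sum of \<open>\<bar>m(\<omega> \<bullet> n) c\<^sub>n(t)\<bar>\<close> is finite for each \<open>t\<close> without
  any uniformity, so limits of means in \<open>x\<close> and integrals in \<open>t\<close> cannot be interchanged directly.
  Let \<open>E\<close> be the closed set of times near which the integrated system fails. If \<open>E\<close> is not empty, then by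
  Baire that sum is bounded on a nonempty relatively open part of \<open>E\<close>. Across the gaps of \<open>E\<close> the system
  holds, and since the linear part is a rotation, the increments of all coefficients together are
  bounded by the length of the gap times the bound at its endpoint. Dominated convergence on \<open>E\<close> and
  on the sum over the gaps then shows that the system holds near that part of \<open>E\<close> as well.
\<close>

section \<open>Absolutely convergent series of waves\<close>

text \<open>Why the supremum over time must sit inside the sum: with the supremum outside, the
  Duhamel integral is controlled only by the integral over r of the supremum over n of |n| exp(- rho
  |n| |t - r|), which is of order 1 / (rho |t - r|) and diverges logarithmically. Frequency by
  frequency, the integral of |n| exp(- rho |n| |t - r|) in r is at most 1 / rho. The linear part
  enters no such estimate, because its rotations have modulus one. The growth bound on the symbol is
  spent on turning coefficients into a classical solution, and it fixes how far the weight may fall: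
  from k to the larger of kappa and k - epsilon, which together with rho determines T. Uniqueness
  has to work in V^kappa, where kappa may lie below k - epsilon, so the norm of a competing solution
  gives no control of Lu. All that such a solution offers is convergence of the series of Lu at each
  time; for complex families this convergence is absolute, and that is where the finiteness of the
  sum of |m c_n(t)| comes from.\<close>

definition conv :: "('i::ab_group_add \<Rightarrow> 'a) \<Rightarrow> ('i \<Rightarrow> 'a) \<Rightarrow> 'i \<Rightarrow> 'a::{real_normed_field,banach}" where
  "conv f g n = (\<Sum>\<^sub>\<infinity>k. f k * g (n - k))"

lemma conv_summable:
  fixes f g :: "'i::ab_group_add \<Rightarrow> 'a::{real_normed_field,banach}"
  assumes f: "(\<lambda>n. norm (f n)) summable_on UNIV" and g: "(\<lambda>n. norm (g n)) summable_on UNIV"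
  shows conv_terms_abs_summable: "(\<lambda>k. norm (f k * g (n - k))) summable_on UNIV"
    and conv_has_sum: "(conv f g has_sum (infsum f UNIV * infsum g UNIV)) UNIV"
proof -
  have a: "(\<lambda>p. norm ((\<lambda>(k, l). f k * g l) p)) summable_on UNIV \<times> UNIV"
    unfolding Infinite_Sum.abs_summable_on_Sigma_iff
  proof (intro conjI ballI)
    fix k show "(\<lambda>l. norm (case (k, l) of (k, l) \<Rightarrow> f k * g l)) summable_on UNIV"
      using summable_on_cmult_right[OF g, of "norm (f k)"] by (simp add: norm_mult)
  next
    have "(\<lambda>k. norm (f k) * infsum (\<lambda>l. norm (g l)) UNIV) summable_on UNIV"
      by (rule summable_on_cmult_left[OF f])
    then show "(\<lambda>k. norm (\<Sum>\<^sub>\<infinity>l\<in>UNIV. norm (case (k, l) of (k, l) \<Rightarrow> f k * g l))) summable_on UNIV"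
      by (simp add: norm_mult infsum_cmult_right' abs_mult infsum_nonneg)
  qed
  have bij: "bij_betw (\<lambda>(n, k). (k, n - k)) (UNIV \<times> UNIV) (UNIV \<times> (UNIV :: 'i set))"
    by (rule bij_betwI[where g = "\<lambda>(k, l). (k + l, k)"]) (auto simp: algebra_simps)
  have a2: "(\<lambda>p. norm ((\<lambda>(n, k). f k * g (n - k)) p)) summable_on UNIV \<times> UNIV"
    using summable_on_reindex_bij_betw[OF bij, of "\<lambda>p. norm ((\<lambda>(k, l). f k * g l) p)"] a
    by (simp add: case_prod_unfold)
  show terms: "(\<lambda>k. norm (f k * g (n - k))) summable_on UNIV" for n
    using a2 unfolding Infinite_Sum.abs_summable_on_Sigma_iff by auto
  have h: "((\<lambda>(k, l). f k * g l) has_sum (infsum f UNIV * infsum g UNIV)) (UNIV \<times> UNIV)"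
  proof (rule has_sum_SigmaI)
    fix k show "((\<lambda>l. case (k, l) of (k, l) \<Rightarrow> f k * g l) has_sum f k * infsum g UNIV) UNIV"
      using has_sum_cmult_right[OF has_sum_infsum[OF abs_summable_summable[OF g]], of "f k"] by simp
  next
    show "((\<lambda>k. f k * infsum g UNIV) has_sum infsum f UNIV * infsum g UNIV) UNIV"
      by (rule has_sum_cmult_left[OF has_sum_infsum[OF abs_summable_summable[OF f]]])
  qed (rule abs_summable_summable[OF a])
  have h2: "((\<lambda>(n, k). f k * g (n - k)) has_sum (infsum f UNIV * infsum g UNIV)) (UNIV \<times> UNIV)"
    using has_sum_reindex_bij_betw[OF bij, of "\<lambda>(k, l). f k * g l"] h
    by (simp add: case_prod_unfold)
  show "(conv f g has_sum (infsum f UNIV * infsum g UNIV)) UNIV"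
  proof (rule has_sum_SigmaD[OF h2])
    fix n show "((\<lambda>k. case (n, k) of (n, k) \<Rightarrow> f k * g (n - k)) has_sum conv f g n) UNIV"
      unfolding conv_def using has_sum_infsum[OF abs_summable_summable[OF terms[of n]]] by simp
  qed
qed

lemma norm_conv_le:
  fixes f g :: "'i::ab_group_add \<Rightarrow> 'a::{real_normed_field,banach}"
  assumes "(\<lambda>n. norm (f n)) summable_on UNIV" "(\<lambda>n. norm (g n)) summable_on UNIV"
  shows "norm (conv f g n) \<le> conv (\<lambda>n. norm (f n)) (\<lambda>n. norm (g n)) n"
  unfolding conv_def
  using norm_infsum_bound[OF conv_terms_abs_summable[OF assms, of n]] by (simp add: norm_mult)

lemma conv_diff:
  fixes f g f' g' :: "'i::ab_group_add \<Rightarrow> 'a::{real_normed_field,banach}"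
  assumes "(\<lambda>n. norm (f n)) summable_on UNIV" "(\<lambda>n. norm (g n)) summable_on UNIV"
    and "(\<lambda>n. norm (f' n)) summable_on UNIV" "(\<lambda>n. norm (g' n)) summable_on UNIV"
  shows "conv f g n - conv f' g' n = conv (\<lambda>n. f n - f' n) g n + conv f' (\<lambda>n. g n - g' n) n"
proof -
  note s = abs_summable_summable[OF conv_terms_abs_summable]
  have "conv (\<lambda>n. f n - f' n) g n = conv f g n - conv f' g n"
    unfolding conv_def using infsum_add[OF s[OF assms(1,2), of n] summable_on_uminus[THEN iffD2, OF s[OF assms(3,2), of n]]]
    by (simp add: left_diff_distrib infsum_uminus)
  moreover have "conv f' (\<lambda>n. g n - g' n) n = conv f' g n - conv f' g' n"
    unfolding conv_def using infsum_add[OF s[OF assms(3,2), of n] summable_on_uminus[THEN iffD2, OF s[OF assms(3,4), of n]]]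
    by (simp add: right_diff_distrib infsum_uminus)
  ultimately show ?thesis by simp
qed

section \<open>Waves and products of wave series\<close>

lemma int_vec_0 [simp]: "int_vec 0 = 0"
  and int_vec_add: "int_vec (a + b) = int_vec a + int_vec b"
  and int_vec_diff: "int_vec (a - b) = int_vec a - int_vec b"
  and int_vec_uminus [simp]: "int_vec (- a) = - int_vec a"
  by (simp_all add: int_vec_def vec_eq_iff)

lemma norm_wave [simp]: "norm (wave \<omega> n x) = 1"
  unfolding wave_def by (metis norm_exp_i_times)

lemma wave_0 [simp]: "wave \<omega> 0 x = 1"
  by (simp add: wave_def)

lemma wave_add: "wave \<omega> (a + b) x = wave \<omega> a x * wave \<omega> b x"
  by (simp add: wave_def int_vec_add exp_add [symmetric] algebra_simps inner_add_right)

lemma wave_uminus: "wave \<omega> (- a) x = cnj (wave \<omega> a x)"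
  by (simp add: wave_def exp_cnj)

lemma wave_diff: "wave \<omega> (a - b) x = wave \<omega> a x * cnj (wave \<omega> b x)"
  using wave_add[of \<omega> a "-b" x] by (simp add: wave_uminus)

lemma continuous_wave [continuous_intros]:
  "continuous_on S f \<Longrightarrow> continuous_on S (\<lambda>z. wave \<omega> n (f z))"
  unfolding wave_def by (intro continuous_intros)

lemma wave_has_vector_derivative:
  "((\<lambda>x. wave \<omega> n x) has_vector_derivative (\<i> * (\<omega> \<bullet> int_vec n) * wave \<omega> n x)) (at x within S)"
proof -
  have "((\<lambda>z. exp (\<i> * complex_of_real (\<omega> \<bullet> int_vec n) * z)) has_field_derivative
    (\<i> * (\<omega> \<bullet> int_vec n) * wave \<omega> n x)) (at (of_real x))"
    unfolding wave_def by (auto intro!: derivative_eq_intros simp: mult_ac)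
  from has_vector_derivative_real_field[OF has_field_derivative_at_within[OF this]] show ?thesis
    unfolding wave_def by (simp add: mult_ac)
qed

lemma summable_wave:
  assumes "(\<lambda>n. norm (c n)) summable_on UNIV"
  shows "(\<lambda>n. c n * wave \<omega> n x) summable_on UNIV"
  by (rule abs_summable_summable) (use assms in \<open>simp add: norm_mult\<close>)

text \<open>Waves are characters of the frequency lattice, so multiplying coefficients by
  \<open>wave\<close> commutes with \<open>conv\<close>, and the product formula reduces to the
  value of the sum in \<open>conv_has_sum\<close>.\<close>

lemma conv_wave:
  fixes f g :: "int ^ 'nu::finite \<Rightarrow> complex"
  assumes f: "(\<lambda>n. norm (f n)) summable_on UNIV" and g: "(\<lambda>n. norm (g n)) summable_on UNIV"
    and u: "((\<lambda>n. f n * wave \<omega> n x) has_sum u) UNIV" and v: "((\<lambda>n. g n * wave \<omega> n x) has_sum v) UNIV"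
  shows "((\<lambda>n. conv f g n * wave \<omega> n x) has_sum (u * v)) UNIV"
proof -
  have "conv f g n * wave \<omega> n x = conv (\<lambda>n. f n * wave \<omega> n x) (\<lambda>n. g n * wave \<omega> n x) n" for n
  proof -
    have "f k * wave \<omega> k x * (g (n - k) * wave \<omega> (n - k) x) = (f k * g (n - k)) * wave \<omega> n x" for k
      using wave_add[of \<omega> k "n - k" x] by simp
    then show ?thesis unfolding conv_def by (simp only: infsum_cmult_left')
  qed
  moreover have "(conv (\<lambda>n. f n * wave \<omega> n x) (\<lambda>n. g n * wave \<omega> n x) has_sum (u * v)) UNIV"
    using conv_has_sum[of "\<lambda>n. f n * wave \<omega> n x" "\<lambda>n. g n * wave \<omega> n x"] f g infsumI[OF u] infsumI[OF v]
    by (simp add: norm_mult)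
  ultimately show ?thesis by simp
qed

section \<open>Termwise continuity and differentiation\<close>

lemma continuous_on_has_sum:
  fixes f :: "'i \<Rightarrow> 'b::topological_space \<Rightarrow> 'c::banach"
  assumes "\<And>n. continuous_on Y (f n)" "\<And>n y. y \<in> Y \<Longrightarrow> norm (f n y) \<le> M n" "M summable_on UNIV"
    and "\<And>y. y \<in> Y \<Longrightarrow> ((\<lambda>n. f n y) has_sum S y) UNIV"
  shows "continuous_on Y S"
proof (rule uniform_limit_theorem)
  show "uniform_limit Y (\<lambda>X y. \<Sum>n\<in>X. f n y) S (finite_subsets_at_top UNIV)"
    by (rule Weierstrass_m_test_general'[OF _ _ assms(3)]) (use assms in auto)
qed (auto intro!: always_eventually continuous_on_sum assms)

text \<open>The M-test is applied to the derivatives only: their series may be integrated term by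
  term, which exhibits \<open>S\<close> as \<open>S a\<close> plus a primitive of the continuous
  \<open>S'\<close>.\<close>

lemma has_vector_derivative_has_sum:
  fixes f :: "'i \<Rightarrow> real \<Rightarrow> 'c::banach"
  assumes f: "\<And>n y. y \<in> {a..b} \<Longrightarrow> (f n has_vector_derivative f' n y) (at y within {a..b})"
    and c: "\<And>n. continuous_on {a..b} (f' n)"
    and M: "\<And>n y. y \<in> {a..b} \<Longrightarrow> norm (f' n y) \<le> M n" "M summable_on UNIV"
    and S: "\<And>y. y \<in> {a..b} \<Longrightarrow> ((\<lambda>n. f n y) has_sum S y) UNIV"
    and S': "\<And>y. y \<in> {a..b} \<Longrightarrow> ((\<lambda>n. f' n y) has_sum S' y) UNIV"
    and x: "x \<in> {a..b}"
  shows "(S has_vector_derivative S' x) (at x within {a..b})"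
proof -
  have cS': "continuous_on {a..b} S'"
    by (rule continuous_on_has_sum[OF c M S'])
  have eq: "S y = S a + integral {a..y} S'" if y: "y \<in> {a..b}" for y
  proof -
    have u: "uniform_limit {a..y} (\<lambda>X y. \<Sum>n\<in>X. f' n y) S' (finite_subsets_at_top UNIV)"
      by (rule uniform_limit_on_subset[OF Weierstrass_m_test_general'[where M = M and Y = "{a..b}"]])
        (use M S' y in auto)
    have cc: "continuous_on {a..y} (\<lambda>y. \<Sum>n\<in>X. f' n y)" for X
      by (rule continuous_on_subset[OF continuous_on_sum[OF c]]) (use y in auto)
    obtain I J where IJ: "\<And>X. ((\<lambda>y. \<Sum>n\<in>X. f' n y) has_integral I X) {a..y}"
      "(S' has_integral J) {a..y}" "(I \<longlongrightarrow> J) (finite_subsets_at_top UNIV)"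
      using uniform_limit_integral[OF u cc] by auto
    have "((\<lambda>y. \<Sum>n\<in>X. f' n y) has_integral ((\<Sum>n\<in>X. f n y) - (\<Sum>n\<in>X. f n a))) {a..y}" for X
      by (rule fundamental_theorem_of_calculus)
        (use y in \<open>auto intro!: has_vector_derivative_sum has_vector_derivative_within_subset[OF f]\<close>)
    then have "I = (\<lambda>X. (\<Sum>n\<in>X. f n y) - (\<Sum>n\<in>X. f n a))"
      using IJ(1) has_integral_unique by (intro ext) blast
    moreover have "((\<lambda>X. (\<Sum>n\<in>X. f n y) - (\<Sum>n\<in>X. f n a)) \<longlongrightarrow> S y - S a) (finite_subsets_at_top UNIV)"
      using S[of y] S[of a] y by (intro tendsto_diff) (auto simp: has_sum_def)
    ultimately have "J = S y - S a"
      using IJ(3) tendsto_unique[OF finite_subsets_at_top_neq_bot] by blast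
    then show ?thesis using IJ(2) by (simp add: integral_unique)
  qed
  have "((\<lambda>y. S a + integral {a..y} S') has_vector_derivative (0 + S' x)) (at x within {a..b})"
    by (intro has_vector_derivative_add has_vector_derivative_const integral_has_vector_derivative cS' x)
  then show ?thesis
    using has_vector_derivative_transform[OF x eq] by simp
qed

section \<open>Window means and the recovery of coefficients\<close>

lemma freq_inj:
  assumes "int_independent \<omega>" "\<omega> \<bullet> int_vec l = \<omega> \<bullet> int_vec n"
  shows "l = n"
proof -
  have "(\<Sum>i\<in>UNIV. real_of_int ((l - n) $ i) * \<omega> $ i) = \<omega> \<bullet> int_vec (l - n)"
    by (simp add: inner_vec_def int_vec_def mult.commute)
  also have "\<dots> = 0" using assms(2) by (simp add: int_vec_diff inner_diff_right)
  finally show ?thesis using assms(1) unfolding int_independent_def by (metis eq_iff_diff_eq_0)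
qed

text \<open>The mean over one bounded window, kept apart from its limit: for a function whose time
  derivative is bounded only locally in x, differentiation in time is possible window by
  window.\<close>

definition mean :: "real ^ 'nu::finite \<Rightarrow> (real \<Rightarrow> complex) \<Rightarrow> int ^ 'nu \<Rightarrow> real \<Rightarrow> complex" where
  "mean \<omega> u n N = (1 / complex_of_real (2 * N)) * integral {-N..N} (\<lambda>x. u x * cnj (wave \<omega> n x))"

lemma qp_coeff_mean: "qp_coeff \<omega> u n = Lim at_top (mean \<omega> u n)"
proof -
  have "exp (- \<i> * complex_of_real ((\<omega> \<bullet> int_vec n) * x)) = cnj (wave \<omega> n x)" for x
    by (simp add: wave_def exp_cnj)
  then show ?thesis unfolding qp_coeff_def mean_def by simp
qed

lemma norm_mean_le:
  assumes "continuous_on UNIV u" "\<And>x. norm (u x) \<le> B" "N > 0"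
  shows "norm (mean \<omega> u n N) \<le> B"
proof -
  have "norm (integral {-N..N} (\<lambda>x. u x * cnj (wave \<omega> n x))) \<le> B * (N - (-N))"
    using assms by (intro integral_bound)
      (auto intro!: continuous_intros simp: norm_mult intro: continuous_on_subset)
  then show ?thesis using assms
    by (simp add: mean_def norm_mult norm_divide field_simps)
qed

lemma mean_diff:
  assumes "continuous_on UNIV u" "continuous_on UNIV v"
  shows "mean \<omega> (\<lambda>x. u x - v x) n N = mean \<omega> u n N - mean \<omega> v n N"
proof -
  have "(\<lambda>x. u x * cnj (wave \<omega> n x)) integrable_on {-N..N}" "(\<lambda>x. v x * cnj (wave \<omega> n x)) integrable_on {-N..N}"
    using assms by (auto intro!: integrable_continuous_real continuous_intros intro: continuous_on_subset)
  then show ?thesis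
    by (simp add: mean_def left_diff_distrib integral_diff right_diff_distrib)
qed

lemma mean_wave_tendsto:
  assumes ind: "int_independent \<omega>"
  shows "((\<lambda>N. mean \<omega> (\<lambda>x. wave \<omega> l x) n N) \<longlongrightarrow> (if l = n then 1 else 0)) at_top"
proof (cases "l = n")
  case True
  have "mean \<omega> (\<lambda>x. wave \<omega> l x) n N = 1" if "N > 0" for N
    using that True by (simp add: mean_def wave_diff[symmetric] content_real scaleR_conv_of_real)
  then have "\<forall>\<^sub>F N in at_top. mean \<omega> (\<lambda>x. wave \<omega> l x) n N = 1"
    by (rule eventually_mono[OF eventually_gt_at_top[of "0::real"]])
  then show ?thesis using True by (simp add: tendsto_eventually)
next
  case False
  define \<theta> where "\<theta> = \<omega> \<bullet> int_vec (l - n)"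
  have \<theta>: "\<theta> \<noteq> 0" using freq_inj[OF ind, of "l - n" 0] False by (auto simp: \<theta>_def)
  \<comment> \<open>A wave of frequency \<open>\<theta>\<close> has a primitive of modulus 1 /
    |\<theta>|, so its integral over any window is at most 2 / |\<theta>|; division by the length 2N
    leaves decay in N.\<close>
  have b0: "norm (mean \<omega> (\<lambda>x. wave \<omega> l x) n N) \<le> (1 / \<bar>\<theta>\<bar>) / N" if N: "N > 0" for N
  proof -
    have "((\<lambda>x. wave \<omega> (l - n) x) has_integral
       (wave \<omega> (l - n) N / (\<i> * \<theta>) - wave \<omega> (l - n) (-N) / (\<i> * \<theta>))) {-N..N}"
    proof (rule fundamental_theorem_of_calculus)
      fix x
      have "((\<lambda>x. wave \<omega> (l - n) x / (\<i> * \<theta>)) has_vector_derivative (\<i> * \<theta> * wave \<omega> (l - n) x) / (\<i> * \<theta>)) (at x within {-N..N})"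
        by (rule has_vector_derivative_divide) (use wave_has_vector_derivative[of \<omega> "l - n"] in \<open>simp add: \<theta>_def\<close>)
      then show "((\<lambda>x. wave \<omega> (l - n) x / (\<i> * \<theta>)) has_vector_derivative wave \<omega> (l - n) x) (at x within {-N..N})"
        using \<theta> by simp
    qed (use N in auto)
    then have i: "integral {-N..N} (\<lambda>x. wave \<omega> l x * cnj (wave \<omega> n x)) = wave \<omega> (l - n) N / (\<i> * \<theta>) - wave \<omega> (l - n) (-N) / (\<i> * \<theta>)"
      by (simp add: wave_diff[symmetric] integral_unique)
    have "norm (integral {-N..N} (\<lambda>x. wave \<omega> l x * cnj (wave \<omega> n x))) \<le> 1 / \<bar>\<theta>\<bar> + 1 / \<bar>\<theta>\<bar>"
      unfolding i by (rule order_trans[OF norm_triangle_ineq4]) (simp add: norm_divide norm_mult)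
    then show ?thesis using N by (simp add: mean_def norm_mult norm_divide field_simps)
  qed
  have b: "\<forall>\<^sub>F N in at_top. norm (mean \<omega> (\<lambda>x. wave \<omega> l x) n N) \<le> 1 / \<bar>\<theta>\<bar> * inverse N"
    using eventually_gt_at_top[of "0::real"]
    by eventually_elim (use b0 in \<open>simp add: divide_inverse\<close>)
  have "((\<lambda>N::real. 1 / \<bar>\<theta>\<bar> * inverse N) \<longlongrightarrow> 0) at_top"
    by (rule tendsto_mult_right_zero[OF tendsto_inverse_0_at_top[OF filterlim_ident]])
  from Lim_null_comparison[OF b this]
  have "((\<lambda>N. mean \<omega> (\<lambda>x. wave \<omega> l x) n N) \<longlongrightarrow> 0) at_top" .
  then show ?thesis using False by simp
qed


lemma wave_series_continuous:
  fixes c :: "int ^ 'nu::finite \<Rightarrow> complex"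
  assumes c: "(\<lambda>n. norm (c n)) summable_on UNIV" and u: "\<And>x. ((\<lambda>n. c n * wave \<omega> n x) has_sum u x) UNIV"
  shows "continuous_on UNIV u"
proof (rule continuous_on_has_sum[where f = "\<lambda>n x. c n * wave \<omega> n x" and M = "\<lambda>n. norm (c n)"])
  show "continuous_on UNIV (\<lambda>x. c n * wave \<omega> n x)" for n
    by (intro continuous_intros)
  show "(\<lambda>n. cmod (c n)) summable_on UNIV" by (rule c)
  show "((\<lambda>n. c n * wave \<omega> n y) has_sum u y) UNIV" for y by (rule u)
  show "cmod (c n * wave \<omega> n y) \<le> cmod (c n)" for n y by (simp add: norm_mult)
qed

text \<open>Finite partial sums approximate \<open>u\<close> uniformly and means do not exceed the
  sup norm, so the claim reduces to the orthogonality of finitely many waves.\<close>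

lemma mean_tendsto:
  fixes c :: "int ^ 'nu::finite \<Rightarrow> complex"
  assumes ind: "int_independent \<omega>"
    and c: "(\<lambda>n. norm (c n)) summable_on UNIV" and u: "\<And>x. ((\<lambda>n. c n * wave \<omega> n x) has_sum u x) UNIV"
  shows "(mean \<omega> u n \<longlongrightarrow> c n) at_top"
proof (rule tendstoI)
  fix e :: real assume e: "e > 0"
  have ul: "uniform_limit UNIV (\<lambda>X x. \<Sum>l\<in>X. c l * wave \<omega> l x) u (finite_subsets_at_top UNIV)"
    by (rule Weierstrass_m_test_general'[where M = "\<lambda>n. norm (c n)", OF _ u c]) (simp add: norm_mult)
  have "\<forall>\<^sub>F X in finite_subsets_at_top UNIV. \<forall>x\<in>UNIV. dist (\<Sum>l\<in>X. c l * wave \<omega> l x) (u x) < e/2"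
    using uniform_limitD[OF ul, of "e/2"] e by simp
  then obtain X0 where "finite X0" and X0: "\<And>Y. finite Y \<Longrightarrow> X0 \<subseteq> Y \<Longrightarrow> \<forall>x. dist (\<Sum>l\<in>Y. c l * wave \<omega> l x) (u x) < e/2"
    unfolding eventually_finite_subsets_at_top by auto
  \<comment> \<open>\<open>n\<close> is forced into the finite set so that the Kronecker sum below
    returns \<open>c n\<close>.\<close>
  define X where "X = insert n X0"
  have X: "finite X" "n \<in> X" using \<open>finite X0\<close> by (auto simp: X_def)
  have "X0 \<subseteq> X" by (auto simp: X_def)
  then have Xle: "norm ((\<Sum>l\<in>X. c l * wave \<omega> l x) - u x) \<le> e/2" for x
    using X0[OF X(1)] by (simp add: dist_norm order_less_imp_le)
  define v where "v x = (\<Sum>l\<in>X. c l * wave \<omega> l x)" for x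
  have cv: "continuous_on UNIV v" unfolding v_def by (intro continuous_intros)
  have cu: "continuous_on UNIV u" by (rule wave_series_continuous[OF c u])
  have mv: "mean \<omega> v n = (\<lambda>N. \<Sum>l\<in>X. c l * mean \<omega> (\<lambda>x. wave \<omega> l x) n N)"
  proof
    fix N
    have "integral {-N..N} (\<lambda>x. \<Sum>l\<in>X. c l * (wave \<omega> l x * cnj (wave \<omega> n x))) =
      (\<Sum>l\<in>X. c l * integral {-N..N} (\<lambda>x. wave \<omega> l x * cnj (wave \<omega> n x)))"
      by (subst integral_sum) (auto intro!: X integrable_continuous_real continuous_intros)
    then show "mean \<omega> v n N = (\<Sum>l\<in>X. c l * mean \<omega> (\<lambda>x. wave \<omega> l x) n N)"
      by (simp add: mean_def v_def sum_distrib_right sum_distrib_left mult.assoc mult.left_commute)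
  qed
  have "((\<lambda>N. \<Sum>l\<in>X. c l * mean \<omega> (\<lambda>x. wave \<omega> l x) n N) \<longlongrightarrow> (\<Sum>l\<in>X. c l * (if l = n then 1 else 0))) at_top"
    by (intro tendsto_intros mean_wave_tendsto ind)
  then have "(mean \<omega> v n \<longlongrightarrow> c n) at_top"
    using X by (simp add: mv if_distrib[of "\<lambda>z. _ * z"] sum.delta' cong: if_cong)
  then have "\<forall>\<^sub>F N in at_top. dist (mean \<omega> v n N) (c n) < e/2" using e by (intro tendstoD) auto
  then show "\<forall>\<^sub>F N in at_top. dist (mean \<omega> u n N) (c n) < e"
    using eventually_gt_at_top[of 0]
  proof eventually_elim
    case (elim N)
    have "norm (mean \<omega> (\<lambda>x. v x - u x) n N) \<le> e/2"
      by (rule norm_mean_le) (use Xle elim cv cu in \<open>auto intro!: continuous_intros simp: v_def\<close>)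
    then have "dist (mean \<omega> u n N) (mean \<omega> v n N) \<le> e/2"
      by (simp add: mean_diff[OF cv cu] dist_norm norm_minus_commute)
    then show ?case using elim dist_triangle[of "mean \<omega> u n N" "c n" "mean \<omega> v n N"] by linarith
  qed
qed

lemma qp_coeff_eq:
  fixes c :: "int ^ 'nu::finite \<Rightarrow> complex"
  assumes ind: "int_independent \<omega>"
    and c: "(\<lambda>n. norm (c n)) summable_on UNIV" and u: "\<And>x. ((\<lambda>n. c n * wave \<omega> n x) has_sum u x) UNIV"
  shows "qp_coeff \<omega> u = c"
  unfolding qp_coeff_mean by (intro ext tendsto_Lim mean_tendsto[OF assms]) auto

section \<open>Coefficient curves with a summable majorant\<close>

text \<open>The supremum over time is inside the sum over the frequencies: one majorant serves all times.\<close>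

definition tame ::
  "real set \<Rightarrow> (real \<Rightarrow> real) \<Rightarrow> (real \<Rightarrow> int ^ 'nu::finite \<Rightarrow> complex) \<Rightarrow> real \<Rightarrow> bool" where
  "tame J s c R \<longleftrightarrow> (\<exists>\<alpha>. (\<forall>n. 0 \<le> \<alpha> n) \<and> \<alpha> summable_on UNIV \<and> infsum \<alpha> UNIV \<le> R \<and>
     (\<forall>t\<in>J. \<forall>n. norm (c t n) * exp (s t * norm (int_vec n)) \<le> \<alpha> n))"

lemma tameI:
  assumes "\<And>n. 0 \<le> \<alpha> n" "\<alpha> summable_on UNIV" "infsum \<alpha> UNIV \<le> R"
    and "\<And>t n. t \<in> J \<Longrightarrow> norm (c t n) * exp (s t * norm (int_vec n)) \<le> \<alpha> n"
  shows "tame J s c R"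
  unfolding tame_def by (rule exI[of _ \<alpha>]) (use assms in blast)

lemma tameE:
  assumes "tame J s c R"
  obtains \<alpha> where "\<And>n. 0 \<le> \<alpha> n" "\<alpha> summable_on UNIV" "infsum \<alpha> UNIV \<le> R"
    and "\<And>t n. t \<in> J \<Longrightarrow> norm (c t n) * exp (s t * norm (int_vec n)) \<le> \<alpha> n"
  using assms unfolding tame_def by blast

lemma tame_nonneg: "tame J s c R \<Longrightarrow> 0 \<le> R"
  by (erule tameE) (meson infsum_nonneg order_trans)

lemma tame_mono:
  assumes "tame J s c R" "R \<le> R'" "J' \<subseteq> J"
    and "\<And>t n. t \<in> J' \<Longrightarrow> norm (c' t n) * exp (s' t * norm (int_vec n)) \<le> norm (c t n) * exp (s t * norm (int_vec n))"
  shows "tame J' s' c' R'"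
proof -
  obtain \<alpha> where a: "\<And>n. 0 \<le> \<alpha> n" "\<alpha> summable_on UNIV" "infsum \<alpha> UNIV \<le> R"
    "\<And>t n. t \<in> J \<Longrightarrow> norm (c t n) * exp (s t * norm (int_vec n)) \<le> \<alpha> n"
    by (rule tameE[OF assms(1)]) (rule that; blast)
  show ?thesis
  proof (rule tameI[of \<alpha>])
    fix t n assume "t \<in> J'"
    then show "norm (c' t n) * exp (s' t * norm (int_vec n)) \<le> \<alpha> n"
      using assms(3,4) a(4)[of t n] by (meson order_trans subsetD)
  qed (use a assms(2) in auto)
qed

lemma tame_weight_mono:
  assumes "tame J s c R" "\<And>t. t \<in> J \<Longrightarrow> s' t \<le> s t"
  shows "tame J s' c R"
  by (rule tame_mono[OF assms(1) order_refl subset_refl])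
    (auto intro!: mult_left_mono mult_right_mono assms(2))

lemma tame_cong:
  assumes "tame J s c R" "\<And>t n. t \<in> J \<Longrightarrow> c' t n = c t n"
  shows "tame J s c' R"
  by (rule tame_mono[OF assms(1) order_refl subset_refl]) (simp add: assms(2))

lemma tame_single:
  assumes "tame J s c R" "t \<in> J"
  shows tame_weighted_summable: "(\<lambda>n. norm (c t n) * exp (s t * norm (int_vec n))) summable_on UNIV"
    and tame_weighted_infsum: "(\<Sum>\<^sub>\<infinity>n. norm (c t n) * exp (s t * norm (int_vec n))) \<le> R"
proof -
  obtain \<alpha> where a: "\<And>n. 0 \<le> \<alpha> n" "\<alpha> summable_on UNIV" "infsum \<alpha> UNIV \<le> R"
    "\<And>t n. t \<in> J \<Longrightarrow> norm (c t n) * exp (s t * norm (int_vec n)) \<le> \<alpha> n"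
    by (rule tameE[OF assms(1)]) (rule that; blast)
  show *: "(\<lambda>n. norm (c t n) * exp (s t * norm (int_vec n))) summable_on UNIV"
    by (rule summable_on_comparison_test[OF a(2)]) (use a(4)[OF assms(2)] in auto)
  have "(\<Sum>\<^sub>\<infinity>n. norm (c t n) * exp (s t * norm (int_vec n))) \<le> infsum \<alpha> UNIV"
    by (rule infsum_mono[OF * a(2) a(4)[OF assms(2)]])
  then show "(\<Sum>\<^sub>\<infinity>n. norm (c t n) * exp (s t * norm (int_vec n))) \<le> R"
    using a(3) by linarith
qed

text \<open>On a one-point time set \<open>tame\<close> is just a weighted l1 bound, so estimates
  proved for curves also apply to single states.\<close>

lemma tame_singletonI:
  assumes "(\<lambda>n. norm (c t n) * exp (s t * norm (int_vec n))) summable_on UNIV"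
    and "(\<Sum>\<^sub>\<infinity>n. norm (c t n) * exp (s t * norm (int_vec n))) \<le> R"
  shows "tame {t} s c R"
  by (rule tameI[OF _ assms]) auto

lemma tame_bound:
  assumes "tame J s c R" "t \<in> J" "0 \<le> s t"
  shows "norm (c t n) \<le> R"
proof -
  have "norm (c t n) * 1 \<le> norm (c t n) * exp (s t * norm (int_vec n))"
    using assms(3) by (intro mult_left_mono) auto
  also have "\<dots> = (\<Sum>\<^sub>\<infinity>n\<in>{n}. norm (c t n) * exp (s t * norm (int_vec n)))" by simp
  also have "\<dots> \<le> (\<Sum>\<^sub>\<infinity>n. norm (c t n) * exp (s t * norm (int_vec n)))"
    by (rule infsum_mono2[OF _ tame_weighted_summable[OF assms(1,2)]]) auto
  finally show ?thesis using tame_weighted_infsum[OF assms(1,2)] by simp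
qed

lemma tame_abs_summable:
  assumes "tame J s c R" "t \<in> J" "0 \<le> s t"
  shows "(\<lambda>n. norm (c t n)) summable_on UNIV"
proof (rule summable_on_comparison_test[OF tame_weighted_summable[OF assms(1,2)]])
  fix n
  have "norm (c t n) * 1 \<le> norm (c t n) * exp (s t * norm (int_vec n))"
    using assms(3) by (intro mult_left_mono) auto
  then show "norm (c t n) \<le> norm (c t n) * exp (s t * norm (int_vec n))" by simp
qed auto

lemma tame_add:
  assumes "tame J s c R" "tame J s d S"
  shows "tame J s (\<lambda>t n. c t n + d t n) (R + S)"
proof -
  obtain \<alpha> where a: "\<And>n. 0 \<le> \<alpha> n" "\<alpha> summable_on UNIV" "infsum \<alpha> UNIV \<le> R"
    "\<And>t n. t \<in> J \<Longrightarrow> norm (c t n) * exp (s t * norm (int_vec n)) \<le> \<alpha> n"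
    by (rule tameE[OF assms(1)]) (rule that; blast)
  obtain \<beta> where b: "\<And>n. 0 \<le> \<beta> n" "\<beta> summable_on UNIV" "infsum \<beta> UNIV \<le> S"
    "\<And>t n. t \<in> J \<Longrightarrow> norm (d t n) * exp (s t * norm (int_vec n)) \<le> \<beta> n"
    by (rule tameE[OF assms(2)]) (rule that; blast)
  show ?thesis
  proof (rule tameI[of "\<lambda>n. \<alpha> n + \<beta> n"])
    fix t n assume "t \<in> J"
    have "norm (c t n + d t n) * exp (s t * norm (int_vec n)) \<le> (norm (c t n) + norm (d t n)) * exp (s t * norm (int_vec n))"
      by (intro mult_right_mono norm_triangle_ineq) auto
    then show "norm (c t n + d t n) * exp (s t * norm (int_vec n)) \<le> \<alpha> n + \<beta> n"
      using a(4)[OF \<open>t \<in> J\<close>, of n] b(4)[OF \<open>t \<in> J\<close>, of n] by (simp add: distrib_right)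
  qed (use a(1-3) b(1-3) in \<open>auto simp: infsum_add intro!: summable_on_add\<close>)
qed

lemma tame_cmult:
  assumes "tame J s c R"
  shows "tame J s (\<lambda>t n. z * c t n) (norm z * R)"
proof -
  obtain \<alpha> where a: "\<And>n. 0 \<le> \<alpha> n" "\<alpha> summable_on UNIV" "infsum \<alpha> UNIV \<le> R"
    "\<And>t n. t \<in> J \<Longrightarrow> norm (c t n) * exp (s t * norm (int_vec n)) \<le> \<alpha> n"
    by (rule tameE[OF assms(1)]) (rule that; blast)
  show ?thesis
    by (rule tameI[of "\<lambda>n. norm z * \<alpha> n"])
      (use a in \<open>auto simp: infsum_cmult_right norm_mult mult.assoc intro!: summable_on_cmult_right mult_left_mono\<close>)
qed

lemma tame_zero: "tame J s (\<lambda>t n. 0) 0"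
  by (rule tameI[of "\<lambda>n. 0"]) auto

text \<open>For nonnegative \<open>s t\<close> the weight is submultiplicative by the triangle
  inequality, so the convolution of two majorants is again a majorant.\<close>

lemma tame_conv:
  assumes "tame J s c R" "tame J s d S" and s: "\<And>t. t \<in> J \<Longrightarrow> 0 \<le> s t"
  shows "tame J s (\<lambda>t. conv (c t) (d t)) (R * S)"
proof -
  obtain \<alpha> where a: "\<And>n. 0 \<le> \<alpha> n" "\<alpha> summable_on UNIV" "infsum \<alpha> UNIV \<le> R"
    "\<And>t n. t \<in> J \<Longrightarrow> norm (c t n) * exp (s t * norm (int_vec n)) \<le> \<alpha> n"
    by (rule tameE[OF assms(1)]) (rule that; blast)
  obtain \<beta> where b: "\<And>n. 0 \<le> \<beta> n" "\<beta> summable_on UNIV" "infsum \<beta> UNIV \<le> S"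
    "\<And>t n. t \<in> J \<Longrightarrow> norm (d t n) * exp (s t * norm (int_vec n)) \<le> \<beta> n"
    by (rule tameE[OF assms(2)]) (rule that; blast)
  have na: "(\<lambda>n. norm (\<alpha> n)) summable_on UNIV" and nb: "(\<lambda>n. norm (\<beta> n)) summable_on UNIV"
    using a b by auto
  have cs: "(conv \<alpha> \<beta> has_sum infsum \<alpha> UNIV * infsum \<beta> UNIV) UNIV"
    by (rule conv_has_sum[OF na nb])
  have ab: "(\<lambda>k. \<alpha> k * \<beta> (n - k)) summable_on UNIV" for n
    by (rule abs_summable_summable[OF conv_terms_abs_summable[OF na nb]])
  show ?thesis
  proof (rule tameI[of "conv \<alpha> \<beta>"])
    show "0 \<le> conv \<alpha> \<beta> n" for n unfolding conv_def by (intro infsum_nonneg) (simp add: a b)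
    show "conv \<alpha> \<beta> summable_on UNIV" using cs by (rule has_sum_imp_summable)
    show "infsum (conv \<alpha> \<beta>) UNIV \<le> R * S"
      using infsumI[OF cs] a b infsum_nonneg[of UNIV \<alpha>] infsum_nonneg[of UNIV \<beta>]
      by (simp add: mult_mono)
    fix t n assume t: "t \<in> J"
    have sc: "(\<lambda>n. norm (c t n)) summable_on UNIV" and sd: "(\<lambda>n. norm (d t n)) summable_on UNIV"
      using tame_abs_summable[OF assms(1) t s[OF t]] tame_abs_summable[OF assms(2) t s[OF t]] .
    note ct = conv_terms_abs_summable[OF sc sd, of n]
    have "norm (conv (c t) (d t) n) * exp (s t * norm (int_vec n))
        \<le> (\<Sum>\<^sub>\<infinity>k. norm (c t k * d t (n - k))) * exp (s t * norm (int_vec n))"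
      unfolding conv_def by (intro mult_right_mono norm_infsum_bound ct) auto
    also have "\<dots> = (\<Sum>\<^sub>\<infinity>k. norm (c t k * d t (n - k)) * exp (s t * norm (int_vec n)))"
      using ct by (intro infsum_cmult_left[symmetric])
    also have "\<dots> \<le> conv \<alpha> \<beta> n"
      unfolding conv_def
    proof (rule infsum_mono[OF summable_on_cmult_left[OF ct] ab])
      fix k
      have "norm (int_vec n) \<le> norm (int_vec k) + norm (int_vec (n - k))"
        using norm_triangle_ineq[of "int_vec k" "int_vec (n - k)"] by (simp add: int_vec_diff)
      then have "exp (s t * norm (int_vec n)) \<le> exp (s t * norm (int_vec k)) * exp (s t * norm (int_vec (n - k)))"
        using mult_left_mono[OF _ s[OF t]] by (fastforce simp: exp_add[symmetric] distrib_left[symmetric])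
      then have "norm (c t k * d t (n - k)) * exp (s t * norm (int_vec n)) \<le>
          (norm (c t k) * norm (d t (n - k))) * (exp (s t * norm (int_vec k)) * exp (s t * norm (int_vec (n - k))))"
        unfolding norm_mult by (intro mult_left_mono) auto
      also have "\<dots> = (norm (c t k) * exp (s t * norm (int_vec k))) * (norm (d t (n - k)) * exp (s t * norm (int_vec (n - k))))"
        by simp
      also have "\<dots> \<le> \<alpha> k * \<beta> (n - k)"
        by (intro mult_mono a(4) b(4) t a(1)) auto
      finally show "norm (c t k * d t (n - k)) * exp (s t * norm (int_vec n)) \<le> \<alpha> k * \<beta> (n - k)" .
    qed
    finally show "norm (conv (c t) (d t) n) * exp (s t * norm (int_vec n)) \<le> conv \<alpha> \<beta> n" .
  qed
qed

text \<open>Coefficients of the complex conjugate function: conjugation reverses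
  frequencies.\<close>

definition cstar :: "(int ^ 'nu::finite \<Rightarrow> complex) \<Rightarrow> int ^ 'nu \<Rightarrow> complex" where
  "cstar a n = cnj (a (- n))"

lemma bij_uminus: "bij_betw uminus (UNIV :: 'a::group_add set) UNIV"
  by (rule bij_betwI[where g = uminus]) auto

lemma tame_cstar:
  assumes "tame J s c R"
  shows "tame J s (\<lambda>t. cstar (c t)) R"
proof -
  obtain \<alpha> where a: "\<And>n. 0 \<le> \<alpha> n" "\<alpha> summable_on UNIV" "infsum \<alpha> UNIV \<le> R"
    "\<And>t n. t \<in> J \<Longrightarrow> norm (c t n) * exp (s t * norm (int_vec n)) \<le> \<alpha> n"
    by (rule tameE[OF assms(1)]) (rule that; blast)
  show ?thesis
  proof (rule tameI[of "\<lambda>n. \<alpha> (- n)"])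
    show "(\<lambda>n. \<alpha> (- n)) summable_on UNIV"
      using summable_on_reindex_bij_betw[OF bij_uminus, of \<alpha>] a(2) by simp
    show "(\<Sum>\<^sub>\<infinity>n. \<alpha> (- n)) \<le> R"
      using infsum_reindex_bij_betw[OF bij_uminus, of \<alpha>] a(3) by simp
    fix t n assume "t \<in> J"
    then show "norm (cstar (c t) n) * exp (s t * norm (int_vec n)) \<le> \<alpha> (- n)"
      using a(4)[of t "-n"] by (simp add: cstar_def)
  qed (use a in auto)
qed

definition cunit :: "int ^ 'nu::finite \<Rightarrow> complex" where
  "cunit n = (if n = 0 then 1 else 0)"

lemma tame_cunit: "tame J s (\<lambda>t. cunit :: int ^ 'a::finite \<Rightarrow> complex) 1"
proof (rule tameI[of "\<lambda>n. if n = 0 then 1 else 0"])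
  have "((\<lambda>n::int^'a. if n = 0 then 1 else 0::real) has_sum 1) UNIV"
    by (rule has_sum_finite_neutralI[of "{0}"]) auto
  then show "(\<lambda>n::int^'a. if n = 0 then 1 else 0::real) summable_on UNIV"
    "infsum (\<lambda>n::int^'a. if n = 0 then 1 else 0::real) UNIV \<le> 1"
    by (auto simp: infsumI has_sum_imp_summable)
qed (auto simp: cunit_def)

text \<open>\<open>B\<close> and \<open>L\<close> must serve all time sets and all nonnegative
  weights at once: the decay rate of the weight is chosen in terms of them, so they have to be fixed
  before the weight is.\<close>

definition tame_lip ::
  "((int ^ 'a::finite \<Rightarrow> complex) \<Rightarrow> int ^ 'a \<Rightarrow> complex) \<Rightarrow> real \<Rightarrow> real \<Rightarrow> real \<Rightarrow> bool" where
  "tame_lip F R B L \<longleftrightarrow> 0 \<le> B \<and> 0 \<le> L \<and> (\<forall>J s. (\<forall>t\<in>J. 0 \<le> s t) \<longrightarrow>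
     (\<forall>c. tame J s c R \<longrightarrow> tame J s (\<lambda>t. F (c t)) B) \<and>
     (\<forall>c c' D. tame J s c R \<longrightarrow> tame J s c' R \<longrightarrow> tame J s (\<lambda>t n. c t n - c' t n) D \<longrightarrow>
        tame J s (\<lambda>t n. F (c t) n - F (c' t) n) (L * D)))"

lemma tame_lipI:
  fixes F :: "(int ^ 'a::finite \<Rightarrow> complex) \<Rightarrow> int ^ 'a \<Rightarrow> complex"
  assumes "0 \<le> B" "0 \<le> L"
    and "\<And>J s c. \<forall>t\<in>J. 0 \<le> s t \<Longrightarrow> tame J s c R \<Longrightarrow> tame J s (\<lambda>t. F (c t)) B"
    and "\<And>J s c c' D. \<forall>t\<in>J. 0 \<le> s t \<Longrightarrow> tame J s c R \<Longrightarrow> tame J s c' R \<Longrightarrow>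
        tame J s (\<lambda>t n. c t n - c' t n) D \<Longrightarrow> tame J s (\<lambda>t n. F (c t) n - F (c' t) n) (L * D)"
  shows "tame_lip F R B L"
  unfolding tame_lip_def by (intro conjI allI impI assms)

lemma tame_lipD:
  fixes F :: "(int ^ 'a::finite \<Rightarrow> complex) \<Rightarrow> int ^ 'a \<Rightarrow> complex"
  assumes "tame_lip F R B L"
  shows "0 \<le> B" "0 \<le> L"
    and "\<forall>t\<in>J. 0 \<le> s t \<Longrightarrow> tame J s c R \<Longrightarrow> tame J s (\<lambda>t. F (c t)) B"
    and "\<forall>t\<in>J. 0 \<le> s t \<Longrightarrow> tame J s c R \<Longrightarrow> tame J s c' R \<Longrightarrow>
        tame J s (\<lambda>t n. c t n - c' t n) D \<Longrightarrow> tame J s (\<lambda>t n. F (c t) n - F (c' t) n) (L * D)"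
proof -
  note h = assms[unfolded tame_lip_def]
  show "0 \<le> B" "0 \<le> L" using h by blast+
  assume s: "\<forall>t\<in>J. 0 \<le> s t" and c: "tame J s c R"
  note hJ = h[THEN conjunct2, THEN conjunct2, THEN spec[of _ J], THEN spec[of _ s], THEN mp, OF s]
  show "tame J s (\<lambda>t. F (c t)) B"
    by (rule hJ[THEN conjunct1, THEN spec[of _ c], THEN mp, OF c])
  assume "tame J s c' R" "tame J s (\<lambda>t n. c t n - c' t n) D"
  then show "tame J s (\<lambda>t n. F (c t) n - F (c' t) n) (L * D)"
    by (rule hJ[THEN conjunct2, THEN spec[of _ c], THEN spec[of _ c'], THEN spec[of _ D], THEN mp, THEN mp, THEN mp, OF c])
qed

text \<open>\<open>tame_lip\<close> asks for a nonnegative bound while the radius may be negative,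
  hence \<open>max R 0\<close>.\<close>

lemma tame_lip_ident: "tame_lip (\<lambda>a. a) R (max R 0) 1"
  by (rule tame_lipI) (auto intro: tame_mono[where R = R and R' = "max R 0"])

lemma tame_lip_cstar:
  assumes "tame_lip F R B L"
  shows "tame_lip (\<lambda>a. cstar (F a)) R B L"
proof (rule tame_lipI)
  fix J s and c c' :: "real \<Rightarrow> int ^ 'a \<Rightarrow> complex" and D
  have eq: "(\<lambda>t n. cstar (F (c t)) n - cstar (F (c' t)) n) = (\<lambda>t. cstar (\<lambda>n. F (c t) n - F (c' t) n))"
    by (simp add: cstar_def fun_eq_iff)
  assume s: "\<forall>t\<in>J. 0 \<le> s t" and c: "tame J s c R"
  show "tame J s (\<lambda>t. cstar (F (c t))) B"
    by (intro tame_cstar tame_lipD(3)[OF assms s c])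
  assume "tame J s c' R" "tame J s (\<lambda>t n. c t n - c' t n) D"
  then show "tame J s (\<lambda>t n. cstar (F (c t)) n - cstar (F (c' t)) n) (L * D)"
    unfolding eq by (intro tame_cstar tame_lipD(4)[OF assms s c])
qed (use tame_lipD[OF assms] in auto)

lemma tame_lip_cunit: "tame_lip (\<lambda>a. cunit) R 1 0"
  by (rule tame_lipI) (auto intro: tame_cunit tame_zero)

text \<open>The Leibniz splitting \<open>conv_diff\<close> produces the constant: one factor is
  differenced while the other is only bounded.\<close>

lemma tame_lip_conv:
  assumes F: "tame_lip F R B L" and G: "tame_lip G R B' L'"
  shows "tame_lip (\<lambda>a. conv (F a) (G a)) R (B * B') (L * B' + B * L')"
proof (rule tame_lipI)
  fix J s and c c' :: "real \<Rightarrow> int ^ 'a \<Rightarrow> complex" and D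
  assume s: "\<forall>t\<in>J. 0 \<le> s t" and c: "tame J s c R"
  then show "tame J s (\<lambda>t. conv (F (c t)) (G (c t))) (B * B')"
    by (intro tame_conv tame_lipD(3)[OF F] tame_lipD(3)[OF G]) auto
  assume c': "tame J s c' R" and D: "tame J s (\<lambda>t n. c t n - c' t n) D"
  have "tame J s (\<lambda>t n. conv (\<lambda>n. F (c t) n - F (c' t) n) (G (c t)) n + conv (F (c' t)) (\<lambda>n. G (c t) n - G (c' t) n) n)
      ((L * D) * B' + B * (L' * D))"
    using s by (intro tame_add tame_conv tame_lipD(4)[OF F s c c' D] tame_lipD(4)[OF G s c c' D]
      tame_lipD(3)[OF F s c'] tame_lipD(3)[OF G s c]) auto
  then show "tame J s (\<lambda>t n. conv (F (c t)) (G (c t)) n - conv (F (c' t)) (G (c' t)) n) ((L * B' + B * L') * D)"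
  proof (rule tame_mono)
    fix t n assume t: "t \<in> J"
    then have "0 \<le> s t" using s by blast
    then have "(\<lambda>n. norm (F (c t) n)) summable_on UNIV" "(\<lambda>n. norm (G (c t) n)) summable_on UNIV"
      "(\<lambda>n. norm (F (c' t) n)) summable_on UNIV" "(\<lambda>n. norm (G (c' t) n)) summable_on UNIV"
      using tame_abs_summable[OF tame_lipD(3)[OF F s c] t] tame_abs_summable[OF tame_lipD(3)[OF G s c] t]
        tame_abs_summable[OF tame_lipD(3)[OF F s c'] t] tame_abs_summable[OF tame_lipD(3)[OF G s c'] t]
      by blast+
    from conv_diff[OF this]
    show "norm (conv (F (c t)) (G (c t)) n - conv (F (c' t)) (G (c' t)) n) * exp (s t * norm (int_vec n)) \<le>
       norm (conv (\<lambda>n. F (c t) n - F (c' t) n) (G (c t)) n + conv (F (c' t)) (\<lambda>n. G (c t) n - G (c' t) n) n) * exp (s t * norm (int_vec n))"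
      by simp
  qed (auto simp: algebra_simps)
qed (use tame_lipD(1,2)[OF F] tame_lipD(1,2)[OF G] in auto)

lemma tame_lip_cmult:
  assumes F: "tame_lip F R B L"
  shows "tame_lip (\<lambda>a n. z * F a n) R (norm z * B) (norm z * L)"
proof (rule tame_lipI)
  fix J s and c c' :: "real \<Rightarrow> int ^ 'a \<Rightarrow> complex" and D
  assume s: "\<forall>t\<in>J. 0 \<le> s t" and c: "tame J s c R"
  show "tame J s (\<lambda>t n. z * F (c t) n) (norm z * B)"
    by (rule tame_cmult[OF tame_lipD(3)[OF F s c]])
  assume c': "tame J s c' R" and D: "tame J s (\<lambda>t n. c t n - c' t n) D"
  show "tame J s (\<lambda>t n. z * F (c t) n - z * F (c' t) n) (norm z * L * D)"
    using tame_cmult[OF tame_lipD(4)[OF F s c c' D], of z]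
    by (simp add: right_diff_distrib mult.assoc)
qed (use tame_lipD(1,2)[OF F] in auto)

lemma tame_lip_add:
  assumes F: "tame_lip F R B L" and G: "tame_lip G R B' L'"
  shows "tame_lip (\<lambda>a n. F a n + G a n) R (B + B') (L + L')"
proof (rule tame_lipI)
  fix J s and c c' :: "real \<Rightarrow> int ^ 'a \<Rightarrow> complex" and D
  assume s: "\<forall>t\<in>J. 0 \<le> s t" and c: "tame J s c R"
  show "tame J s (\<lambda>t n. F (c t) n + G (c t) n) (B + B')"
    by (rule tame_add[OF tame_lipD(3)[OF F s c] tame_lipD(3)[OF G s c]])
  assume c': "tame J s c' R" and D: "tame J s (\<lambda>t n. c t n - c' t n) D"
  show "tame J s (\<lambda>t n. F (c t) n + G (c t) n - (F (c' t) n + G (c' t) n)) ((L + L') * D)"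
    using tame_add[OF tame_lipD(4)[OF F s c c' D] tame_lipD(4)[OF G s c c' D]]
    by (simp add: algebra_simps)
qed (use tame_lipD(1,2)[OF F] tame_lipD(1,2)[OF G] in auto)

definition tame_map :: "((int ^ 'a::finite \<Rightarrow> complex) \<Rightarrow> int ^ 'a \<Rightarrow> complex) \<Rightarrow> bool" where
  "tame_map F \<longleftrightarrow> (\<forall>R. \<exists>B L. tame_lip F R B L)"

lemma tame_map_intros:
  shows tame_map_ident: "tame_map (\<lambda>a. a)"
    and tame_map_cunit: "tame_map (\<lambda>a. cunit)"
    and tame_map_cstar: "tame_map F \<Longrightarrow> tame_map (\<lambda>a. cstar (F a))"
    and tame_map_cmult: "tame_map F \<Longrightarrow> tame_map (\<lambda>a n. z * F a n)"
    and tame_map_conv: "tame_map F \<Longrightarrow> tame_map G \<Longrightarrow> tame_map (\<lambda>a. conv (F a) (G a))"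
    and tame_map_add: "tame_map F \<Longrightarrow> tame_map G \<Longrightarrow> tame_map (\<lambda>a n. F a n + G a n)"
  unfolding tame_map_def
  by (blast intro: tame_lip_ident tame_lip_cunit tame_lip_cstar tame_lip_cmult tame_lip_conv tame_lip_add)+

lemma tame_map_sum:
  assumes "\<And>i. i \<in> I \<Longrightarrow> tame_map (F i)" "finite I"
  shows "tame_map (\<lambda>a n. \<Sum>i\<in>I. F i a n)"
  using assms(2,1)
proof (induction I)
  case empty
  then show ?case using tame_map_cmult[OF tame_map_ident, of 0] by simp
next
  case (insert i I)
  then show ?case by (simp add: tame_map_add)
qed

section \<open>The polynomial nonlinearity on coefficients\<close>

fun cpow :: "(int ^ 'nu::finite \<Rightarrow> complex) \<Rightarrow> nat \<Rightarrow> int ^ 'nu \<Rightarrow> complex" where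
  "cpow a 0 = cunit"
| "cpow a (Suc j) = conv a (cpow a j)"

text \<open>The coefficients of P(u, cnj u). The outer index \<open>j\<close> counts powers of u and
  the inner index \<open>i\<close> powers of its conjugate, matching \<open>poly2\<close>, which
  substitutes its first argument for the outer variable.\<close>

definition pcoeff :: "complex poly poly \<Rightarrow> (int ^ 'nu::finite \<Rightarrow> complex) \<Rightarrow> int ^ 'nu \<Rightarrow> complex" where
  "pcoeff P a n = (\<Sum>j\<le>degree P. \<Sum>i\<le>degree (coeff P j).
     coeff (coeff P j) i * conv (cpow a j) (cpow (cstar a) i) n)"

lemma tame_map_cpow: "tame_map F \<Longrightarrow> tame_map (\<lambda>a. cpow (F a) j)"
  by (induction j) (auto intro: tame_map_cunit tame_map_conv)

lemma tame_map_pcoeff: "tame_map (pcoeff P)"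
  unfolding pcoeff_def[abs_def]
  by (intro tame_map_sum tame_map_cmult tame_map_conv tame_map_cpow tame_map_cstar tame_map_ident) auto

text \<open>Absolute summability is carried along with the value at a point because it makes the
  relation closed under products.\<close>

definition is_series :: "real ^ 'nu::finite \<Rightarrow> (int ^ 'nu \<Rightarrow> complex) \<Rightarrow> real \<Rightarrow> complex \<Rightarrow> bool" where
  "is_series \<omega> a x u \<longleftrightarrow> (\<lambda>n. norm (a n)) summable_on UNIV \<and> ((\<lambda>n. a n * wave \<omega> n x) has_sum u) UNIV"

lemma is_series_conv:
  assumes "is_series \<omega> a x u" "is_series \<omega> b x v"
  shows "is_series \<omega> (conv a b) x (u * v)"
proof -
  have ab: "(\<lambda>n. norm (a n)) summable_on UNIV" "(\<lambda>n. norm (b n)) summable_on UNIV"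
    using assms by (auto simp: is_series_def)
  then have "conv (\<lambda>n. norm (a n)) (\<lambda>n. norm (b n)) summable_on UNIV"
    by (intro has_sum_imp_summable[OF conv_has_sum]) auto
  then have "(\<lambda>n. norm (conv a b n)) summable_on UNIV"
    by (rule summable_on_comparison_test) (use norm_conv_le[OF ab] in auto)
  then show ?thesis using conv_wave[OF ab] assms by (auto simp: is_series_def)
qed

lemma is_series_cunit: "is_series \<omega> cunit x 1"
  unfolding is_series_def
proof
  have "((\<lambda>n. norm (cunit n :: complex)) has_sum 1) UNIV"
    by (rule has_sum_finite_neutralI[of "{0}"]) (auto simp: cunit_def)
  then show "(\<lambda>n. norm (cunit n :: complex)) summable_on UNIV" by (rule has_sum_imp_summable)
  show "((\<lambda>n. cunit n * wave \<omega> n x) has_sum 1) UNIV"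
    by (rule has_sum_finite_neutralI[of "{0}"]) (auto simp: cunit_def)
qed

lemma is_series_cpow: "is_series \<omega> a x u \<Longrightarrow> is_series \<omega> (cpow a j) x (u ^ j)"
  by (induction j) (auto intro: is_series_cunit is_series_conv)

lemma is_series_cstar:
  assumes "is_series \<omega> a x u"
  shows "is_series \<omega> (cstar a) x (cnj u)"
  unfolding is_series_def
proof
  show "(\<lambda>n. norm (cstar a n)) summable_on UNIV"
    using summable_on_reindex_bij_betw[OF bij_uminus, of "\<lambda>n. norm (a n)"] assms
    by (simp add: is_series_def cstar_def)
  have "((\<lambda>n. cnj (a n * wave \<omega> n x)) has_sum cnj u) UNIV"
    using assms unfolding has_sum_cnj_iff is_series_def by blast
  then show "((\<lambda>n. cstar a n * wave \<omega> n x) has_sum cnj u) UNIV"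
    using has_sum_reindex_bij_betw[OF bij_uminus, of "\<lambda>n. cnj (a n * wave \<omega> n x)"]
    by (simp add: cstar_def wave_uminus)
qed

lemma is_series_cmult: "is_series \<omega> a x u \<Longrightarrow> is_series \<omega> (\<lambda>n. z * a n) x (z * u)"
  by (auto simp: is_series_def norm_mult mult.assoc intro: summable_on_cmult_right has_sum_cmult_right)

lemma is_series_add:
  assumes "is_series \<omega> a x u" "is_series \<omega> b x v"
  shows "is_series \<omega> (\<lambda>n. a n + b n) x (u + v)"
  unfolding is_series_def
proof
  have "(\<lambda>n. norm (a n) + norm (b n)) summable_on UNIV"
    using assms by (auto simp: is_series_def intro: summable_on_add)
  then show "(\<lambda>n. norm (a n + b n)) summable_on UNIV"
    by (rule summable_on_comparison_test) (auto intro: norm_triangle_ineq)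
  show "((\<lambda>n. (a n + b n) * wave \<omega> n x) has_sum u + v) UNIV"
    unfolding distrib_right using assms by (intro has_sum_add) (auto simp: is_series_def)
qed

lemma is_series_sum:
  assumes "\<And>i. i \<in> I \<Longrightarrow> is_series \<omega> (a i) x (u i)"
  shows "is_series \<omega> (\<lambda>n. \<Sum>i\<in>I. a i n) x (\<Sum>i\<in>I. u i)"
proof -
  have "is_series \<omega> (\<lambda>n. 0) x 0" by (simp add: is_series_def)
  then show ?thesis
    using assms by (induction I rule: infinite_finite_induct) (auto intro: is_series_add)
qed

lemma is_series_pcoeff:
  assumes "is_series \<omega> a x u"
  shows "is_series \<omega> (pcoeff P a) x (poly2 P u (cnj u))"
proof -
  have "poly2 P u w = (\<Sum>j\<le>degree P. \<Sum>i\<le>degree (coeff P j). coeff (coeff P j) i * (u ^ j * w ^ i))" for w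
    unfolding poly2_def poly_altdef[of P] poly_sum poly_mult poly_power
    by (simp add: poly_altdef[of "coeff P _"] sum_distrib_right sum_distrib_left mult_ac)
  then show ?thesis
    unfolding pcoeff_def[abs_def]
    by (simp only:) (intro is_series_sum is_series_cmult is_series_conv is_series_cpow is_series_cstar assms)
qed

section \<open>Coefficients of classical solutions\<close>

lemma gap_exists:
  fixes E :: "real set"
  assumes "closed E" "s \<in> E" "t \<in> E" "s < x" "x < t" "x \<notin> E"
  shows "\<exists>a b. a \<in> E \<and> b \<in> E \<and> s \<le> a \<and> a < x \<and> x < b \<and> b \<le> t \<and> {a<..<b} \<inter> E = {}"
proof -
  \<comment> \<open>The last point of \<open>E\<close> up to \<open>x\<close> and, next, the first
    one from \<open>x\<close> on; closedness of \<open>E\<close> puts both in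
    \<open>E\<close>.\<close>
  define a where "a = Sup (E \<inter> {s..x})"
  define b where "b = Inf (E \<inter> {x..t})"
  have A: "E \<inter> {s..x} \<noteq> {}" "bdd_above (E \<inter> {s..x})" "closed (E \<inter> {s..x})"
    and B: "E \<inter> {x..t} \<noteq> {}" "bdd_below (E \<inter> {x..t})" "closed (E \<inter> {x..t})"
    using assms by (auto intro!: closed_Int exI[of _ s] exI[of _ t] bdd_above_Int2 bdd_below_Int2)
  have a: "a \<in> E \<inter> {s..x}" unfolding a_def by (rule closed_contains_Sup[OF A])
  have b: "b \<in> E \<inter> {x..t}" unfolding b_def by (rule closed_contains_Inf[OF B])
  have "z \<notin> E" if "a < z" "z < b" for z
  proof
    assume "z \<in> E"
    show False
    proof (cases "z \<le> x")
      case True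
      then have "z \<le> a" unfolding a_def using a \<open>z \<in> E\<close> that A by (intro cSup_upper) auto
      then show False using that by simp
    next
      case False
      then have "b \<le> z" unfolding b_def using b \<open>z \<in> E\<close> that B by (intro cInf_lower) auto
      then show False using that by simp
    qed
  qed
  moreover have "a \<noteq> x" "b \<noteq> x" using a b assms by auto
  ultimately show ?thesis using a b by (intro exI[of _ a] exI[of _ b]) force
qed

lemma set_integral_gap:
  fixes Q q :: "real \<Rightarrow> complex"
  assumes "a \<le> b" "\<And>x. x \<in> {a..b} \<Longrightarrow> (Q has_vector_derivative q x) (at x within {a..b})"
    and "continuous_on {a..b} q"
  shows "(LINT x:{a<..<b}|lborel. q x) = Q b - Q a"
    and "(LINT x:{a..b}|lborel. q x) = Q b - Q a"
proof -
  show *: "(LINT x:{a..b}|lborel. q x) = Q b - Q a"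
    unfolding set_lebesgue_integral_def by (rule integral_FTC_Icc) (use assms in auto)
  show "(LINT x:{a<..<b}|lborel. q x) = Q b - Q a"
    using interval_integral_Icc[OF assms(1), of q] interval_integral_Ioo[of "ereal a" "ereal b" q] assms(1) *
    by simp
qed

text \<open>On \<open>E\<close> the derivatives are controlled pointwise, across the gaps of \<open>E\<close> only the total
  increments are.\<close>

lemma increment_tendsto_zero:
  fixes Q q :: "nat \<Rightarrow> real \<Rightarrow> complex" and E :: "real set"
  assumes st: "s \<le> t" and E: "closed E" "s \<in> E" "t \<in> E"
    and Q: "\<And>N x. x \<in> {s..t} \<Longrightarrow> (Q N has_vector_derivative q N x) (at x within {s..t})"
    and q: "\<And>N. continuous_on {s..t} (q N)"
    and K: "\<And>N x. x \<in> E \<inter> {s..t} \<Longrightarrow> norm (q N x) \<le> K"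
    and lim: "\<And>x. x \<in> E \<inter> {s..t} \<Longrightarrow> (\<lambda>N. q N x) \<longlonglongrightarrow> 0"
    and gap: "\<And>N a b. a \<in> E \<Longrightarrow> b \<in> E \<Longrightarrow> s \<le> a \<Longrightarrow> a < b \<Longrightarrow> b \<le> t \<Longrightarrow> {a<..<b} \<inter> E = {} \<Longrightarrow>
        norm (Q N b - Q N a) \<le> K * (b - a)"
    and gap_lim: "\<And>a b. a \<in> E \<Longrightarrow> b \<in> E \<Longrightarrow> s \<le> a \<Longrightarrow> a < b \<Longrightarrow> b \<le> t \<Longrightarrow> {a<..<b} \<inter> E = {} \<Longrightarrow>
        (\<lambda>N. Q N b - Q N a) \<longlonglongrightarrow> 0"
  shows "(\<lambda>N. Q N t - Q N s) \<longlonglongrightarrow> 0"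
proof -
  define G where "G = {s..t} - E"
  have "\<forall>x\<in>G. \<exists>p. fst p \<in> E \<and> snd p \<in> E \<and> s \<le> fst p \<and> fst p < x \<and> x < snd p \<and> snd p \<le> t \<and> {fst p<..<snd p} \<inter> E = {}"
  proof
    fix x assume "x \<in> G"
    then have "s < x" "x < t" "x \<notin> E" using E by (auto simp: G_def order.order_iff_strict)
    from gap_exists[OF E this] show "\<exists>p. fst p \<in> E \<and> snd p \<in> E \<and> s \<le> fst p \<and> fst p < x \<and> x < snd p \<and> snd p \<le> t \<and> {fst p<..<snd p} \<inter> E = {}"
      by auto
  qed
  from bchoice[OF this] obtain p where p: "\<And>x. x \<in> G \<Longrightarrow> fst (p x) \<in> E \<and> snd (p x) \<in> E \<and> s \<le> fst (p x) \<and>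
    fst (p x) < x \<and> x < snd (p x) \<and> snd (p x) \<le> t \<and> {fst (p x)<..<snd (p x)} \<inter> E = {}" by blast
  define I where "I x = {fst (p x)<..<snd (p x)}" for x
  \<comment> \<open>Two chosen gaps with a common point coincide: their endpoints lie in
    \<open>E\<close>, which no gap meets.\<close>
  have pp: "p y = p x" if x: "x \<in> G" and y: "y \<in> G" and z: "z \<in> I x" "z \<in> I y" for x y z
  proof -
    have "fst (p x) \<notin> I y" "fst (p y) \<notin> I x" "snd (p x) \<notin> I y" "snd (p y) \<notin> I x"
      using p[OF x] p[OF y] unfolding I_def by blast+
    then show ?thesis using z unfolding I_def by (auto simp: prod_eq_iff)
  qed
  have IG: "I x \<subseteq> G" and xI: "x \<in> I x" if "x \<in> G" for x
    using p[OF that] by (auto simp: I_def G_def)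
  have cI: "countable (I ` G)"
  proof (rule countable_disjoint_open_subsets)
    show "disjoint (I ` G)"
      unfolding disjoint_def using pp by (fastforce simp: I_def)
  qed (auto simp: I_def)
  \<comment> \<open>\<open>A i\<close> is the gap with number \<open>i\<close> in an enumeration of
    the countably many disjoint gaps, or empty if no gap has that number.\<close>
  define A where "A i = {x \<in> G. to_nat_on (I ` G) (I x) = i}" for i
  have AI: "A i = I x" if "x \<in> A i" for x i
  proof -
    have x: "x \<in> G" "to_nat_on (I ` G) (I x) = i" using that by (auto simp: A_def)
    show ?thesis
    proof (intro equalityI subsetI)
      fix y assume "y \<in> A i"
      then have y: "y \<in> G" "to_nat_on (I ` G) (I y) = to_nat_on (I ` G) (I x)" using x by (auto simp: A_def)
      then have "I y = I x" using inj_on_to_nat_on[OF cI] x(1) by (auto simp: inj_on_def)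
      then show "y \<in> I x" using xI[OF y(1)] by simp
    next
      fix y assume y: "y \<in> I x"
      then have "y \<in> G" using IG x by blast
      then have "p y = p x" using pp[OF x(1) _ y xI] by blast
      then show "y \<in> A i" using x \<open>y \<in> G\<close> by (auto simp: A_def I_def)
    qed
  qed
  have disj: "i \<noteq> j \<Longrightarrow> A i \<inter> A j = {}" for i j by (auto simp: A_def)
  have UA: "(\<Union>i. A i) = G" by (auto simp: A_def)
  have Acases: "A i = {} \<or> (\<exists>a b. A i = {a<..<b} \<and> a \<in> E \<and> b \<in> E \<and> s \<le> a \<and> a < b \<and> b \<le> t \<and> {a<..<b} \<inter> E = {})" for i
  proof (cases "A i = {}")
    case False
    then obtain x where x: "x \<in> A i" by blast
    then have xG: "x \<in> G" by (simp add: A_def)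
    show ?thesis
      using p[OF xG] AI[OF x] unfolding I_def
      by (intro disjI2 exI[of _ "fst (p x)"] exI[of _ "snd (p x)"]) (meson order.strict_trans)
  qed simp
  have Am [measurable]: "A i \<in> sets lborel" for i
    using Acases[of i] by auto
  have Gm [measurable]: "G \<in> sets lborel" unfolding G_def using E by simp
  have Em [measurable]: "E \<in> sets borel" using E by simp
  have "emeasure lborel G \<le> emeasure lborel {s..t}" by (rule emeasure_mono) (auto simp: G_def)
  then have finG: "emeasure lborel G \<noteq> \<infinity>" using st by (auto simp: top_unique)
  \<comment> \<open>The gaps are disjoint in a bounded interval, so their lengths are summable;
    multiplied by \<open>K\<close> they are the majorant for the limit under the sum.\<close>
  have meas_sum: "summable (\<lambda>i. measure lborel (A i))"
    using measure_UNION[of A lborel] Am disj finG UA by (auto simp: disjoint_family_on_def sums_iff image_subset_iff)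
  have K0: "0 \<le> K" using order_trans[OF norm_ge_zero K[of s 0]] E st by simp
  have int_st: "set_integrable lborel {s..t} (q N)" for N by (rule borel_integrable_atLeastAtMost'[OF q])
  have int_sub: "set_integrable lborel S (q N)" if "S \<subseteq> {s..t}" "S \<in> sets lborel" for S N
    by (rule set_integrable_subset[OF int_st]) (use that in auto)
  have A_int: "(A i = {} \<and> (\<forall>N. (LINT x:A i|lborel. q N x) = 0)) \<or>
      (\<exists>a b. A i = {a<..<b} \<and> a \<in> E \<and> b \<in> E \<and> s \<le> a \<and> a < b \<and> b \<le> t \<and> {a<..<b} \<inter> E = {} \<and>
        (\<forall>N. (LINT x:A i|lborel. q N x) = Q N b - Q N a))" for i
    using Acases[of i]
  proof
    assume "\<exists>a b. A i = {a<..<b} \<and> a \<in> E \<and> b \<in> E \<and> s \<le> a \<and> a < b \<and> b \<le> t \<and> {a<..<b} \<inter> E = {}"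
    then obtain a b where ab: "A i = {a<..<b}" "a \<in> E" "b \<in> E" "s \<le> a" "a < b" "b \<le> t" "{a<..<b} \<inter> E = {}" by blast
    have "(LINT x:{a<..<b}|lborel. q N x) = Q N b - Q N a" for N
    proof (rule set_integral_gap)
      show "continuous_on {a..b} (q N)" by (rule continuous_on_subset[OF q]) (use ab in auto)
      fix x assume "x \<in> {a..b}"
      then show "(Q N has_vector_derivative q N x) (at x within {a..b})"
        by (intro has_vector_derivative_within_subset[OF Q]) (use ab in auto)
    qed (use ab in simp)
    then show ?thesis
      by (intro disjI2 exI[of _ a] exI[of _ b] conjI allI) (use ab in simp_all)
  qed (simp add: set_lebesgue_integral_def)
  \<comment> \<open>Dominated convergence for the sum over the gaps. Inside a gap \<open>q N\<close>
    may be large; only its integral, the increment of \<open>Q N\<close>, is estimated.\<close>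
  have "(\<lambda>N. \<Sum>i. (LINT x:A i|lborel. q N x)) \<longlonglongrightarrow> (\<Sum>i. 0)"
  proof (rule conjunct2[OF conjunct2[OF tannerys_theorem[where M = "\<lambda>i. K * measure lborel (A i)"]]])
    show "(\<lambda>N. (LINT x:A i|lborel. q N x)) \<longlonglongrightarrow> 0" for i
      using A_int[of i]
    proof (elim disjE exE conjE)
      fix a b
      assume ab: "a \<in> E" "b \<in> E" "s \<le> a" "a < b" "b \<le> t" "{a<..<b} \<inter> E = {}"
        and eq: "\<forall>N. (LINT x:A i|lborel. q N x) = Q N b - Q N a"
      show ?thesis using gap_lim[OF ab] eq by simp
    qed simp
    have "norm (LINT x:A i|lborel. q N x) \<le> K * measure lborel (A i)" for i N
      using A_int[of i]
    proof (elim disjE exE conjE)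
      fix a b
      assume ab: "a \<in> E" "b \<in> E" "s \<le> a" "a < b" "b \<le> t" "{a<..<b} \<inter> E = {}"
        and eq: "\<forall>N. (LINT x:A i|lborel. q N x) = Q N b - Q N a" and A: "A i = {a<..<b}"
      show ?thesis using gap[OF ab] eq ab unfolding A by simp
    qed simp
    then show "\<forall>\<^sub>F (i, N) in at_top \<times>\<^sub>F at_top. norm (LINT x:A i|lborel. q N x) \<le> K * measure lborel (A i)"
      by (auto intro: always_eventually)
    show "summable (\<lambda>i. K * measure lborel (A i))" by (intro summable_mult meas_sum)
  qed simp
  moreover have "(\<Sum>i. (LINT x:A i|lborel. q N x)) = (LINT x:G|lborel. q N x)" for N
    using lebesgue_integral_countable_add[of A lborel "q N"] Am disj int_sub[of G] UA by (simp add: G_def)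
  ultimately have gl: "(\<lambda>N. LINT x:G|lborel. q N x) \<longlonglongrightarrow> 0" by simp
  \<comment> \<open>On \<open>E\<close> itself \<open>q N\<close> is bounded by \<open>K\<close> and
    tends to zero pointwise, so ordinary dominated convergence applies.\<close>
  have el: "(\<lambda>N. LINT x:E \<inter> {s..t}|lborel. q N x) \<longlonglongrightarrow> (LINT x::real|lborel. (0::complex))"
    unfolding set_lebesgue_integral_def
  proof -
    have m: "(\<lambda>x. indicator (E \<inter> {s..t}) x *\<^sub>R q N x) \<in> borel_measurable lborel" for N
      using int_sub[of "E \<inter> {s..t}" N] unfolding set_integrable_def by (auto dest: borel_measurable_integrable)
    have i: "integrable lborel (\<lambda>x. K * indicator {s..t} x)"
      using st by (intro integrable_mult_right integrable_real_indicator) auto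
    have l: "AE x in lborel. (\<lambda>N. indicator (E \<inter> {s..t}) x *\<^sub>R q N x) \<longlonglongrightarrow> 0"
      by (rule AE_I2) (use lim in \<open>auto simp: indicator_def\<close>)
    have b: "AE x in lborel. norm (indicator (E \<inter> {s..t}) x *\<^sub>R q N x) \<le> K * indicator {s..t} x" for N
      by (rule AE_I2) (use K K0 in \<open>auto simp: indicator_def\<close>)
    show "(\<lambda>N. LINT x|lborel. indicator (E \<inter> {s..t}) x *\<^sub>R q N x) \<longlonglongrightarrow> (LINT x::real|lborel. (0::complex))"
      by (rule integral_dominated_convergence[OF _ m i l b]) simp
  qed
  have "Q N t - Q N s = (LINT x:E \<inter> {s..t}|lborel. q N x) + (LINT x:G|lborel. q N x)" for N
  proof -
    have "Q N t - Q N s = (LINT x:{s..t}|lborel. q N x)"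
      by (rule set_integral_gap(2)[symmetric]) (use st Q q in auto)
    also have "{s..t} = (E \<inter> {s..t}) \<union> G" by (auto simp: G_def)
    also have "(LINT x:(E \<inter> {s..t}) \<union> G|lborel. q N x) = (LINT x:E \<inter> {s..t}|lborel. q N x) + (LINT x:G|lborel. q N x)"
      by (rule set_integral_Un) (use int_sub Gm in \<open>auto simp: G_def\<close>)
    finally show ?thesis .
  qed
  then show ?thesis using tendsto_add[OF el gl] by simp
qed

section \<open>Scalar equations with a rotating linear part\<close>

lemma exp_has_vector_derivative:
  fixes z :: complex
  shows "((\<lambda>t. exp (of_real t * z)) has_vector_derivative z * exp (of_real t * z)) (at t within S)"
proof -
  have "((\<lambda>w. exp (w * z)) has_field_derivative (z * exp (of_real t * z))) (at (of_real t))"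
    by (auto intro!: derivative_eq_intros simp: mult_ac)
  from has_vector_derivative_real_field[OF has_field_derivative_at_within[OF this]] show ?thesis .
qed

text \<open>The integrating factor exp(t \<mu>) has modulus one and removes the linear term. In the
  second bound the rotation moves the starting value by at most the angle (b - a) |\<mu>| times its
  size, so the linear term is needed at the left endpoint only.\<close>

lemma rotating_ode:
  fixes c f :: "real \<Rightarrow> complex"
  assumes \<mu>: "Re \<mu> = 0" and ab: "a \<le> b"
    and c: "\<And>t. t \<in> {a..b} \<Longrightarrow> (c has_vector_derivative - (\<mu> * c t + f t)) (at t within {a..b})"
    and f: "continuous_on {a..b} f"
  shows rotating_ode_twisted: "norm (exp (of_real b * \<mu>) * c b - exp (of_real a * \<mu>) * c a) \<le> integral {a..b} (\<lambda>t. norm (f t))"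
    and rotating_ode_increment: "norm (c b - c a) \<le> (b - a) * norm (\<mu> * c a) + integral {a..b} (\<lambda>t. norm (f t))"
proof -
  define y where "y t = exp (of_real t * \<mu>) * c t" for t :: real
  have "(y has_vector_derivative - (exp (of_real t * \<mu>) * f t)) (at t within {a..b})" if "t \<in> {a..b}" for t
    unfolding y_def
    using has_vector_derivative_mult[OF exp_has_vector_derivative[of \<mu> t] c[OF that]]
    by (simp add: algebra_simps)
  then have I: "((\<lambda>t. - (exp (of_real t * \<mu>) * f t)) has_integral (y b - y a)) {a..b}"
    by (rule fundamental_theorem_of_calculus[OF ab])
  have "norm (integral {a..b} (\<lambda>t. - (exp (of_real t * \<mu>) * f t))) \<le> integral {a..b} (\<lambda>t. norm (f t))"
  proof (rule Henstock_Kurzweil_Integration.integral_norm_bound_integral)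
    show "(\<lambda>t. norm (f t)) integrable_on {a..b}"
      by (intro integrable_continuous_real continuous_intros f)
  qed (use I \<mu> in \<open>auto simp: norm_mult\<close>)
  then show *: "norm (exp (of_real b * \<mu>) * c b - exp (of_real a * \<mu>) * c a) \<le> integral {a..b} (\<lambda>t. norm (f t))"
    unfolding integral_unique[OF I] by (simp add: y_def)
  have "c b - c a = exp (- of_real b * \<mu>) * (y b - y a) + (exp (of_real (a - b) * \<mu>) - 1) * c a"
  proof -
    have e: "exp (- of_real b * \<mu>) * exp (of_real b * \<mu>) = 1" "exp (- of_real b * \<mu>) * exp (of_real a * \<mu>) = exp (of_real (a - b) * \<mu>)"
      by (simp_all add: exp_add[symmetric] algebra_simps)
    have "exp (- of_real b * \<mu>) * (y b - y a) = (exp (- of_real b * \<mu>) * exp (of_real b * \<mu>)) * c b - (exp (- of_real b * \<mu>) * exp (of_real a * \<mu>)) * c a"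
      by (simp only: y_def right_diff_distrib mult.assoc)
    then show ?thesis unfolding e by (simp add: algebra_simps)
  qed
  then have "norm (c b - c a) \<le> norm (y b - y a) + norm (exp (of_real (a - b) * \<mu>) - 1) * norm (c a)"
    using norm_triangle_ineq[of "exp (- of_real b * \<mu>) * (y b - y a)" "(exp (of_real (a - b) * \<mu>) - 1) * c a"] \<mu>
    by (simp add: norm_mult)
  \<comment> \<open>Taylor remainder of order 0 at a purely imaginary argument: a chord is no longer
    than its arc.\<close>
  moreover have "norm (exp (of_real (a - b) * \<mu>) - 1) \<le> (b - a) * norm \<mu>"
    using Taylor_exp[of "of_real (a - b) * \<mu>" 0] \<mu> ab by (simp add: norm_mult flip: of_real_diff)
  ultimately show "norm (c b - c a) \<le> (b - a) * norm (\<mu> * c a) + integral {a..b} (\<lambda>t. norm (f t))"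
    using * mult_right_mono[of "norm (exp (of_real (a - b) * \<mu>) - 1)" "(b - a) * norm \<mu>" "norm (c a)"]
    by (simp add: y_def norm_mult mult.assoc)
qed

section \<open>Local constancy and a Baire argument\<close>

lemma constant_off_closed:
  fixes H :: "real \<Rightarrow> 'a::t1_space"
  assumes ab: "a \<le> b" and c: "continuous_on {a..b} H"
    and loc: "\<And>x. a < x \<Longrightarrow> x < b \<Longrightarrow> \<exists>V. open V \<and> x \<in> V \<and> (\<forall>y\<in>V \<inter> {a..b}. H y = H x)"
  shows "H a = H b"
proof (cases "a = b")
  case False
  then have ab: "a < b" using ab by simp
  define z where "z = (a + b) / 2"
  have z: "z \<in> {a<..<b}" using ab by (simp add: z_def)
  have eq: "H x = H z" if "x \<in> {a<..<b}" for x
  proof (rule connected_local_const[of "{a<..<b}"])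
    show "\<forall>x\<in>{a<..<b}. \<forall>\<^sub>F y in at x within {a<..<b}. H x = H y"
    proof
      fix x assume "x \<in> {a<..<b}"
      then obtain V where V: "open V" "x \<in> V" "\<forall>y\<in>V \<inter> {a..b}. H y = H x" using loc by auto
      then show "\<forall>\<^sub>F y in at x within {a<..<b}. H x = H y"
        unfolding eventually_at_topological by (intro exI[of _ V]) auto
    qed
  qed (use that z in auto)
  \<comment> \<open>Local constancy is available only in the open interval; the endpoints, which may
    be exceptional times, are reached by continuity.\<close>
  have "H a = H z" "H b = H z"
    using continuous_constant_on_closure[of "{a<..<b}" H "H z"] ab c eq by auto
  then show ?thesis by simp
qed simp

text \<open>If boundedness failed near every point of \<open>E\<close>, the relatively open sets
  where some \<open>g i\<close> exceeds a given number would all be dense in \<open>E\<close>, and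
  so would their intersection, which is empty by pointwise boundedness.\<close>

lemma baire_bounded:
  fixes E :: "real set" and g :: "'i \<Rightarrow> real \<Rightarrow> real"
  assumes E: "closed E" "E \<noteq> {}"
    and g: "\<And>i. continuous_on E (g i)"
    and bd: "\<And>t. t \<in> E \<Longrightarrow> \<exists>M::nat. \<forall>i. g i t \<le> M"
  shows "\<exists>t\<in>E. \<exists>e>0. \<exists>M::nat. \<forall>r\<in>E \<inter> ball t e. \<forall>i. g i r \<le> M"
proof (rule ccontr)
  assume neg: "\<not> ?thesis"
  define G where "G M = (\<Union>i. E \<inter> g i -` {real M<..})" for M :: nat
  have "E \<subseteq> closure (\<Inter>(range G))"
  proof (rule Baire[OF E(1)])
    fix T assume "T \<in> range G"
    then obtain M where T: "T = G M" by (rule rangeE)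
    have "E \<subseteq> closure (G M)"
    proof
      fix t assume t: "t \<in> E"
      show "t \<in> closure (G M)"
        unfolding closure_approachable
      proof (intro allI impI)
        fix e :: real assume "0 < e"
        have "\<not> (\<forall>r\<in>E \<inter> ball t e. \<forall>i. g i r \<le> real M)"
        proof
          assume "\<forall>r\<in>E \<inter> ball t e. \<forall>i. g i r \<le> real M"
          with neg show False by (elim notE) (rule bexI[OF _ t], rule exI[of _ e], rule conjI[OF \<open>e > 0\<close>], rule exI[of _ M])
        qed
        then obtain r i where "r \<in> E \<inter> ball t e" "\<not> g i r \<le> M" by meson
        then have "r \<in> G M" "dist r t < e" unfolding G_def by (auto simp: dist_commute not_le)
        then show "\<exists>y\<in>G M. dist y t < e" by blast
      qed
    qed
    moreover have "openin (top_of_set E) (G M)"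
      unfolding G_def
    proof (rule openin_Union)
      fix S assume "S \<in> range (\<lambda>i. E \<inter> g i -` {real M<..})"
      then obtain i where "S = E \<inter> g i -` {real M<..}" by blast
      then show "openin (top_of_set E) S"
        using continuous_openin_preimage_gen[OF g[of i] open_greaterThan[of "real M"]] by simp
    qed
    ultimately show "openin (top_of_set E) T \<and> E \<subseteq> closure T" using T by blast
  qed simp
  moreover have "\<Inter>(range G) = {}"
  proof -
    have "t \<notin> \<Inter>(range G)" for t
    proof
      assume t: "t \<in> \<Inter>(range G)"
      then have tG: "t \<in> G M" for M by blast
      from tG[of 0] have "t \<in> E" unfolding G_def by blast
      from bd[OF this] obtain M :: nat where "\<forall>i. g i t \<le> M" ..
      then have "t \<notin> G M" by (auto simp: G_def not_less)
      then show False using tG by blast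
    qed
    then show ?thesis by blast
  qed
  ultimately show False using E(2) by simp
qed

section \<open>Window means of evolving wave series\<close>

lemma mean_has_vector_derivative:
  fixes u ut :: "real \<Rightarrow> real \<Rightarrow> complex"
  assumes "\<And>t. t \<in> {a..b} \<Longrightarrow> continuous_on UNIV (u t)"
    and "\<And>t x. t \<in> {a..b} \<Longrightarrow> ((\<lambda>r. u r x) has_vector_derivative ut t x) (at t within {a..b})"
    and ut: "continuous_on ({a..b} \<times> UNIV) (\<lambda>(t, x). ut t x)"
    and t: "t \<in> {a..b}"
  shows "((\<lambda>t. mean \<omega> (u t) n N) has_vector_derivative mean \<omega> (ut t) n N) (at t within {a..b})"
    and "continuous_on {a..b} (\<lambda>t. mean \<omega> (ut t) n N)"
proof -
  have "continuous_on ({a..b} \<times> cbox (-N) N) (\<lambda>z. ut (fst z) (snd z) * cnj (wave \<omega> n (snd z)))"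
    by (intro continuous_intros continuous_on_subset[OF ut[unfolded case_prod_beta]]) auto
  then have c: "continuous_on ({a..b} \<times> cbox (-N) N) (\<lambda>(t, x). ut t x * cnj (wave \<omega> n x))"
    by (simp add: case_prod_beta)
  \<comment> \<open>Differentiation under the integral: on a bounded window the joint continuity of
    \<open>ut\<close> suffices, without a bound uniform in x.\<close>
  have "((\<lambda>t. integral (cbox (-N) N) (\<lambda>x. u t x * cnj (wave \<omega> n x))) has_vector_derivative
      integral (cbox (-N) N) (\<lambda>x. ut t x * cnj (wave \<omega> n x))) (at t within {a..b})"
  proof (rule leibniz_rule_vector_derivative[OF _ _ c t])
    show "((\<lambda>t. u t x * cnj (wave \<omega> n x)) has_vector_derivative ut t x * cnj (wave \<omega> n x)) (at t within {a..b})"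
      if "t \<in> {a..b}" for t x
      by (intro has_vector_derivative_mult_left assms(2) that)
    show "(\<lambda>x. u t x * cnj (wave \<omega> n x)) integrable_on cbox (- N) N" if "t \<in> {a..b}" for t
      by (intro integrable_continuous continuous_intros continuous_on_subset[OF assms(1)[OF that]]) auto
  qed auto
  then show "((\<lambda>t. mean \<omega> (u t) n N) has_vector_derivative mean \<omega> (ut t) n N) (at t within {a..b})"
    unfolding mean_def by (intro has_vector_derivative_mult_right) simp
  show "continuous_on {a..b} (\<lambda>t. mean \<omega> (ut t) n N)"
    unfolding mean_def using integral_continuous_on_param[OF c] by (intro continuous_intros) simp
qed

lemma has_sum_norm_le:
  fixes f :: "'i \<Rightarrow> 'a::banach"
  assumes "(f has_sum S) UNIV" "\<And>F. finite F \<Longrightarrow> (\<Sum>n\<in>F. norm (f n)) \<le> M"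
  shows "norm S \<le> M"
proof (rule tendsto_upperbound)
  show "((\<lambda>F. norm (sum f F)) \<longlongrightarrow> norm S) (finite_subsets_at_top UNIV)"
    using assms(1) by (auto simp: has_sum_def intro: tendsto_norm)
  show "\<forall>\<^sub>F F in finite_subsets_at_top UNIV. norm (sum f F) \<le> M"
    by (rule eventually_finite_subsets_at_top_weakI) (rule order_trans[OF norm_sum assms(2)])
qed simp

lemma finite_sum_le_total:
  fixes f :: "'i \<Rightarrow> real"
  assumes "f summable_on UNIV" "infsum f UNIV \<le> C" "\<And>n. 0 \<le> f n" "finite F"
  shows "sum f F \<le> C"
  using finite_sum_le_infsum[OF assms(1,4)] assms(2,3) by force

text \<open>\<open>ut\<close> is not assumed to be bounded in \<open>x\<close>, nor is the sum over \<open>n\<close> of the terms \<open>\<mu> n * c t n\<close> bounded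
  uniformly in \<open>t\<close>.\<close>

locale series_evolution =
  fixes \<omega> :: "real ^ 'nu::finite" and \<mu> :: "int ^ 'nu \<Rightarrow> complex"
    and c f :: "real \<Rightarrow> int ^ 'nu \<Rightarrow> complex" and u ut :: "real \<Rightarrow> real \<Rightarrow> complex"
    and p q C :: real
  assumes ind: "int_independent \<omega>"
    and \<mu>: "\<And>n. Re (\<mu> n) = 0"
    and c_summable: "\<And>t. t \<in> {p..q} \<Longrightarrow> (\<lambda>n. norm (c t n)) summable_on UNIV"
    and c_cont: "\<And>n. continuous_on {p..q} (\<lambda>t. c t n)"
    and f_cont: "\<And>n. continuous_on {p..q} (\<lambda>t. f t n)"
    and f_summable: "\<And>t. t \<in> {p..q} \<Longrightarrow> (\<lambda>n. norm (f t n)) summable_on UNIV"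
    and f_bound: "\<And>t. t \<in> {p..q} \<Longrightarrow> (\<Sum>\<^sub>\<infinity>n. norm (f t n)) \<le> C"
    and \<mu>c_summable: "\<And>t. t \<in> {p..q} \<Longrightarrow> (\<lambda>n. norm (\<mu> n * c t n)) summable_on UNIV"
    and u_sum: "\<And>t x. t \<in> {p..q} \<Longrightarrow> ((\<lambda>n. c t n * wave \<omega> n x) has_sum u t x) UNIV"
    and ut_cont: "continuous_on ({p..q} \<times> UNIV) (\<lambda>(t, x). ut t x)"
    and u_deriv: "\<And>t x. t \<in> {p..q} \<Longrightarrow> ((\<lambda>r. u r x) has_vector_derivative ut t x) (at t within {p..q})"
    and ut_sum: "\<And>t x. t \<in> {p..q} \<Longrightarrow> ((\<lambda>n. - (\<mu> n * c t n + f t n) * wave \<omega> n x) has_sum ut t x) UNIV"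
begin

definition d where "d n t = \<mu> n * c t n + f t n"

text \<open>The integrated equation for frequency \<open>n\<close> says that \<open>H n\<close> is
  constant, which makes sense before \<open>c\<close> is known to be differentiable in time.\<close>

definition H where "H n t = c t n + integral {p..t} (d n)"

lemma d_cont: "continuous_on {p..q} (d n)"
  unfolding d_def by (intro continuous_intros c_cont f_cont)

lemma d_integral_deriv:
  "t \<in> {p..q} \<Longrightarrow> ((\<lambda>t. integral {p..t} (d n)) has_vector_derivative d n t) (at t within {p..q})"
  by (rule integral_has_vector_derivative[OF d_cont])

lemma H_cont: "continuous_on {p..q} (H n)"
  unfolding H_def
  by (intro continuous_intros c_cont indefinite_integral_continuous_1 integrable_continuous_real d_cont)

lemma f_sum_le: "t \<in> {p..q} \<Longrightarrow> finite F \<Longrightarrow> (\<Sum>n\<in>F. norm (f t n)) \<le> C"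
  by (rule finite_sum_le_total[OF f_summable f_bound]) auto

lemma d_summable: "t \<in> {p..q} \<Longrightarrow> (\<lambda>n. norm (d n t)) summable_on UNIV"
  unfolding d_def
  by (rule summable_on_comparison_test[OF summable_on_add[OF \<mu>c_summable f_summable]])
    (auto intro: norm_triangle_ineq)

lemma u_cont: "t \<in> {p..q} \<Longrightarrow> continuous_on UNIV (u t)"
  by (rule wave_series_continuous[OF c_summable u_sum])

lemma ut_cont_x: "t \<in> {p..q} \<Longrightarrow> continuous_on UNIV (ut t)"
proof (rule wave_series_continuous[of "\<lambda>n. - d n t"])
  assume t: "t \<in> {p..q}"
  show "(\<lambda>n. norm (- d n t)) summable_on UNIV" using d_summable[OF t] by simp
  show "((\<lambda>n. - d n t * wave \<omega> n x) has_sum ut t x) UNIV" for x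
    using ut_sum[OF t] unfolding d_def .
qed

lemma c_deriv_of_constant_H:
  assumes ab: "{a..b} \<subseteq> {p..q}" and H: "\<And>t. t \<in> {a..b} \<Longrightarrow> H n t = H n a" and t: "t \<in> {a..b}"
  shows "((\<lambda>t. c t n) has_vector_derivative - (\<mu> n * c t n + f t n)) (at t within {a..b})"
proof -
  have D: "((\<lambda>t. H n a - integral {p..t} (d n)) has_vector_derivative (0 - d n t)) (at t within {a..b})"
    by (intro has_vector_derivative_diff has_vector_derivative_const
        has_vector_derivative_within_subset[OF d_integral_deriv ab]) (use ab t in auto)
  have "c r n = H n a - integral {p..r} (d n)" if "r \<in> {a..b}" for r
    using H[OF that] by (simp add: H_def algebra_simps)
  from has_vector_derivative_transform[OF t this D] show ?thesis
    by (simp add: d_def)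
qed

text \<open>The linear part is charged only at the left endpoint, where \<open>M\<close> bounds it;
  afterwards it merely rotates, and the forcing adds at most \<open>C\<close> per unit time. This is
  the estimate used across a gap.\<close>

lemma increment_sum_le:
  assumes ab: "a \<le> b" "{a..b} \<subseteq> {p..q}" and H: "\<And>n t. t \<in> {a..b} \<Longrightarrow> H n t = H n a"
    and M: "\<And>F. finite F \<Longrightarrow> (\<Sum>n\<in>F. norm (\<mu> n * c a n)) \<le> M" and F: "finite F"
  shows "(\<Sum>n\<in>F. norm (c b n - c a n)) \<le> (M + C) * (b - a)"
proof -
  have fc: "continuous_on {a..b} (\<lambda>t. f t n)" for n
    by (rule continuous_on_subset[OF f_cont ab(2)])
  have "(\<Sum>n\<in>F. norm (c b n - c a n)) \<le> (\<Sum>n\<in>F. (b - a) * norm (\<mu> n * c a n) + integral {a..b} (\<lambda>t. norm (f t n)))"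
    by (intro sum_mono rotating_ode_increment[OF \<mu> ab(1) c_deriv_of_constant_H[OF ab(2) H] fc])
  also have "\<dots> = (b - a) * (\<Sum>n\<in>F. norm (\<mu> n * c a n)) + integral {a..b} (\<lambda>t. \<Sum>n\<in>F. norm (f t n))"
    by (subst integral_sum)
      (auto simp: sum.distrib sum_distrib_left intro!: F integrable_continuous_real continuous_intros fc)
  also have "\<dots> \<le> (b - a) * M + integral {a..b} (\<lambda>t. C)"
    by (intro add_mono mult_left_mono M F integral_le integrable_continuous_real continuous_intros fc f_sum_le)
      (use ab in auto)
  also have "\<dots> = (M + C) * (b - a)" using ab by (simp add: algebra_simps)
  finally show ?thesis .
qed

text \<open>The functions \<open>Q i\<close> below are window means of \<open>u\<close> plus \<open>integral {p..t} (d n)\<close>; they converge to \<open>H n\<close>.\<close>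

lemma H_step:
  assumes E: "closed E" and Epq: "E \<subseteq> {p..q}"
    and M: "\<And>r F. r \<in> E \<Longrightarrow> a \<le> r \<Longrightarrow> r \<le> b \<Longrightarrow> finite F \<Longrightarrow> (\<Sum>n\<in>F. norm (\<mu> n * c r n)) \<le> M"
    and gapH: "\<And>n x y. a \<le> x \<Longrightarrow> x \<le> y \<Longrightarrow> y \<le> b \<Longrightarrow> {x<..<y} \<inter> E = {} \<Longrightarrow> H n x = H n y"
    and ab: "a \<in> E" "b \<in> E" "a \<le> b"
  shows "H n a = H n b"
proof -
  have sub: "{a..b} \<subseteq> {p..q}" using ab Epq by auto
  \<comment> \<open>The window mean and the primitive of \<open>d n\<close> each contribute
    \<open>M + C\<close>, both to the derivative on \<open>E\<close> and to the increment per unit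
    length across a gap.\<close>
  define K where "K = 2 * (M + C)"
  have C0: "0 \<le> C" using f_sum_le[of a "{}"] ab Epq by auto
  have M0: "0 \<le> M" using M[of a "{}"] ab by auto
  have dM: "(\<Sum>n\<in>F. norm (d n r)) \<le> M + C" if r: "r \<in> E \<inter> {a..b}" and F: "finite F" for r F
  proof -
    have "(\<Sum>n\<in>F. norm (d n r)) \<le> (\<Sum>n\<in>F. norm (\<mu> n * c r n) + norm (f r n))"
      unfolding d_def by (intro sum_mono norm_triangle_ineq)
    also have "\<dots> \<le> M + C"
      unfolding sum.distrib using r sub F by (intro add_mono M f_sum_le) auto
    finally show ?thesis .
  qed
  have inc: "(\<Sum>n\<in>F. norm (c y n - c x n)) \<le> (M + C) * (y - x)"
    and incH: "H n x = H n y"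
    if "x \<in> E" "y \<in> E" "a \<le> x" "x < y" "y \<le> b" "{x<..<y} \<inter> E = {}" "finite F" for x y F n
  proof -
    show "H n x = H n y" using gapH that by force
    show "(\<Sum>n\<in>F. norm (c y n - c x n)) \<le> (M + C) * (y - x)"
    proof (rule increment_sum_le)
      show "H n t = H n x" if "t \<in> {x..y}" for n t
        using gapH[of x t n] \<open>{x<..<y} \<inter> E = {}\<close> that \<open>a \<le> x\<close> \<open>y \<le> b\<close> by force
      show "(\<Sum>n\<in>F. norm (\<mu> n * c x n)) \<le> M" if "finite F" for F
        using M[of x F] that \<open>x \<in> E\<close> \<open>a \<le> x\<close> \<open>x < y\<close> \<open>y \<le> b\<close> by simp
    qed (use that sub in auto)
  qed
  \<comment> \<open>Windows start at half-width 1, since \<open>norm_mean_le\<close> needs a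
    positive one.\<close>
  define N where "N i = real (Suc i)" for i
  have Nlim: "filterlim N at_top sequentially"
    unfolding N_def by (rule filterlim_compose[OF filterlim_real_sequentially filterlim_Suc])
  define Q where "Q i t = mean \<omega> (u t) n (N i) + integral {p..t} (d n)" for i t
  have Qlim: "(\<lambda>i. Q i t) \<longlonglongrightarrow> H n t" if "t \<in> {p..q}" for t
    unfolding Q_def H_def
    by (intro tendsto_intros filterlim_compose[OF mean_tendsto[OF ind c_summable u_sum] Nlim] that)
  have "(\<lambda>i. Q i b - Q i a) \<longlonglongrightarrow> 0"
  proof (rule increment_tendsto_zero[OF ab(3) E ab(1,2)])
    fix i t assume t: "t \<in> {a..b}"
    then have tpq: "t \<in> {p..q}" using sub by auto
    show "(Q i has_vector_derivative mean \<omega> (ut t) n (N i) + d n t) (at t within {a..b})"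
      unfolding Q_def
      by (rule has_vector_derivative_within_subset[OF _ sub],
          intro has_vector_derivative_add d_integral_deriv tpq mean_has_vector_derivative(1) u_cont u_deriv ut_cont)
  next
    fix i
    have "continuous_on {p..q} (\<lambda>t. mean \<omega> (ut t) n (N i) + d n t)"
      using sub ab
      by (intro continuous_intros d_cont mean_has_vector_derivative(2)[of _ _ u ut a] u_cont u_deriv ut_cont) auto
    then show "continuous_on {a..b} (\<lambda>t. mean \<omega> (ut t) n (N i) + d n t)"
      by (rule continuous_on_subset[OF _ sub])
  next
    fix i t assume t: "t \<in> E \<inter> {a..b}"
    then have tpq: "t \<in> {p..q}" using sub by auto
    \<comment> \<open>At times in \<open>E\<close> the bound \<open>M\<close> holds for all finite
      partial sums, so \<open>ut t\<close> is bounded in x; this is not known at other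
      times.\<close>
    have "norm (ut t x) \<le> M + C" for x
      by (rule has_sum_norm_le[OF ut_sum[OF tpq]]) (use dM[OF t] in \<open>simp only: norm_mult norm_minus_cancel norm_wave mult_1_right d_def\<close>)
    then have "norm (mean \<omega> (ut t) n (N i)) \<le> M + C"
      by (intro norm_mean_le ut_cont_x tpq) (auto simp: N_def)
    moreover have "norm (d n t) \<le> M + C" using dM[OF t, of "{n}"] by simp
    ultimately show "norm (mean \<omega> (ut t) n (N i) + d n t) \<le> K"
      unfolding K_def by (intro order_trans[OF norm_triangle_ineq]) simp
  next
    fix t assume t: "t \<in> E \<inter> {a..b}"
    then have tpq: "t \<in> {p..q}" using sub by auto
    have "(mean \<omega> (ut t) n \<longlongrightarrow> - d n t) at_top"
    proof (rule mean_tendsto[OF ind, of "\<lambda>n. - d n t"])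
      show "(\<lambda>n. norm (- d n t)) summable_on UNIV" using d_summable[OF tpq] by simp
      show "((\<lambda>n. - d n t * wave \<omega> n x) has_sum ut t x) UNIV" for x
        using ut_sum[OF tpq] unfolding d_def .
    qed
    from tendsto_add[OF filterlim_compose[OF this Nlim] tendsto_const[of "d n t"]]
    show "(\<lambda>i. mean \<omega> (ut t) n (N i) + d n t) \<longlonglongrightarrow> 0" by simp
  next
    fix i x y
    assume xy: "x \<in> E" "y \<in> E" "a \<le> x" "x < y" "y \<le> b" "{x<..<y} \<inter> E = {}"
    then have xpq: "x \<in> {p..q}" "y \<in> {p..q}" using Epq by auto
    \<comment> \<open>The mean for a single frequency sees the whole function, so the increments of
      all coefficients together are needed to bound \<open>u y - u x\<close> in the sup
      norm.\<close>
    have "norm (u y z - u x z) \<le> (M + C) * (y - x)" for z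
    proof (rule has_sum_norm_le)
      show "((\<lambda>n. (c y n - c x n) * wave \<omega> n z) has_sum (u y z - u x z)) UNIV"
        unfolding left_diff_distrib
        using has_sum_add[OF u_sum[OF xpq(2)] has_sum_uminusI[OF u_sum[OF xpq(1)]]] by simp
    qed (use inc[OF xy] in \<open>simp add: norm_mult\<close>)
    then have "norm (mean \<omega> (\<lambda>z. u y z - u x z) n (N i)) \<le> (M + C) * (y - x)"
      by (intro norm_mean_le continuous_intros u_cont xpq) (auto simp: N_def)
    then have 1: "norm (mean \<omega> (u y) n (N i) - mean \<omega> (u x) n (N i)) \<le> (M + C) * (y - x)"
      by (simp only: mean_diff[OF u_cont[OF xpq(2)] u_cont[OF xpq(1)]])
    have "integral {p..y} (d n) - integral {p..x} (d n) = - (c y n - c x n)"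
      using incH[OF xy, of "{}" n] by (simp add: H_def algebra_simps)
    then have 2: "norm (integral {p..y} (d n) - integral {p..x} (d n)) \<le> (M + C) * (y - x)"
      using inc[OF xy, of "{n}"] by (simp add: norm_minus_commute)
    have "Q i y - Q i x = (mean \<omega> (u y) n (N i) - mean \<omega> (u x) n (N i)) + (integral {p..y} (d n) - integral {p..x} (d n))"
      by (simp add: Q_def)
    then have "norm (Q i y - Q i x) \<le> (M + C) * (y - x) + (M + C) * (y - x)"
      using 1 2 by (simp only:) (intro norm_triangle_le add_mono)
    then show "norm (Q i y - Q i x) \<le> K * (y - x)"
      by (simp add: K_def algebra_simps)
  next
    fix x y
    assume xy: "x \<in> E" "y \<in> E" "a \<le> x" "x < y" "y \<le> b" "{x<..<y} \<inter> E = {}"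
    then have xpq: "x \<in> {p..q}" "y \<in> {p..q}" using Epq by auto
    show "(\<lambda>i. Q i y - Q i x) \<longlonglongrightarrow> 0"
      using tendsto_diff[OF Qlim[OF xpq(2)] Qlim[OF xpq(1)]] incH[OF xy, of "{}" n] by simp
  qed
  moreover have "(\<lambda>i. Q i b - Q i a) \<longlonglongrightarrow> H n b - H n a"
    using ab sub by (intro tendsto_diff Qlim) auto
  ultimately have "H n b - H n a = 0" by (rule LIMSEQ_unique[rotated])
  then show ?thesis by simp
qed

lemma H_const:
  assumes "t \<in> {p..q}"
  shows "H n t = H n p"
proof -
  \<comment> \<open>Constancy is demanded for all \<open>n\<close> on the same open set, because the
    estimate across a gap uses the equation for every frequency at once.\<close>
  define W where "W = \<Union>{V. open V \<and> (\<forall>n. \<forall>a\<in>V \<inter> {p..q}. \<forall>b\<in>V \<inter> {p..q}. H n a = H n b)}"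
  define E where "E = {p..q} - W"
  have E: "closed E" unfolding E_def W_def by (intro closed_Diff open_Union) auto
  have Epq: "E \<subseteq> {p..q}" by (auto simp: E_def)
  have gap: "H n x = H n y" if "p \<le> x" "x \<le> y" "y \<le> q" "{x<..<y} \<inter> E = {}" for n x y
  proof (rule constant_off_closed[OF that(2)])
    show "continuous_on {x..y} (H n)" by (rule continuous_on_subset[OF H_cont]) (use that in auto)
    fix z assume z: "x < z" "z < y"
    then have "z \<in> W" using that unfolding E_def by force
    then obtain V where V: "open V" "z \<in> V" "\<And>n a b. a \<in> V \<inter> {p..q} \<Longrightarrow> b \<in> V \<inter> {p..q} \<Longrightarrow> H n a = H n b"
      unfolding W_def by blast
    show "\<exists>V. open V \<and> z \<in> V \<and> (\<forall>y\<in>V \<inter> {x..y}. H n y = H n z)"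
      by (rule exI[of _ V]) (use V(1,2) that z in \<open>auto intro!: V(3)\<close>)
  qed
  have "E = {}"
  proof (rule ccontr)
    assume ne: "E \<noteq> {}"
    \<comment> \<open>The full sum over frequencies need not be continuous in time, but its finite
      partial sums are, and the Baire argument is applied to this family. Infinite index sets are
      sent to the empty sum.\<close>
    define g where "g F r = (\<Sum>n\<in>F. norm (\<mu> n * c r n))" for F :: "(int ^ 'nu) set" and r
    have "\<exists>t\<in>E. \<exists>e>0. \<exists>M::nat. \<forall>r\<in>E \<inter> ball t e. \<forall>F. g (if finite F then F else {}) r \<le> M"
    proof (rule baire_bounded[OF E ne])
      show "continuous_on E (g (if finite F then F else {}))" for F
        unfolding g_def by (intro continuous_intros continuous_on_subset[OF c_cont Epq])
      fix t assume "t \<in> E"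
      then have t: "t \<in> {p..q}" using Epq by auto
      obtain M :: nat where M: "(\<Sum>\<^sub>\<infinity>n. norm (\<mu> n * c t n)) \<le> M" using real_arch_simple by blast
      show "\<exists>M::nat. \<forall>F. g (if finite F then F else {}) t \<le> M"
        unfolding g_def
        by (intro exI[of _ M] allI finite_sum_le_total[OF \<mu>c_summable[OF t] M]) auto
    qed
    then obtain t e M where t: "t \<in> E" "0 < e"
      and M': "\<And>r F. r \<in> E \<inter> ball t e \<Longrightarrow> g (if finite F then F else {}) r \<le> real M" by blast
    have M: "(\<Sum>n\<in>F. norm (\<mu> n * c r n)) \<le> real M" if "r \<in> E" "r \<in> ball t e" "finite F" for r F
      using M'[of r F] that by (simp add: g_def)
    have le: "H n a = H n b" if ab: "a \<in> ball t e \<inter> {p..q}" "b \<in> ball t e \<inter> {p..q}" "a \<le> b" for n a b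
    proof (cases "E \<inter> {a..b} = {}")
      case True
      then have "{a<..<b} \<inter> E = {}" by (auto simp: less_imp_le)
      then show ?thesis using gap ab by auto
    next
      case False
      \<comment> \<open>With \<open>b'\<close>, the first and last exceptional times in
        \<open>{a..b}\<close>: outside them \<open>gap\<close> applies, between them
        \<open>H_step\<close>.\<close>
      define a' where "a' = Inf (E \<inter> {a..b})"
      define b' where "b' = Sup (E \<inter> {a..b})"
      have A: "bdd_below (E \<inter> {a..b})" "bdd_above (E \<inter> {a..b})" "closed (E \<inter> {a..b})"
        using E by (auto intro!: closed_Int bdd_above_Int2 bdd_below_Int2)
      have a': "a' \<in> E \<inter> {a..b}" unfolding a'_def by (rule closed_contains_Inf[OF False A(1,3)])
      have b': "b' \<in> E \<inter> {a..b}" unfolding b'_def by (rule closed_contains_Sup[OF False A(2,3)])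
      have lo: "a' \<le> z" and hi: "z \<le> b'" if "z \<in> E" "a \<le> z" "z \<le> b" for z
        unfolding a'_def b'_def using that A by (auto intro: cInf_lower cSup_upper)
      have sub: "z \<in> ball t e" if "a \<le> z" "z \<le> b" for z
        using ab that by (auto simp: dist_real_def)
      have "H n a = H n a'"
        by (rule gap) (use a' ab lo in force)+
      moreover have "H n b' = H n b"
        by (rule gap) (use b' ab hi in force)+
      moreover have "H n a' = H n b'"
      proof (rule H_step[OF E Epq])
        show "(\<Sum>n\<in>F. norm (\<mu> n * c r n)) \<le> real M" if "r \<in> E" "a' \<le> r" "r \<le> b'" "finite F" for r F
          using M[of r F] sub[of r] that a' b' by auto
        show "H n x = H n y" if "a' \<le> x" "x \<le> y" "y \<le> b'" "{x<..<y} \<inter> E = {}" for n x y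
          by (rule gap) (use that a' b' Epq in auto)
      qed (use a' b' lo in auto)
      ultimately show ?thesis by simp
    qed
    have "H n a = H n b" if ab: "a \<in> ball t e \<inter> {p..q}" "b \<in> ball t e \<inter> {p..q}" for n a b
    proof (cases "a \<le> b")
      case True then show ?thesis by (rule le[OF ab])
    next
      case False then show ?thesis by (intro le[OF ab(2,1), symmetric]) simp
    qed
    then have "ball t e \<subseteq> W" unfolding W_def by (intro Union_upper CollectI conjI open_ball) blast
    then have "t \<in> W" using t(2) by auto
    then show False using t(1) by (simp add: E_def)
  qed
  then show ?thesis using gap[of p t n] assms by auto
qed

lemma coefficient_ode:
  "t \<in> {p..q} \<Longrightarrow> ((\<lambda>t. c t n) has_vector_derivative - (\<mu> n * c t n + f t n)) (at t within {p..q})"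
  by (rule c_deriv_of_constant_H) (auto intro: H_const)

end

section \<open>The coefficient system\<close>

text \<open>Since the supremum over time stands inside the sum, a separate nearly maximal time
  \<open>\<tau> n\<close> is chosen for each frequency; finite sums along such a choice are bounded
  by \<open>R\<close> and pass to the limit.\<close>

lemma tame_limit:
  assumes J: "J \<noteq> {}" and c: "\<And>j::nat. tame J s (c j) R"
    and lim: "\<And>t n. t \<in> J \<Longrightarrow> (\<lambda>j. c j t n) \<longlonglongrightarrow> c' t n"
  shows "tame J s c' R"
proof -
  define w where "w t n = exp (s t * norm (int_vec n))" for t and n :: "int ^ 'a"
  have fin: "(\<Sum>n\<in>X. norm (c' (\<tau> n) n) * w (\<tau> n) n) \<le> R" if "finite X" "\<And>n. \<tau> n \<in> J" for X \<tau>
  proof (rule LIMSEQ_le_const2)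
    show "(\<lambda>j. \<Sum>n\<in>X. norm (c j (\<tau> n) n) * w (\<tau> n) n) \<longlonglongrightarrow> (\<Sum>n\<in>X. norm (c' (\<tau> n) n) * w (\<tau> n) n)"
      by (intro tendsto_intros lim that)
    have "(\<Sum>n\<in>X. norm (c j (\<tau> n) n) * w (\<tau> n) n) \<le> R" for j
    proof -
      obtain \<alpha> where a: "\<And>n. 0 \<le> \<alpha> n" "\<alpha> summable_on UNIV" "infsum \<alpha> UNIV \<le> R"
        "\<And>t n. t \<in> J \<Longrightarrow> norm (c j t n) * exp (s t * norm (int_vec n)) \<le> \<alpha> n"
        by (rule tameE[OF c[of j]]) (rule that; blast)
      have "(\<Sum>n\<in>X. norm (c j (\<tau> n) n) * w (\<tau> n) n) \<le> sum \<alpha> X"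
        unfolding w_def by (intro sum_mono a(4) that)
      also have "\<dots> \<le> R" by (rule finite_sum_le_total[OF a(2,3,1) that(1)])
      finally show ?thesis .
    qed
    then show "\<exists>N. \<forall>j\<ge>N. (\<Sum>n\<in>X. norm (c j (\<tau> n) n) * w (\<tau> n) n) \<le> R" by blast
  qed
  define \<alpha> where "\<alpha> n = (SUP t\<in>J. norm (c' t n) * w t n)" for n
  have bdd: "bdd_above ((\<lambda>t. norm (c' t n) * w t n) ` J)" for n
    by (rule bdd_aboveI2[of _ _ R]) (use fin[of "{n}" "\<lambda>_. _"] in simp)
  have le: "norm (c' t n) * w t n \<le> \<alpha> n" if "t \<in> J" for t n
    unfolding \<alpha>_def by (rule cSUP_upper[OF that bdd])
  obtain t0 where t0: "t0 \<in> J" using J by blast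
  have nonneg: "0 \<le> \<alpha> n" for n
    using le[OF t0, of n] by (rule order_trans[rotated]) (simp add: w_def)
  have sums: "sum \<alpha> X \<le> R" if X: "finite X" for X
  proof (rule field_le_epsilon)
    fix e :: real assume e: "0 < e"
    \<comment> \<open>The error \<open>e\<close> is shared among the terms of \<open>X\<close>; the
      added 1 keeps the denominator positive when \<open>X\<close> is empty.\<close>
    define \<delta> where "\<delta> = e / (1 + card X)"
    have \<delta>: "0 < \<delta>" using e by (simp add: \<delta>_def add_pos_nonneg)
    have "\<exists>t. t \<in> J \<and> \<alpha> n - \<delta> < norm (c' t n) * w t n" for n
    proof -
      have "\<alpha> n - \<delta> < \<alpha> n" using \<delta> by simp
      then show ?thesis unfolding \<alpha>_def less_cSUP_iff[OF J bdd] by blast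
    qed
    then obtain \<tau> where \<tau>: "\<And>n. \<tau> n \<in> J" "\<And>n. \<alpha> n - \<delta> < norm (c' (\<tau> n) n) * w (\<tau> n) n" by metis
    have "sum \<alpha> X \<le> (\<Sum>n\<in>X. norm (c' (\<tau> n) n) * w (\<tau> n) n + \<delta>)"
      by (intro sum_mono) (use \<tau>(2) in \<open>auto simp: less_imp_le diff_less_eq\<close>)
    also have "\<dots> \<le> R + card X * \<delta>"
      using fin[OF X \<tau>(1)] by (simp add: sum.distrib)
    also have "card X * \<delta> \<le> e" using e by (simp add: \<delta>_def field_simps)
    finally show "sum \<alpha> X \<le> R + e" by simp
  qed
  have sm: "\<alpha> summable_on UNIV"
    by (rule nonneg_bdd_above_summable_on) (use nonneg sums in \<open>auto intro!: bdd_aboveI2[of _ _ R]\<close>)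
  show ?thesis
    by (rule tameI[of \<alpha>]) (use nonneg sm sums le in \<open>auto simp: w_def intro: infsum_le_finite_sums\<close>)
qed

section \<open>Duhamel estimates in the shrinking weight\<close>

lemma exponential_growth:
  fixes z :: "real \<Rightarrow> complex"
  assumes h: "0 \<le> h" and pos: "0 < \<rho>" "0 \<le> A" "0 \<le> N"
    and z: "\<And>r. r \<in> {0..h} \<Longrightarrow> (z has_vector_derivative z' r) (at r within {0..h})"
    and z': "\<And>r. r \<in> {0..h} \<Longrightarrow> norm (z' r) \<le> A * N * exp (\<rho> * N * r)"
    and z0: "z 0 = 0"
  shows "norm (z h) \<le> A / \<rho> * exp (\<rho> * N * h)"
proof (cases "h = 0")
  case True
  then show ?thesis using pos z0 by simp
next
  case False
  then have h: "0 < h" using h by simp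
  \<comment> \<open>The comparison function grows exactly at the rate allowed for \<open>z'\<close>;
    integrating the exponential cancels the factor \<open>N\<close> and leaves the gain 1 /
    \<rho>.\<close>
  have "norm (z h - z 0) \<le> A / \<rho> * exp (\<rho> * N * h) - A / \<rho> * exp (\<rho> * N * 0)"
  proof (rule differentiable_bound_general[OF h, where \<phi> = "\<lambda>r. A / \<rho> * exp (\<rho> * N * r)" and \<phi>' = "\<lambda>r. A * N * exp (\<rho> * N * r)" and f' = z'])
    show "continuous_on {0..h} z"
      by (rule continuous_on_vector_derivative[OF z])
    show "continuous_on {0..h} (\<lambda>r. A / \<rho> * exp (\<rho> * N * r))" by (intro continuous_intros)
    fix r assume r: "0 < r" "r < h"
    then show "(z has_vector_derivative z' r) (at r)"
      using z[of r] at_within_Icc_at[of 0 r h] by simp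
    show "((\<lambda>r. A / \<rho> * exp (\<rho> * N * r)) has_vector_derivative A * N * exp (\<rho> * N * r)) (at r)"
      unfolding has_real_derivative_iff_has_vector_derivative[symmetric]
      by (auto intro!: derivative_eq_intros simp: pos(1) less_imp_neq[OF pos(1), symmetric])
    show "norm (z' r) \<le> A * N * exp (\<rho> * N * r)" using z' r by simp
  qed
  then show ?thesis using pos z0 by (simp add: divide_nonneg_pos order_trans)
qed

text \<open>The shrinking weight absorbs the derivative: the factor \<open>norm (int_vec n)\<close> in the bound
  on \<open>y'\<close> is compensated by integrating \<open>exp (\<rho> * \<bar>t - t0\<bar> * norm (int_vec n))\<close> in time.\<close>

lemma tame_primitive:
  fixes y y' g :: "real \<Rightarrow> int ^ 'nu::finite \<Rightarrow> complex"
  assumes t0: "t0 \<in> {p..q}" and \<rho>: "0 < \<rho>" and W: "0 \<le> W"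
    and y: "\<And>t n. t \<in> {p..q} \<Longrightarrow> ((\<lambda>t. y t n) has_vector_derivative y' t n) (at t within {p..q})"
    and y': "\<And>t n. t \<in> {p..q} \<Longrightarrow> norm (y' t n) \<le> W * norm (int_vec n) * norm (g t n)"
    and y0: "\<And>n. y t0 n = 0"
    and g: "tame {p..q} (\<lambda>t. \<sigma> - \<rho> * \<bar>t - t0\<bar>) g B"
  shows "tame {p..q} (\<lambda>t. \<sigma> - \<rho> * \<bar>t - t0\<bar>) y (W / \<rho> * B)"
proof -
  obtain \<alpha> where a: "\<And>n. 0 \<le> \<alpha> n" "\<alpha> summable_on UNIV" "infsum \<alpha> UNIV \<le> B"
    "\<And>t n. t \<in> {p..q} \<Longrightarrow> norm (g t n) * exp ((\<sigma> - \<rho> * \<bar>t - t0\<bar>) * norm (int_vec n)) \<le> \<alpha> n"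
    by (rule tameE[OF g]) (rule that; blast)
  have y'2: "norm (y' t n) \<le> (W * \<alpha> n * exp (- \<sigma> * norm (int_vec n))) * norm (int_vec n) * exp (\<rho> * norm (int_vec n) * \<bar>t - t0\<bar>)"
    if t: "t \<in> {p..q}" for t n
  proof -
    have e: "exp ((\<sigma> - \<rho> * \<bar>t - t0\<bar>) * norm (int_vec n)) * exp (- (\<sigma> - \<rho> * \<bar>t - t0\<bar>) * norm (int_vec n)) = 1"
      by (simp add: algebra_simps flip: exp_add)
    have "norm (g t n) = norm (g t n) * exp ((\<sigma> - \<rho> * \<bar>t - t0\<bar>) * norm (int_vec n)) * exp (- (\<sigma> - \<rho> * \<bar>t - t0\<bar>) * norm (int_vec n))"
      using e by (simp only: mult.assoc mult_1_right)
    also have "\<dots> \<le> \<alpha> n * exp (- (\<sigma> - \<rho> * \<bar>t - t0\<bar>) * norm (int_vec n))"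
      by (intro mult_right_mono a(4) t) simp
    also have "\<dots> = \<alpha> n * exp (- \<sigma> * norm (int_vec n)) * exp (\<rho> * norm (int_vec n) * \<bar>t - t0\<bar>)"
      by (simp add: algebra_simps flip: exp_add)
    finally have "W * norm (int_vec n) * norm (g t n) \<le> W * norm (int_vec n) * (\<alpha> n * exp (- \<sigma> * norm (int_vec n)) * exp (\<rho> * norm (int_vec n) * \<bar>t - t0\<bar>))"
      by (intro mult_left_mono) (use W in auto)
    then show ?thesis using y'[OF t, of n] by (simp add: mult_ac)
  qed
  have main: "norm (y t n) \<le> (W * \<alpha> n * exp (- \<sigma> * norm (int_vec n))) / \<rho> * exp (\<rho> * norm (int_vec n) * \<bar>t - t0\<bar>)"
    if t: "t \<in> {p..q}" for t n
  proof -
    \<comment> \<open>The sign of time: the way from \<open>t0\<close> to \<open>t\<close> is run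
      through in direction \<open>e\<close>, so forward and backward evolution share one
      estimate.\<close>
    define e where "e = (if t0 \<le> t then 1 else - 1 :: real)"
    define h where "h = \<bar>t - t0\<bar>"
    have th: "t = t0 + e * h" "0 \<le> h" by (auto simp: e_def h_def)
    have in_pq: "t0 + e * r \<in> {p..q}" if "r \<in> {0..h}" for r
      using that t t0 by (auto simp: e_def h_def split: if_splits)
    have img: "(\<lambda>r. t0 + e * r) ` {0..h} \<subseteq> {p..q}" using in_pq by blast
    have "norm (y (t0 + e * h) n) \<le> (W * \<alpha> n * exp (- \<sigma> * norm (int_vec n))) / \<rho> * exp (\<rho> * norm (int_vec n) * h)"
    proof (rule exponential_growth[where z = "\<lambda>r. y (t0 + e * r) n" and z' = "\<lambda>r. e *\<^sub>R y' (t0 + e * r) n"])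
      fix r assume r: "r \<in> {0..h}"
      have "((\<lambda>r. t0 + e * r) has_vector_derivative e) (at r within {0..h})"
        unfolding has_real_derivative_iff_has_vector_derivative[symmetric]
        by (auto intro!: derivative_eq_intros)
      from vector_diff_chain_within[OF this has_vector_derivative_within_subset[OF y[OF in_pq[OF r]] img]]
      show "((\<lambda>r. y (t0 + e * r) n) has_vector_derivative e *\<^sub>R y' (t0 + e * r) n) (at r within {0..h})"
        by (simp add: o_def)
      have "\<bar>e\<bar> = 1" by (simp add: e_def)
      then show "norm (e *\<^sub>R y' (t0 + e * r) n) \<le> W * \<alpha> n * exp (- \<sigma> * norm (int_vec n)) * norm (int_vec n) * exp (\<rho> * norm (int_vec n) * r)"
        using y'2[OF in_pq[OF r], of n] r by (simp add: abs_mult)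
    qed (use \<rho> W a(1) th y0 in auto)
    then show ?thesis unfolding th(1)[symmetric] by (simp only: h_def)
  qed
  show ?thesis
  proof (rule tameI[of "\<lambda>n. W / \<rho> * \<alpha> n"])
    show "(\<lambda>n. W / \<rho> * \<alpha> n) summable_on UNIV" by (rule summable_on_cmult_right[OF a(2)])
    show "infsum (\<lambda>n. W / \<rho> * \<alpha> n) UNIV \<le> W / \<rho> * B"
      unfolding infsum_cmult_right' using \<rho> W by (intro mult_left_mono a(3)) simp
    fix t n assume t: "t \<in> {p..q}"
    have "norm (y t n) * exp ((\<sigma> - \<rho> * \<bar>t - t0\<bar>) * norm (int_vec n)) \<le>
       ((W * \<alpha> n * exp (- \<sigma> * norm (int_vec n))) / \<rho> * exp (\<rho> * norm (int_vec n) * \<bar>t - t0\<bar>)) * exp ((\<sigma> - \<rho> * \<bar>t - t0\<bar>) * norm (int_vec n))"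
      by (intro mult_right_mono main t) simp
    also have "\<dots> = W / \<rho> * \<alpha> n * (exp (- \<sigma> * norm (int_vec n)) * exp (\<rho> * norm (int_vec n) * \<bar>t - t0\<bar>) * exp ((\<sigma> - \<rho> * \<bar>t - t0\<bar>) * norm (int_vec n)))"
      by simp
    also have "exp (- \<sigma> * norm (int_vec n)) * exp (\<rho> * norm (int_vec n) * \<bar>t - t0\<bar>) * exp ((\<sigma> - \<rho> * \<bar>t - t0\<bar>) * norm (int_vec n)) = 1"
      by (simp add: algebra_simps flip: exp_add)
    finally show "norm (y t n) * exp ((\<sigma> - \<rho> * \<bar>t - t0\<bar>) * norm (int_vec n)) \<le> W / \<rho> * \<alpha> n" by simp
  qed (use \<rho> W a(1) in auto)
qed

lemma freq_le: "\<bar>\<omega> \<bullet> int_vec n\<bar> \<le> norm \<omega> * norm (int_vec n)"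
  by (rule Cauchy_Schwarz_ineq2)

text \<open>In the rotating frame, with the initial value subtracted, only the term from
  \<open>h\<close> remains, and \<open>freq_le\<close> puts it in the form that
  \<open>tame_primitive\<close> needs. The initial part keeps its bound \<open>d\<close> because the
  weight is largest at \<open>t0\<close>.\<close>

lemma tame_duhamel:
  fixes z h :: "real \<Rightarrow> int ^ 'nu::finite \<Rightarrow> complex"
  assumes t0: "t0 \<in> {p..q}" and \<rho>: "0 < \<rho>" and \<mu>: "\<And>n. Re (\<mu> n) = 0"
    and z: "\<And>t n. t \<in> {p..q} \<Longrightarrow>
       ((\<lambda>t. z t n) has_vector_derivative - (\<mu> n * z t n + \<i> * (\<omega> \<bullet> int_vec n) * h t n)) (at t within {p..q})"
    and h: "tame {p..q} (\<lambda>t. \<sigma> - \<rho> * \<bar>t - t0\<bar>) h B"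
    and z0: "(\<lambda>n. norm (z t0 n) * exp (\<sigma> * norm (int_vec n))) summable_on UNIV"
      "(\<Sum>\<^sub>\<infinity>n. norm (z t0 n) * exp (\<sigma> * norm (int_vec n))) \<le> d"
  shows "tame {p..q} (\<lambda>t. \<sigma> - \<rho> * \<bar>t - t0\<bar>) z (d + norm \<omega> / \<rho> * B)"
proof -
  define y where "y t n = exp (of_real (t - t0) * \<mu> n) * z t n - z t0 n" for t n
  have "tame {p..q} (\<lambda>t. \<sigma> - \<rho> * \<bar>t - t0\<bar>) y (norm \<omega> / \<rho> * B)"
  proof (rule tame_primitive[OF t0 \<rho> norm_ge_zero _ _ _ h])
    fix t n assume t: "t \<in> {p..q}"
    have e: "((\<lambda>t. exp (of_real (t - t0) * \<mu> n)) has_vector_derivative \<mu> n * exp (of_real (t - t0) * \<mu> n)) (at t within {p..q})"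
      using has_vector_derivative_mult_right[OF exp_has_vector_derivative[of "\<mu> n" t "{p..q}"], of "exp (- of_real t0 * \<mu> n)"]
      by (simp add: left_diff_distrib exp_diff exp_minus field_simps)
    have "((\<lambda>t. y t n) has_vector_derivative (exp (of_real (t - t0) * \<mu> n) * - (\<mu> n * z t n + \<i> * (\<omega> \<bullet> int_vec n) * h t n) +
        \<mu> n * exp (of_real (t - t0) * \<mu> n) * z t n) - 0) (at t within {p..q})"
      unfolding y_def by (intro has_vector_derivative_diff has_vector_derivative_mult e z t has_vector_derivative_const)
    then show "((\<lambda>t. y t n) has_vector_derivative - (exp (of_real (t - t0) * \<mu> n) * (\<i> * (\<omega> \<bullet> int_vec n) * h t n))) (at t within {p..q})"
      by (simp add: algebra_simps)
    show "norm (- (exp (of_real (t - t0) * \<mu> n) * (\<i> * (\<omega> \<bullet> int_vec n) * h t n))) \<le> norm \<omega> * norm (int_vec n) * norm (h t n)"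
      using mult_right_mono[OF freq_le[of \<omega> n] norm_ge_zero[of "h t n"]] \<mu>[of n] by (simp add: norm_mult)
  qed (simp add: y_def)
  moreover have "tame {p..q} (\<lambda>t. \<sigma> - \<rho> * \<bar>t - t0\<bar>) (\<lambda>t. z t0) d"
  proof (rule tameI[OF _ z0])
    fix t n
    show "norm (z t0 n) * exp ((\<sigma> - \<rho> * \<bar>t - t0\<bar>) * norm (int_vec n)) \<le> norm (z t0 n) * exp (\<sigma> * norm (int_vec n))"
      using \<rho> by (intro mult_left_mono) (auto intro!: mult_right_mono)
  qed simp
  ultimately have "tame {p..q} (\<lambda>t. \<sigma> - \<rho> * \<bar>t - t0\<bar>) (\<lambda>t n. z t0 n + y t n) (d + norm \<omega> / \<rho> * B)"
    by (intro tame_add)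
  then show ?thesis
    by (rule tame_mono) (use \<mu> in \<open>auto simp: y_def norm_mult\<close>)
qed

text \<open>Coefficient form of continuity into the weighted space. The sum is taken at each time
  separately, whereas \<open>tame\<close> asks for a majorant common to all times.\<close>

definition l1_continuous :: "real set \<Rightarrow> real \<Rightarrow> (real \<Rightarrow> int ^ 'nu::finite \<Rightarrow> complex) \<Rightarrow> bool" where
  "l1_continuous J s c \<longleftrightarrow>
     (\<forall>t\<in>J. (\<lambda>n. norm (c t n) * exp (s * norm (int_vec n))) summable_on UNIV) \<and>
     (\<forall>t\<in>J. ((\<lambda>r. \<Sum>\<^sub>\<infinity>n. norm (c r n - c t n) * exp (s * norm (int_vec n))) \<longlongrightarrow> 0) (at t within J))"

lemma weighted_diff_summable:
  assumes "(\<lambda>n. norm (a n) * w n) summable_on UNIV" "(\<lambda>n. norm (b n) * w n) summable_on UNIV" "\<And>n. 0 \<le> (w n :: real)"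
  shows "(\<lambda>n. norm (a n - b n) * w n) summable_on UNIV"
proof (rule summable_on_comparison_test[OF summable_on_add[OF assms(1,2)]])
  show "norm (a n - b n) * w n \<le> norm (a n) * w n + norm (b n) * w n" for n
    using mult_right_mono[OF norm_triangle_ineq4 assms(3)[of n]] by (simp add: distrib_right)
qed (use assms(3) in auto)

text \<open>The common majorant makes the series of differences converge uniformly in time.\<close>

lemma tame_l1_continuous:
  assumes c: "tame J s c R" and s: "\<And>t. t \<in> J \<Longrightarrow> \<kappa> \<le> s t"
    and cont: "\<And>n. continuous_on J (\<lambda>t. c t n)"
  shows "l1_continuous J \<kappa> c"
proof -
  have ck: "tame J (\<lambda>t. \<kappa>) c R" by (rule tame_weight_mono[OF c s])
  obtain \<alpha> where a: "\<And>n. 0 \<le> \<alpha> n" "\<alpha> summable_on UNIV" "infsum \<alpha> UNIV \<le> R"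
    "\<And>t n. t \<in> J \<Longrightarrow> norm (c t n) * exp (\<kappa> * norm (int_vec n)) \<le> \<alpha> n"
    by (rule tameE[OF ck]) (rule that; blast)
  have "((\<lambda>r. \<Sum>\<^sub>\<infinity>n. norm (c r n - c t n) * exp (\<kappa> * norm (int_vec n))) \<longlongrightarrow> 0) (at t within J)" if t: "t \<in> J" for t
  proof -
    have "continuous_on J (\<lambda>r. \<Sum>\<^sub>\<infinity>n. norm (c r n - c t n) * exp (\<kappa> * norm (int_vec n)))"
    proof (rule continuous_on_has_sum[where M = "\<lambda>n. 2 * \<alpha> n" and f = "\<lambda>n r. norm (c r n - c t n) * exp (\<kappa> * norm (int_vec n))"])
      show "continuous_on J (\<lambda>r. norm (c r n - c t n) * exp (\<kappa> * norm (int_vec n)))" for n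
        by (intro continuous_intros cont)
      show "(\<lambda>n. 2 * \<alpha> n) summable_on UNIV" by (rule summable_on_cmult_right[OF a(2)])
      fix r assume r: "r \<in> J"
      show "((\<lambda>n. norm (c r n - c t n) * exp (\<kappa> * norm (int_vec n))) has_sum (\<Sum>\<^sub>\<infinity>n. norm (c r n - c t n) * exp (\<kappa> * norm (int_vec n)))) UNIV"
        by (intro has_sum_infsum weighted_diff_summable tame_weighted_summable[OF ck r] tame_weighted_summable[OF ck t]) simp
      fix n
      have "norm (c r n - c t n) * exp (\<kappa> * norm (int_vec n)) \<le> norm (c r n) * exp (\<kappa> * norm (int_vec n)) + norm (c t n) * exp (\<kappa> * norm (int_vec n))"
        using mult_right_mono[OF norm_triangle_ineq4, of "exp (\<kappa> * norm (int_vec n))" "c r n" "c t n"] by (simp add: distrib_right)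
      then show "norm (norm (c r n - c t n) * exp (\<kappa> * norm (int_vec n))) \<le> 2 * \<alpha> n"
        using a(4)[OF r, of n] a(4)[OF t, of n] by simp
    qed
    then show ?thesis using t by (force simp: continuous_on_def)
  qed
  then show ?thesis unfolding l1_continuous_def using tame_weighted_summable[OF ck] by blast
qed

lemma l1_continuous_coefficient:
  assumes "l1_continuous J \<kappa> c" "0 \<le> \<kappa>"
  shows "continuous_on J (\<lambda>t. c t n)"
  unfolding continuous_on_def
proof
  fix t assume t: "t \<in> J"
  show "((\<lambda>r. c r n) \<longlongrightarrow> c t n) (at t within J)"
  proof (rule LIM_zero_cancel, rule Lim_null_comparison)
    show "((\<lambda>r. \<Sum>\<^sub>\<infinity>n. norm (c r n - c t n) * exp (\<kappa> * norm (int_vec n))) \<longlongrightarrow> 0) (at t within J)"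
      using assms(1) t by (simp add: l1_continuous_def)
    have "norm (c r n - c t n) \<le> (\<Sum>\<^sub>\<infinity>n. norm (c r n - c t n) * exp (\<kappa> * norm (int_vec n)))" if r: "r \<in> J" for r
    proof -
      have "(\<lambda>n. norm (c r n - c t n) * exp (\<kappa> * norm (int_vec n))) summable_on UNIV"
        by (rule weighted_diff_summable) (use assms r t in \<open>auto simp: l1_continuous_def\<close>)
      from tame_bound[OF tame_singletonI[of "\<lambda>r n. c r n - c t n" r "\<lambda>_. \<kappa>", OF this order_refl]] assms(2)
      show ?thesis by simp
    qed
    then show "\<forall>\<^sub>F r in at t within J. norm (c r n - c t n) \<le> (\<Sum>\<^sub>\<infinity>n. norm (c r n - c t n) * exp (\<kappa> * norm (int_vec n)))"
      by (auto simp: eventually_at_filter)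
  qed
qed

lemma tame_map_coefficient_continuous:
  assumes F: "tame_map F" and c: "l1_continuous J \<kappa> c" and \<kappa>: "0 \<le> \<kappa>"
    and R: "\<And>t. t \<in> J \<Longrightarrow> (\<Sum>\<^sub>\<infinity>n. norm (c t n) * exp (\<kappa> * norm (int_vec n))) \<le> R"
  shows "continuous_on J (\<lambda>t. F (c t) n)"
proof -
  obtain B L where L: "tame_lip F R B L" using F unfolding tame_map_def by blast
  \<comment> \<open>Single states are treated as constant curves on a one-point time set, so that
    the curve estimate \<open>tame_lip\<close> can compare states at different times.\<close>
  have ct: "tame {r} (\<lambda>_. \<kappa>) (\<lambda>_. c t) R" if "t \<in> J" for r t
    using tame_singletonI[of "\<lambda>_. c t" r "\<lambda>_. \<kappa>" R] R[OF that] c that by (auto simp: l1_continuous_def)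
  show ?thesis
    unfolding continuous_on_def
  proof
    fix t assume t: "t \<in> J"
    define D where "D r = (\<Sum>\<^sub>\<infinity>n. norm (c r n - c t n) * exp (\<kappa> * norm (int_vec n)))" for r
    show "((\<lambda>r. F (c r) n) \<longlongrightarrow> F (c t) n) (at t within J)"
    proof (rule LIM_zero_cancel, rule Lim_null_comparison)
      show "((\<lambda>r. L * D r) \<longlongrightarrow> 0) (at t within J)"
        using c t by (intro tendsto_mult_right_zero) (simp add: l1_continuous_def D_def)
      have "norm (F (c r) n - F (c t) n) \<le> L * D r" if r: "r \<in> J" for r
      proof -
        have "(\<lambda>n. norm (c r n - c t n) * exp (\<kappa> * norm (int_vec n))) summable_on UNIV"
          by (rule weighted_diff_summable) (use c r t in \<open>auto simp: l1_continuous_def\<close>)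
        then have "tame {r} (\<lambda>_. \<kappa>) (\<lambda>_ n. c r n - c t n) (D r)"
          by (intro tame_singletonI) (auto simp: D_def)
        from tame_bound[OF tame_lipD(4)[OF L _ ct[OF r] ct[OF t] this]] \<kappa> show ?thesis by simp
      qed
      then show "\<forall>\<^sub>F r in at t within J. norm (F (c r) n - F (c t) n) \<le> L * D r"
        by (auto simp: eventually_at_filter)
    qed
  qed
qed

section \<open>The coefficient system for an abstract nonlinearity: existence\<close>

locale qp_equation =
  fixes \<omega> :: "real ^ 'nu::finite" and \<mu> :: "int ^ 'nu \<Rightarrow> complex"
    and F :: "(int ^ 'nu \<Rightarrow> complex) \<Rightarrow> int ^ 'nu \<Rightarrow> complex"
  assumes \<mu>: "\<And>n. Re (\<mu> n) = 0" and F: "tame_map F"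
begin

definition coefficient_solution :: "real set \<Rightarrow> (real \<Rightarrow> int ^ 'nu \<Rightarrow> complex) \<Rightarrow> bool" where
  "coefficient_solution J c \<longleftrightarrow> (\<forall>t\<in>J. \<forall>n. ((\<lambda>t. c t n) has_vector_derivative
     - (\<mu> n * c t n + \<i> * (\<omega> \<bullet> int_vec n) * F (c t) n)) (at t within J))"

text \<open>The difference of two integrals from \<open>p\<close> stands for the oriented integral
  from 0 to \<open>t\<close>, which covers negative \<open>t\<close> as well.\<close>

definition duhamel :: "real \<Rightarrow> (int ^ 'nu \<Rightarrow> complex) \<Rightarrow> (real \<Rightarrow> int ^ 'nu \<Rightarrow> complex) \<Rightarrow> real \<Rightarrow> int ^ 'nu \<Rightarrow> complex" where
  "duhamel p a h t n = exp (of_real t * - \<mu> n) * (a n - \<i> * (\<omega> \<bullet> int_vec n) *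
     (integral {p..t} (\<lambda>r. exp (of_real r * \<mu> n) * h r n) - integral {p..0} (\<lambda>r. exp (of_real r * \<mu> n) * h r n)))"

lemma duhamel_0 [simp]: "duhamel p a h 0 n = a n"
  by (simp add: duhamel_def)

lemma duhamel_has_vector_derivative:
  assumes h: "continuous_on {p..q} (\<lambda>t. h t n)" and t: "t \<in> {p..q}"
  shows "((\<lambda>t. duhamel p a h t n) has_vector_derivative
     - (\<mu> n * duhamel p a h t n + \<i> * (\<omega> \<bullet> int_vec n) * h t n)) (at t within {p..q})"
proof -
  define G where "G t = integral {p..t} (\<lambda>r. exp (of_real r * \<mu> n) * h r n)" for t
  define \<xi> where "\<xi> = \<i> * complex_of_real (\<omega> \<bullet> int_vec n)"
  have G: "(G has_vector_derivative exp (of_real t * \<mu> n) * h t n) (at t within {p..q})"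
    unfolding G_def
    by (rule integral_has_vector_derivative[OF _ t]) (intro continuous_intros h)
  have "((\<lambda>t. a n - \<xi> * (G t - G 0)) has_vector_derivative (0 - \<xi> * (exp (of_real t * \<mu> n) * h t n - 0))) (at t within {p..q})"
    by (intro has_vector_derivative_diff has_vector_derivative_mult_right has_vector_derivative_const G)
  from has_vector_derivative_mult[OF exp_has_vector_derivative[of "- \<mu> n" t] this]
  have "((\<lambda>t. exp (of_real t * - \<mu> n) * (a n - \<xi> * (G t - G 0))) has_vector_derivative
      (exp (of_real t * - \<mu> n) * (0 - \<xi> * (exp (of_real t * \<mu> n) * h t n - 0)) +
       - \<mu> n * exp (of_real t * - \<mu> n) * (a n - \<xi> * (G t - G 0)))) (at t within {p..q})" .
  moreover have "exp (of_real t * - \<mu> n) * (0 - \<xi> * (exp (of_real t * \<mu> n) * h t n - 0)) =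
      - \<xi> * h t n * (exp (of_real t * - \<mu> n) * exp (of_real t * \<mu> n))"
    by (simp add: mult_ac)
  moreover have "exp (of_real t * - \<mu> n) * exp (of_real t * \<mu> n) = 1"
    by (simp flip: exp_add)
  ultimately have "((\<lambda>t. exp (of_real t * - \<mu> n) * (a n - \<xi> * (G t - G 0))) has_vector_derivative
      (- \<xi> * h t n * 1 + - \<mu> n * exp (of_real t * - \<mu> n) * (a n - \<xi> * (G t - G 0)))) (at t within {p..q})"
    by (simp only:)
  then show ?thesis
    unfolding duhamel_def G_def[symmetric] \<xi>_def[symmetric] by (simp add: algebra_simps)
qed

lemma F_continuous:
  assumes c: "tame J s c R" and s: "\<And>t. t \<in> J \<Longrightarrow> 0 \<le> s t" and cont: "\<And>n. continuous_on J (\<lambda>t. c t n)"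
  shows "continuous_on J (\<lambda>t. F (c t) n)"
proof (rule tame_map_coefficient_continuous[OF F tame_l1_continuous[OF c s cont]])
  show "(\<Sum>\<^sub>\<infinity>n. norm (c t n) * exp (0 * norm (int_vec n))) \<le> R" if "t \<in> J" for t
    by (rule tame_weighted_infsum[OF tame_weight_mono[OF c] that]) (use s in auto)
qed auto

lemma coefficient_solution_cont:
  "coefficient_solution {p..q} c \<Longrightarrow> continuous_on {p..q} (\<lambda>t. c t n)"
  unfolding coefficient_solution_def by (rule continuous_on_vector_derivative) blast

text \<open>One round of the contraction, turning a bound \<open>D\<close> on the difference into a
  new one; \<open>solution_stability\<close> iterates it.\<close>

lemma coefficient_solution_diff_tame:
  assumes t0: "t0 \<in> {p..q}" and \<rho>: "0 < \<rho>"
    and s: "\<And>t. t \<in> {p..q} \<Longrightarrow> 0 \<le> \<sigma> - \<rho> * \<bar>t - t0\<bar>"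
    and lip: "tame_lip F R B L"
    and c: "coefficient_solution {p..q} c" "tame {p..q} (\<lambda>t. \<sigma> - \<rho> * \<bar>t - t0\<bar>) c R"
    and c': "coefficient_solution {p..q} c'" "tame {p..q} (\<lambda>t. \<sigma> - \<rho> * \<bar>t - t0\<bar>) c' R"
    and D: "tame {p..q} (\<lambda>t. \<sigma> - \<rho> * \<bar>t - t0\<bar>) (\<lambda>t n. c t n - c' t n) D"
    and d: "(\<lambda>n. norm (c t0 n - c' t0 n) * exp (\<sigma> * norm (int_vec n))) summable_on UNIV"
      "(\<Sum>\<^sub>\<infinity>n. norm (c t0 n - c' t0 n) * exp (\<sigma> * norm (int_vec n))) \<le> d"
  shows "tame {p..q} (\<lambda>t. \<sigma> - \<rho> * \<bar>t - t0\<bar>) (\<lambda>t n. c t n - c' t n) (d + norm \<omega> / \<rho> * (L * D))"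
proof (rule tame_duhamel[where \<mu> = \<mu> and h = "\<lambda>t n. F (c t) n - F (c' t) n" and z = "\<lambda>t n. c t n - c' t n", OF t0 \<rho> \<mu> _ _ d])
  show "tame {p..q} (\<lambda>t. \<sigma> - \<rho> * \<bar>t - t0\<bar>) (\<lambda>t n. F (c t) n - F (c' t) n) (L * D)"
    by (rule tame_lipD(4)[OF lip _ c(2) c'(2) D]) (use s in blast)
  fix t n assume t: "t \<in> {p..q}"
  have "((\<lambda>t. c t n - c' t n) has_vector_derivative
      (- (\<mu> n * c t n + \<i> * (\<omega> \<bullet> int_vec n) * F (c t) n) - - (\<mu> n * c' t n + \<i> * (\<omega> \<bullet> int_vec n) * F (c' t) n)))
      (at t within {p..q})"
    using c(1) c'(1) t unfolding coefficient_solution_def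
    by (intro has_vector_derivative_diff) blast+
  then show "((\<lambda>t. c t n - c' t n) has_vector_derivative
      - (\<mu> n * (c t n - c' t n) + \<i> * (\<omega> \<bullet> int_vec n) * (F (c t) n - F (c' t) n))) (at t within {p..q})"
    by (simp add: algebra_simps)
qed

text \<open>Picard iteration from zero in the ball of radius \<open>2 * R\<close>: the data use one
  \<open>R\<close>, \<open>BR\<close> grants the other to the Duhamel term, and \<open>L\<close>
  makes the map contract by 1/2. The bound on \<open>\<rho> * T\<close> keeps the weight
  nonnegative, as products require.\<close>

lemma coefficient_solution_exists:
  assumes \<rho>: "0 < \<rho>" and T: "0 \<le> T" "\<rho> * T \<le> k"
    and lip: "tame_lip F (2 * R) B L" and BR: "norm \<omega> / \<rho> * B \<le> R" and L: "norm \<omega> / \<rho> * L \<le> 1 / 2"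
    and a: "(\<lambda>n. norm (a n) * exp (k * norm (int_vec n))) summable_on UNIV"
      "(\<Sum>\<^sub>\<infinity>n. norm (a n) * exp (k * norm (int_vec n))) \<le> R"
  obtains z where "z 0 = a" "coefficient_solution {-T..T} z" "tame {-T..T} (\<lambda>t. k - \<rho> * \<bar>t - 0\<bar>) z (2 * R)"
proof -
  define J where "J = {-T..T}"
  define s where "s t = k - \<rho> * \<bar>t - 0\<bar>" for t
  have s_eq: "s = (\<lambda>t. k - \<rho> * \<bar>t - 0\<bar>)" by (simp add: s_def fun_eq_iff)
  have J0: "0 \<in> J" using T by (simp add: J_def)
  have R0: "0 \<le> R" using order_trans[OF infsum_nonneg a(2)] by simp
  have s0: "0 \<le> s t" if "t \<in> J" for t
  proof -
    have "\<rho> * \<bar>t\<bar> \<le> \<rho> * T" using that \<rho> by (intro mult_left_mono) (auto simp: J_def)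
    then show ?thesis using T by (simp add: s_def)
  qed
  define \<Phi> where "\<Phi> c = duhamel (-T) a (\<lambda>t. F (c t))" for c
  have \<Phi>_deriv: "((\<lambda>t. \<Phi> c t n) has_vector_derivative - (\<mu> n * \<Phi> c t n + \<i> * (\<omega> \<bullet> int_vec n) * F (c t) n)) (at t within J)"
    if "tame J s c (2 * R)" "\<And>n. continuous_on J (\<lambda>t. c t n)" "t \<in> J" for c t n
    unfolding \<Phi>_def J_def
    by (rule duhamel_has_vector_derivative) (use F_continuous[OF that(1) s0 that(2)] that(3) in \<open>auto simp: J_def\<close>)
  have \<Phi>_cont: "continuous_on J (\<lambda>t. \<Phi> c t n)"
    if "tame J s c (2 * R)" "\<And>n. continuous_on J (\<lambda>t. c t n)" for c n
    by (rule continuous_on_vector_derivative[OF \<Phi>_deriv[OF that]])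
  have \<Phi>_tame: "tame J s (\<Phi> c) (2 * R)"
    if c: "tame J s c (2 * R)" "\<And>n. continuous_on J (\<lambda>t. c t n)" for c
  proof -
    have "tame J s (\<Phi> c) (R + norm \<omega> / \<rho> * B)"
      unfolding J_def s_eq
    proof (rule tame_duhamel[where \<mu> = \<mu> and h = "\<lambda>t. F (c t)"])
      show "tame {-T..T} (\<lambda>t. k - \<rho> * \<bar>t - 0\<bar>) (\<lambda>t. F (c t)) B"
        using tame_lipD(3)[OF lip _ c(1)] s0 unfolding J_def s_eq by blast
      show "((\<lambda>t. \<Phi> c t n) has_vector_derivative - (\<mu> n * \<Phi> c t n + \<i> * (\<omega> \<bullet> int_vec n) * F (c t) n)) (at t within {-T..T})"
        if "t \<in> {-T..T}" for t n
        using \<Phi>_deriv[OF c] that unfolding J_def by blast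
    qed (use a J0 \<rho> \<mu> in \<open>auto simp: \<Phi>_def J_def\<close>)
    then show ?thesis by (rule tame_mono) (use BR in auto)
  qed
  have \<Phi>_diff: "tame J s (\<lambda>t n. \<Phi> c t n - \<Phi> c' t n) (D / 2)"
    if c: "tame J s c (2 * R)" "\<And>n. continuous_on J (\<lambda>t. c t n)"
      and c': "tame J s c' (2 * R)" "\<And>n. continuous_on J (\<lambda>t. c' t n)"
      and D: "tame J s (\<lambda>t n. c t n - c' t n) D" for c c' D
  proof -
    have "tame J s (\<lambda>t n. \<Phi> c t n - \<Phi> c' t n) (0 + norm \<omega> / \<rho> * (L * D))"
      unfolding J_def s_eq
    proof (rule tame_duhamel[where \<mu> = \<mu> and h = "\<lambda>t n. F (c t) n - F (c' t) n"])
      show "tame {-T..T} (\<lambda>t. k - \<rho> * \<bar>t - 0\<bar>) (\<lambda>t n. F (c t) n - F (c' t) n) (L * D)"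
        using tame_lipD(4)[OF lip _ c(1) c'(1) D] s0 unfolding J_def s_eq by blast
      fix t n assume t: "t \<in> {-T..T}"
      have "((\<lambda>t. \<Phi> c t n - \<Phi> c' t n) has_vector_derivative
          (- (\<mu> n * \<Phi> c t n + \<i> * (\<omega> \<bullet> int_vec n) * F (c t) n) - - (\<mu> n * \<Phi> c' t n + \<i> * (\<omega> \<bullet> int_vec n) * F (c' t) n)))
          (at t within J)"
        using t by (intro has_vector_derivative_diff \<Phi>_deriv c c') (simp_all add: J_def)
      then show "((\<lambda>t. \<Phi> c t n - \<Phi> c' t n) has_vector_derivative
          - (\<mu> n * (\<Phi> c t n - \<Phi> c' t n) + \<i> * (\<omega> \<bullet> int_vec n) * (F (c t) n - F (c' t) n))) (at t within {-T..T})"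
        by (simp add: algebra_simps J_def)
    qed (use J0 \<rho> \<mu> in \<open>auto simp: \<Phi>_def J_def\<close>)
    moreover have "norm \<omega> / \<rho> * (L * D) \<le> D / 2"
      using mult_right_mono[OF L tame_nonneg[OF D]] by (simp add: mult.assoc)
    ultimately show ?thesis by (intro tame_mono[where c' = "\<lambda>t n. \<Phi> c t n - \<Phi> c' t n" and R' = "D / 2"]) auto
  qed
  define c where "c j = (\<Phi> ^^ j) (\<lambda>t n. 0)" for j
  have c_Suc: "c (Suc j) = \<Phi> (c j)" for j by (simp add: c_def)
  have c: "tame J s (c j) (2 * R) \<and> (\<forall>n. continuous_on J (\<lambda>t. c j t n))" for j
  proof (induction j)
    case 0
    have "tame J s (\<lambda>t n. 0) (2 * R)" by (rule tame_mono[OF tame_zero]) (use R0 in auto)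
    then show ?case by (simp add: c_def)
  next
    case (Suc j)
    then show ?case unfolding c_Suc using \<Phi>_tame \<Phi>_cont by blast
  qed
  note ct = conjunct1[OF c] and cc = conjunct2[OF c, rule_format]
  have step: "tame J s (\<lambda>t n. c (Suc j) t n - c j t n) (2 * R / 2 ^ j)" for j
  proof (induction j)
    case 0
    show ?case using ct[of "Suc 0"] by (simp add: c_def)
  next
    case (Suc j)
    from \<Phi>_diff[OF ct cc ct cc Suc] show ?case by (simp add: c_Suc[symmetric] field_simps)
  qed
  have far: "tame J s (\<lambda>t n. c (j + i) t n - c j t n) (4 * R / 2 ^ j)" for i j
  proof -
    \<comment> \<open>The partial geometric sum is kept exact so that the induction on
      \<open>i\<close> closes.\<close>
    have "tame J s (\<lambda>t n. c (j + i) t n - c j t n) (4 * R / 2 ^ j - 4 * R / 2 ^ (j + i))"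
    proof (induction i)
      case 0
      then show ?case by (simp add: tame_zero)
    next
      case (Suc i)
      have "tame J s (\<lambda>t n. (c (j + i) t n - c j t n) + (c (Suc (j + i)) t n - c (j + i) t n))
          ((4 * R / 2 ^ j - 4 * R / 2 ^ (j + i)) + 2 * R / 2 ^ (j + i))"
        by (intro tame_add Suc step)
      then show ?case by (simp add: field_simps)
    qed
    then show ?thesis by (rule tame_mono) (use R0 in auto)
  qed
  have bound: "norm (c (j + i) t n - c j t n) \<le> 4 * R / 2 ^ j" if "t \<in> J" for i j t n
    by (rule tame_bound[OF far that s0[OF that]])
  have small: "(\<lambda>j. K / 2 ^ j) \<longlonglongrightarrow> 0" for K :: real
    using LIMSEQ_divide_realpow_zero[of 2 K] by simp
  \<comment> \<open>\<open>tame\<close> is a predicate rather than a complete norm, so the limit is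
    taken in each coefficient and \<open>tame_limit\<close> restores the bounds.\<close>
  define w where "w t n = lim (\<lambda>j. c j t n)" for t n
  have w: "(\<lambda>j. c j t n) \<longlonglongrightarrow> w t n" if t: "t \<in> J" for t n
  proof -
    have "Cauchy (\<lambda>j. c j t n)"
    proof (rule metric_CauchyI)
      fix e :: real assume "0 < e"
      then have "\<forall>\<^sub>F j in sequentially. 4 * R / 2 ^ j < e / 2"
        using order_tendstoD(2)[OF small, of "e / 2" "4 * R"] by simp
      then obtain j where j: "4 * R / 2 ^ j < e / 2" by (auto simp: eventually_sequentially)
      have "dist (c i t n) (c j t n) < e / 2" if "j \<le> i" for i
        using bound[OF t, of j "i - j" n] that j by (simp add: dist_norm)
      then show "\<exists>M. \<forall>i\<ge>M. \<forall>l\<ge>M. dist (c i t n) (c l t n) < e"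
        by (intro exI[of _ j] allI impI) (metis dist_triangle_half_l dist_commute)
    qed
    then show ?thesis by (simp add: w_def convergent_LIMSEQ_iff[symmetric] Cauchy_convergent_iff)
  qed
  have w_tame: "tame J s w (2 * R)"
    by (rule tame_limit[OF _ ct w]) (use J0 in auto)
  have w_diff: "tame J s (\<lambda>t n. w t n - c j t n) (4 * R / 2 ^ j)" for j
  proof (rule tame_limit[OF _ far])
    show "(\<lambda>i. c (j + i) t n - c j t n) \<longlonglongrightarrow> w t n - c j t n" if "t \<in> J" for t n
      using LIMSEQ_ignore_initial_segment[OF w[OF that], of j] by (intro tendsto_intros) (simp add: add.commute)
  qed (use J0 in auto)
  have w_cont: "continuous_on J (\<lambda>t. w t n)" for n
  proof (rule uniform_limit_theorem[where F = sequentially and f = "\<lambda>j t. c j t n"])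
    show "uniform_limit J (\<lambda>j t. c j t n) (\<lambda>t. w t n) sequentially"
    proof (rule uniform_limitI)
      fix e :: real assume "0 < e"
      then have "\<forall>\<^sub>F j in sequentially. 4 * R / 2 ^ j < e"
        using order_tendstoD(2)[OF small, of e "4 * R"] by simp
      then show "\<forall>\<^sub>F j in sequentially. \<forall>t\<in>J. dist (c j t n) (w t n) < e"
      proof eventually_elim
        case (elim j)
        show ?case
        proof
          fix t assume t: "t \<in> J"
          show "dist (c j t n) (w t n) < e"
            using tame_bound[OF w_diff t s0[OF t], of n j] elim by (simp add: dist_norm norm_minus_commute)
        qed
      qed
    qed
    show "\<forall>\<^sub>F j in sequentially. continuous_on J (\<lambda>t. c j t n)"
      by (intro always_eventually allI cc)
  qed simp
  have fixpoint: "\<Phi> w t n = w t n" if t: "t \<in> J" for t n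
  proof -
    have "norm (\<Phi> w t n - w t n) \<le> 4 * R / 2 ^ j" for j
    proof -
      \<comment> \<open>\<open>\<Phi> w\<close> and \<open>w\<close> are both compared with
        \<open>c (Suc j) = \<Phi> (c j)\<close>; each of the two errors is
        \<open>2 * R / 2 ^ j\<close>.\<close>
      have "tame J s (\<lambda>t n. (\<Phi> w t n - \<Phi> (c j) t n) + - 1 * (w t n - c (Suc j) t n)) (4 * R / 2 ^ j / 2 + norm (- 1 :: complex) * (4 * R / 2 ^ Suc j))"
        by (intro tame_add tame_cmult \<Phi>_diff w_diff ct cc w_tame w_cont)
      from tame_bound[OF this t s0[OF t], of n] show ?thesis by (simp add: c_Suc)
    qed
    then have "norm (\<Phi> w t n - w t n) \<le> 0"
      by (intro LIMSEQ_le_const[OF small]) auto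
    then show ?thesis by simp
  qed
  \<comment> \<open>\<open>\<Phi> w\<close> agrees with \<open>w\<close> on the interval and is
    differentiable by construction.\<close>
  show ?thesis
  proof (rule that[of "\<Phi> w"])
    show "\<Phi> w 0 = a" by (simp add: \<Phi>_def fun_eq_iff)
    have "\<Phi> w t = w t" if "t \<in> J" for t using fixpoint[OF that] by (simp add: fun_eq_iff)
    then show "coefficient_solution {-T..T} (\<Phi> w)"
      using \<Phi>_deriv[OF w_tame w_cont] unfolding coefficient_solution_def J_def by simp
    show "tame {-T..T} (\<lambda>t. k - \<rho> * \<bar>t - 0\<bar>) (\<Phi> w) (2 * R)"
      using \<Phi>_tame[OF w_tame w_cont] unfolding J_def s_eq .
  qed
qed

end

section \<open>Stability and uniqueness for the coefficient system\<close>

lemma linear_le_exp: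
  fixes \<delta> x :: real
  assumes "0 < \<delta>"
  shows "x \<le> exp (\<delta> * x) / \<delta>"
proof -
  have "\<delta> * x \<le> exp (\<delta> * x)" using exp_ge_add_one_self[of "\<delta> * x"] by linarith
  then show ?thesis using assms by (simp add: pos_le_divide_eq mult.commute)
qed

context qp_equation
begin

text \<open>Absorbing \<open>D / 2\<close> into \<open>D\<close> would require an optimal bound
  \<open>D\<close>. Instead a crude bound is improved repeatedly: each round halves the excess over
  \<open>2 * d\<close>.\<close>

lemma solution_stability:
  assumes t0: "t0 \<in> {p..q}" and \<rho>: "0 < \<rho>"
    and s: "\<And>t. t \<in> {p..q} \<Longrightarrow> 0 \<le> \<sigma> - \<rho> * \<bar>t - t0\<bar>"
    and lip: "tame_lip F R B L" and L: "norm \<omega> / \<rho> * L \<le> 1 / 2"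
    and c: "coefficient_solution {p..q} c" "tame {p..q} (\<lambda>t. \<sigma> - \<rho> * \<bar>t - t0\<bar>) c R"
    and c': "coefficient_solution {p..q} c'" "tame {p..q} (\<lambda>t. \<sigma> - \<rho> * \<bar>t - t0\<bar>) c' R"
    and d: "(\<lambda>n. norm (c t0 n - c' t0 n) * exp (\<sigma> * norm (int_vec n))) summable_on UNIV"
      "(\<Sum>\<^sub>\<infinity>n. norm (c t0 n - c' t0 n) * exp (\<sigma> * norm (int_vec n))) \<le> d"
    and t: "t \<in> {p..q}"
  shows "(\<Sum>\<^sub>\<infinity>n. norm (c t n - c' t n) * exp ((\<sigma> - \<rho> * \<bar>t - t0\<bar>) * norm (int_vec n))) \<le> 2 * d"
proof -
  have d0: "0 \<le> d" by (rule order_trans[OF infsum_nonneg d(2)]) simp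
  have R0: "0 \<le> R" by (rule tame_nonneg[OF c(2)])
  have D: "tame {p..q} (\<lambda>t. \<sigma> - \<rho> * \<bar>t - t0\<bar>) (\<lambda>t n. c t n - c' t n) (2 * d + 2 * R / 2 ^ j)" for j
  proof (induction j)
    case 0
    have "tame {p..q} (\<lambda>t. \<sigma> - \<rho> * \<bar>t - t0\<bar>) (\<lambda>t n. c t n + - 1 * c' t n) (R + norm (- 1 :: complex) * R)"
      by (intro tame_add tame_cmult c c')
    then show ?case by (rule tame_mono) (use d0 in auto)
  next
    case (Suc j)
    have "norm \<omega> / \<rho> * (L * (2 * d + 2 * R / 2 ^ j)) = norm \<omega> / \<rho> * L * (2 * d + 2 * R / 2 ^ j)" by simp
    also have "\<dots> \<le> 1 / 2 * (2 * d + 2 * R / 2 ^ j)"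
      by (rule mult_right_mono[OF L tame_nonneg[OF Suc]])
    also have "\<dots> = d + R / 2 ^ j" by (simp add: add_divide_distrib)
    finally have "d + norm \<omega> / \<rho> * (L * (2 * d + 2 * R / 2 ^ j)) \<le> 2 * d + 2 * R / 2 ^ Suc j"
      by simp
    from tame_mono[OF coefficient_solution_diff_tame[OF t0 \<rho> s lip c c' Suc d] this subset_refl order_refl]
    show ?case .
  qed
  have "(\<lambda>j. 2 * d + 2 * R / 2 ^ j) \<longlonglongrightarrow> 2 * d + 0"
    using LIMSEQ_divide_realpow_zero[of 2 "2 * R"] by (intro tendsto_intros) simp
  then show ?thesis
    by (intro LIMSEQ_le_const[where X = "\<lambda>j. 2 * d + 2 * R / 2 ^ j"]) (use tame_weighted_infsum[OF D t] in auto)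
qed

lemma coefficient_solution_subset:
  "coefficient_solution J c \<Longrightarrow> J' \<subseteq> J \<Longrightarrow> coefficient_solution J' c"
  unfolding coefficient_solution_def by (meson has_vector_derivative_within_subset subsetD)

lemma l1_continuous_bounded:
  assumes "l1_continuous {p..q} \<kappa> c"
  obtains R where "0 \<le> R" "\<And>t. t \<in> {p..q} \<Longrightarrow> (\<Sum>\<^sub>\<infinity>n. norm (c t n) * exp (\<kappa> * norm (int_vec n))) \<le> R"
proof -
  define N where "N t = (\<Sum>\<^sub>\<infinity>n. norm (c t n) * exp (\<kappa> * norm (int_vec n)))" for t
  have cs: "(\<lambda>n. norm (c t n) * exp (\<kappa> * norm (int_vec n))) summable_on UNIV" if "t \<in> {p..q}" for t
    using assms that by (simp add: l1_continuous_def)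
  have "continuous_on {p..q} N"
    unfolding continuous_on_def
  proof
    fix t assume t: "t \<in> {p..q}"
    define D where "D r = (\<Sum>\<^sub>\<infinity>n. norm (c r n - c t n) * exp (\<kappa> * norm (int_vec n)))" for r
    show "(N \<longlongrightarrow> N t) (at t within {p..q})"
    proof (rule LIM_zero_cancel, rule Lim_null_comparison)
      show "(D \<longlongrightarrow> 0) (at t within {p..q})"
        using assms t by (simp add: l1_continuous_def D_def[abs_def])
      have "norm (N r - N t) \<le> D r" if r: "r \<in> {p..q}" for r
      proof -
        have ds: "(\<lambda>n. norm (c r n - c t n) * exp (\<kappa> * norm (int_vec n))) summable_on UNIV"
          by (intro weighted_diff_summable cs r t) simp
        have "N r \<le> (\<Sum>\<^sub>\<infinity>n. norm (c t n) * exp (\<kappa> * norm (int_vec n)) + norm (c r n - c t n) * exp (\<kappa> * norm (int_vec n)))"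
          unfolding N_def using norm_triangle_sub
          by (intro infsum_mono cs r t summable_on_add ds) (simp flip: distrib_right)
        moreover have "N t \<le> (\<Sum>\<^sub>\<infinity>n. norm (c r n) * exp (\<kappa> * norm (int_vec n)) + norm (c r n - c t n) * exp (\<kappa> * norm (int_vec n)))"
          unfolding N_def using norm_triangle_sub[of "c t _" "c r _"]
          by (intro infsum_mono cs r t summable_on_add ds) (simp add: norm_minus_commute flip: distrib_right)
        ultimately show ?thesis
          using infsum_add[OF cs[OF t] ds] infsum_add[OF cs[OF r] ds] by (simp add: N_def D_def)
      qed
      then show "\<forall>\<^sub>F r in at t within {p..q}. norm (N r - N t) \<le> D r"
        by (auto simp: eventually_at_filter)
    qed
  qed
  then have "bounded (N ` {p..q})" by (intro compact_imp_bounded compact_continuous_image) auto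
  then obtain R where "0 < R" "\<forall>x\<in>N ` {p..q}. norm x \<le> R" unfolding bounded_pos by blast
  then show ?thesis by (intro that[of R]) (force simp: N_def)+
qed

text \<open>Differentiation in x costs weight: |n| is at most exp(\<delta> |n|) / \<delta>, where
  \<delta> is the weight given up.\<close>

lemma frequency_weight_summable:
  assumes \<kappa>: "\<kappa>' < \<kappa>" and a: "(\<lambda>n. norm (a n) * exp (\<kappa> * norm (int_vec n))) summable_on UNIV"
    and B: "(\<Sum>\<^sub>\<infinity>n. norm (a n) * exp (\<kappa> * norm (int_vec n))) \<le> B"
  shows "(\<lambda>n. norm (\<i> * (\<omega> \<bullet> int_vec n) * a n) * exp (\<kappa>' * norm (int_vec n))) summable_on UNIV"
    and "(\<Sum>\<^sub>\<infinity>n. norm (\<i> * (\<omega> \<bullet> int_vec n) * a n) * exp (\<kappa>' * norm (int_vec n))) \<le> norm \<omega> / (\<kappa> - \<kappa>') * B"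
proof -
  have le: "norm (\<i> * (\<omega> \<bullet> int_vec n) * a n) * exp (\<kappa>' * norm (int_vec n)) \<le> norm \<omega> / (\<kappa> - \<kappa>') * (norm (a n) * exp (\<kappa> * norm (int_vec n)))" for n
  proof -
    define x where "x = norm (int_vec n)"
    have "norm (\<i> * (\<omega> \<bullet> int_vec n) * a n) * exp (\<kappa>' * x) \<le> (norm \<omega> * x * norm (a n)) * exp (\<kappa>' * x)"
      using freq_le[of \<omega> n] by (auto simp: norm_mult x_def intro!: mult_right_mono)
    also have "\<dots> \<le> (norm \<omega> * (exp ((\<kappa> - \<kappa>') * x) / (\<kappa> - \<kappa>')) * norm (a n)) * exp (\<kappa>' * x)"
      using linear_le_exp[of "\<kappa> - \<kappa>'" x] \<kappa> by (intro mult_right_mono mult_left_mono) auto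
    also have "\<dots> = norm \<omega> / (\<kappa> - \<kappa>') * (norm (a n) * (exp ((\<kappa> - \<kappa>') * x) * exp (\<kappa>' * x)))" by simp
    also have "exp ((\<kappa> - \<kappa>') * x) * exp (\<kappa>' * x) = exp (\<kappa> * x)" by (simp add: algebra_simps flip: exp_add)
    finally show ?thesis by (simp add: x_def)
  qed
  note s = summable_on_cmult_right[OF a, of "norm \<omega> / (\<kappa> - \<kappa>')"]
  show sm: "(\<lambda>n. norm (\<i> * (\<omega> \<bullet> int_vec n) * a n) * exp (\<kappa>' * norm (int_vec n))) summable_on UNIV"
    by (rule summable_on_comparison_test[OF s le]) simp
  have "(\<Sum>\<^sub>\<infinity>n. norm (\<i> * (\<omega> \<bullet> int_vec n) * a n) * exp (\<kappa>' * norm (int_vec n))) \<le> (\<Sum>\<^sub>\<infinity>n. norm \<omega> / (\<kappa> - \<kappa>') * (norm (a n) * exp (\<kappa> * norm (int_vec n))))"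
    by (rule infsum_mono[OF sm s le])
  also have "\<dots> \<le> norm \<omega> / (\<kappa> - \<kappa>') * B"
    unfolding infsum_cmult_right' using \<kappa> by (intro mult_left_mono B) simp
  finally show "(\<Sum>\<^sub>\<infinity>n. norm (\<i> * (\<omega> \<bullet> int_vec n) * a n) * exp (\<kappa>' * norm (int_vec n))) \<le> norm \<omega> / (\<kappa> - \<kappa>') * B" .
qed

text \<open>Continuity in the weighted space only bounds each time slice; integrating the equation
  yields one summable majorant for all times, at a slightly smaller weight.\<close>

lemma coefficient_solution_tame:
  assumes pq: "p \<le> q" and \<kappa>: "0 \<le> \<kappa>" "\<kappa>' < \<kappa>"
    and c: "coefficient_solution {p..q} c" "l1_continuous {p..q} \<kappa> c"
  shows "\<exists>R. tame {p..q} (\<lambda>_. \<kappa>') c R"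
proof -
  obtain R where R: "0 \<le> R" "\<And>t. t \<in> {p..q} \<Longrightarrow> (\<Sum>\<^sub>\<infinity>n. norm (c t n) * exp (\<kappa> * norm (int_vec n))) \<le> R"
    by (rule l1_continuous_bounded[OF c(2)]) (rule that; blast)
  obtain B L where lip: "tame_lip F R B L" using F unfolding tame_map_def by blast
  define f where "f t n = \<i> * (\<omega> \<bullet> int_vec n) * F (c t) n" for t n
  define K where "K = norm \<omega> / (\<kappa> - \<kappa>') * B"
  have fc: "continuous_on {p..q} (\<lambda>t. f t n)" for n
    unfolding f_def by (intro continuous_intros tame_map_coefficient_continuous[OF F c(2) \<kappa>(1) R(2)])
  have fK: "(\<Sum>n\<in>X. norm (f t n) * exp (\<kappa>' * norm (int_vec n))) \<le> K" if t: "t \<in> {p..q}" and X: "finite X" for t X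
  proof -
    have "tame {t} (\<lambda>_. \<kappa>) c R"
      by (rule tame_singletonI) (use c(2) R(2)[OF t] t in \<open>auto simp: l1_continuous_def\<close>)
    then have "tame {t} (\<lambda>_. \<kappa>) (\<lambda>t. F (c t)) B" by (intro tame_lipD(3)[OF lip]) (use \<kappa> in auto)
    note s = tame_weighted_summable[OF this singletonI] tame_weighted_infsum[OF this singletonI]
    show ?thesis
      unfolding f_def K_def by (rule finite_sum_le_total[OF frequency_weight_summable[OF \<kappa>(2) s] _ X]) simp
  qed
  \<comment> \<open>Total forcing of frequency \<open>n\<close> over the whole interval. In the
    rotating frame the coefficient moves by at most this much, which yields a majorant independent
    of time.\<close>
  define \<beta> where "\<beta> n = integral {p..q} (\<lambda>t. norm (f t n))" for n
  have ni: "(\<lambda>t. norm (f t n)) integrable_on {x..y}" if "{x..y} \<subseteq> {p..q}" for n x y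
    by (intro integrable_continuous_real continuous_intros continuous_on_subset[OF fc that])
  have \<beta>0: "0 \<le> \<beta> n" for n unfolding \<beta>_def by (intro integral_nonneg ni) auto
  have \<beta>sum: "(\<Sum>n\<in>X. \<beta> n * exp (\<kappa>' * norm (int_vec n))) \<le> K * (q - p)" if X: "finite X" for X
  proof -
    have "(\<Sum>n\<in>X. \<beta> n * exp (\<kappa>' * norm (int_vec n))) = integral {p..q} (\<lambda>t. \<Sum>n\<in>X. norm (f t n) * exp (\<kappa>' * norm (int_vec n)))"
      by (subst integral_sum[OF X]) (auto simp: \<beta>_def intro!: integrable_on_mult_left ni)
    also have "\<dots> \<le> integral {p..q} (\<lambda>t. K)"
      by (rule integral_le) (use fK X in \<open>auto intro!: integrable_sum integrable_on_mult_left ni\<close>)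
    finally show ?thesis using pq by (simp add: mult.commute)
  qed
  have \<beta>s: "(\<lambda>n. \<beta> n * exp (\<kappa>' * norm (int_vec n))) summable_on UNIV"
    by (rule nonneg_bdd_above_summable_on) (use \<beta>0 \<beta>sum in \<open>auto intro!: bdd_aboveI2[of _ _ "K * (q - p)"]\<close>)
  have cs: "(\<lambda>n. norm (c p n) * exp (\<kappa>' * norm (int_vec n))) summable_on UNIV"
  proof (rule summable_on_comparison_test)
    show "(\<lambda>n. norm (c p n) * exp (\<kappa> * norm (int_vec n))) summable_on UNIV"
      using c(2) pq by (simp add: l1_continuous_def)
  qed (use \<kappa> in \<open>auto intro!: mult_left_mono mult_right_mono\<close>)
  define \<alpha> where "\<alpha> n = norm (c p n) * exp (\<kappa>' * norm (int_vec n)) + \<beta> n * exp (\<kappa>' * norm (int_vec n))" for n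
  have "tame {p..q} (\<lambda>_. \<kappa>') c (infsum \<alpha> UNIV)"
  proof (rule tameI[of \<alpha>])
    show "0 \<le> \<alpha> n" for n using \<beta>0 by (simp add: \<alpha>_def)
    show "\<alpha> summable_on UNIV" unfolding \<alpha>_def by (rule summable_on_add[OF cs \<beta>s])
    fix t n assume t: "t \<in> {p..q}"
    have "norm (exp (of_real t * \<mu> n) * c t n - exp (of_real p * \<mu> n) * c p n) \<le> integral {p..t} (\<lambda>r. norm (f r n))"
    proof (rule rotating_ode_twisted[OF \<mu>])
      show "((\<lambda>t. c t n) has_vector_derivative - (\<mu> n * c r n + f r n)) (at r within {p..t})" if "r \<in> {p..t}" for r
        using coefficient_solution_subset[OF c(1), of "{p..t}"] that t
        unfolding coefficient_solution_def f_def by auto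
      show "continuous_on {p..t} (\<lambda>r. f r n)" by (rule continuous_on_subset[OF fc]) (use t in auto)
    qed (use t in simp)
    also have "\<dots> \<le> \<beta> n"
      unfolding \<beta>_def by (rule integral_subset_le) (use t in \<open>auto intro!: ni\<close>)
    finally have "norm (exp (of_real t * \<mu> n) * c t n) - norm (exp (of_real p * \<mu> n) * c p n) \<le> \<beta> n"
      using norm_triangle_ineq2 order_trans by blast
    then have "norm (c t n) \<le> norm (c p n) + \<beta> n"
      using \<mu> by (simp add: norm_mult)
    from mult_right_mono[OF this, of "exp (\<kappa>' * norm (int_vec n))"]
    show "norm (c t n) * exp (\<kappa>' * norm (int_vec n)) \<le> \<alpha> n"
      by (simp add: \<alpha>_def distrib_right)
  qed simp
  then show ?thesis by blast
qed

text \<open>The \<open>tame\<close> bounds at weight \<open>\<kappa> / 2\<close> hold on all of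
  \<open>{p..q}\<close>, so every local step starts afresh at full weight and the step length is the
  same everywhere. Finitely many steps reach any time.\<close>

lemma coefficient_solution_unique:
  assumes \<kappa>: "0 < \<kappa>" and t0: "t0 \<in> {p..q}"
    and c: "coefficient_solution {p..q} c" "l1_continuous {p..q} \<kappa> c"
    and c': "coefficient_solution {p..q} c'" "l1_continuous {p..q} \<kappa> c'"
    and eq: "c t0 = c' t0" and t: "t \<in> {p..q}"
  shows "c t = c' t"
proof -
  have pq: "p \<le> q" using t0 by simp
  obtain R1 R2 where "tame {p..q} (\<lambda>_. \<kappa> / 2) c R1" "tame {p..q} (\<lambda>_. \<kappa> / 2) c' R2"
    using coefficient_solution_tame[OF pq _ _ c, of "\<kappa> / 2"] coefficient_solution_tame[OF pq _ _ c', of "\<kappa> / 2"] \<kappa> by auto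
  then have R: "tame {p..q} (\<lambda>_. \<kappa> / 2) c (max R1 R2)" "tame {p..q} (\<lambda>_. \<kappa> / 2) c' (max R1 R2)"
    by (auto elim: tame_mono)
  define R where "R = max R1 R2"
  obtain B L where lip: "tame_lip F R B L" using F unfolding tame_map_def by blast
  define \<rho> where "\<rho> = 2 * (norm \<omega> * L) + 1"
  have nL: "0 \<le> norm \<omega> * L" using tame_lipD(2)[OF lip] by simp
  then have \<rho>: "0 < \<rho>" by (simp add: \<rho>_def)
  have L: "norm \<omega> / \<rho> * L \<le> 1 / 2" using \<rho> nL by (simp add: \<rho>_def field_simps)
  \<comment> \<open>At distance \<open>\<delta>\<close> from the restart time, a weight starting at
    \<open>\<kappa> / 2\<close> and falling at rate \<open>\<rho>\<close> has just dropped to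
    zero.\<close>
  define \<delta> where "\<delta> = \<kappa> / 2 / \<rho>"
  have \<delta>: "0 < \<delta>" using \<kappa> \<rho> by (simp add: \<delta>_def)
  have local: "c r = c' r" if t1: "t1 \<in> {p..q}" and e: "c t1 = c' t1" and r: "r \<in> {p..q}" "\<bar>r - t1\<bar> \<le> \<delta>" for t1 r
  proof -
    define p' q' where "p' = max p (t1 - \<delta>)" and "q' = min q (t1 + \<delta>)"
    have sub: "{p'..q'} \<subseteq> {p..q}" and r': "r \<in> {p'..q'}" and t1': "t1 \<in> {p'..q'}"
      using r t1 \<delta> by (auto simp: p'_def q'_def abs_le_iff)
    have s: "0 \<le> \<kappa> / 2 - \<rho> * \<bar>x - t1\<bar>" if "x \<in> {p'..q'}" for x
    proof -
      have "\<rho> * \<bar>x - t1\<bar> \<le> \<rho> * \<delta>" using that \<rho> by (intro mult_left_mono) (auto simp: p'_def q'_def abs_le_iff)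
      then show ?thesis using \<rho> by (simp add: \<delta>_def)
    qed
    have tm: "tame {p'..q'} (\<lambda>x. \<kappa> / 2 - \<rho> * \<bar>x - t1\<bar>) c R" "tame {p'..q'} (\<lambda>x. \<kappa> / 2 - \<rho> * \<bar>x - t1\<bar>) c' R"
      unfolding R_def
      by (rule tame_weight_mono[OF tame_mono[OF R(1) order_refl sub order_refl]],
          use \<rho> in simp,
          rule tame_weight_mono[OF tame_mono[OF R(2) order_refl sub order_refl]],
          use \<rho> in simp)
    have "(\<Sum>\<^sub>\<infinity>n. norm (c r n - c' r n) * exp ((\<kappa> / 2 - \<rho> * \<bar>r - t1\<bar>) * norm (int_vec n))) \<le> 2 * 0"
      by (rule solution_stability[OF t1' \<rho> s lip L coefficient_solution_subset[OF c(1) sub] tm(1)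
            coefficient_solution_subset[OF c'(1) sub] tm(2) _ _ r']) (use e in auto)
    moreover have "(\<lambda>n. norm (c r n - c' r n) * exp ((\<kappa> / 2 - \<rho> * \<bar>r - t1\<bar>) * norm (int_vec n))) summable_on UNIV"
      by (intro weighted_diff_summable tame_weighted_summable[OF tm(1) r'] tame_weighted_summable[OF tm(2) r']) simp
    ultimately have "tame {r} (\<lambda>x. \<kappa> / 2 - \<rho> * \<bar>x - t1\<bar>) (\<lambda>x n. c x n - c' x n) 0"
      by (intro tame_singletonI) auto
    from tame_bound[OF this singletonI s[OF r']] show ?thesis by (simp add: fun_eq_iff)
  qed
  have steps: "\<bar>r - t0\<bar> \<le> real j * \<delta> \<Longrightarrow> r \<in> {p..q} \<Longrightarrow> c r = c' r" for j r
  proof (induction j arbitrary: r)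
    case 0
    then show ?case using eq by simp
  next
    case (Suc j)
    \<comment> \<open>Places the restart point on the segment from \<open>t0\<close> to
      \<open>r\<close>, within \<open>j\<close> steps of \<open>t0\<close> and one step of
      \<open>r\<close>.\<close>
    define \<theta> where "\<theta> = real j / real (Suc j)"
    have \<theta>: "0 \<le> \<theta>" "\<theta> \<le> 1" by (auto simp: \<theta>_def)
    define t1 where "t1 = (1 - \<theta>) * t0 + \<theta> * r"
    have t1: "t1 \<in> {p..q}"
      using convexD[OF convex_real_interval(5)[of p q] t0 Suc.prems(2), of "1 - \<theta>" \<theta>] \<theta> by (simp add: t1_def)
    have "\<bar>t1 - t0\<bar> = \<bar>\<theta> * (r - t0)\<bar>" by (simp add: t1_def algebra_simps)
    also have "\<dots> = \<theta> * \<bar>r - t0\<bar>" using \<theta> by (simp add: abs_mult)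
    also have "\<dots> \<le> \<theta> * (real (Suc j) * \<delta>)" using \<theta> Suc.prems by (intro mult_left_mono) auto
    also have "\<dots> = real j * \<delta>" by (simp add: \<theta>_def)
    finally have "c t1 = c' t1" using Suc.IH t1 by blast
    have "\<bar>r - t1\<bar> = \<bar>(1 - \<theta>) * (r - t0)\<bar>" by (simp add: t1_def algebra_simps)
    also have "\<dots> = (1 - \<theta>) * \<bar>r - t0\<bar>" using \<theta> by (simp add: abs_mult)
    also have "\<dots> \<le> (1 - \<theta>) * (real (Suc j) * \<delta>)" using \<theta> Suc.prems by (intro mult_left_mono) auto
    also have "\<dots> = \<delta>" by (simp add: \<theta>_def field_simps)
    finally show ?case using local[OF t1 \<open>c t1 = c' t1\<close> Suc.prems(2)] by blast
  qed
  obtain j :: nat where "\<bar>t - t0\<bar> / \<delta> \<le> real j" using real_arch_simple by blast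
  then show ?thesis using steps[of t j] t \<delta> by (simp add: field_simps)
qed

end

section \<open>Well-posedness\<close>

lemma weighted_abs_summable:
  fixes a :: "int ^ 'nu::finite \<Rightarrow> complex"
  assumes "(\<lambda>n. norm (a n) * exp (s * norm (int_vec n))) summable_on UNIV" "0 \<le> s"
  shows "(\<lambda>n. norm (a n)) summable_on UNIV"
  using tame_abs_summable[OF tame_singletonI[of "\<lambda>_. a" 0 "\<lambda>_. s", OF assms(1) order_refl]] assms(2) by simp

lemma qp_space_coeff:
  assumes ind: "int_independent \<omega>" and s: "0 \<le> s" and v: "v \<in> qp_space \<omega> s"
  shows "(\<lambda>n. norm (qp_coeff \<omega> v n) * exp (s * norm (int_vec n))) summable_on UNIV"
    and "(\<lambda>n. norm (qp_coeff \<omega> v n)) summable_on UNIV"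
    and "((\<lambda>n. qp_coeff \<omega> v n * wave \<omega> n x) has_sum v x) UNIV"
proof -
  obtain c where c: "(\<lambda>n. norm (c n) * exp (s * norm (int_vec n))) summable_on UNIV"
    "\<And>x. ((\<lambda>n. c n * wave \<omega> n x) has_sum v x) UNIV"
    using v unfolding qp_space_def by blast
  note ca = weighted_abs_summable[OF c(1) s]
  have "qp_coeff \<omega> v = c" by (rule qp_coeff_eq[OF ind ca c(2)])
  then show "(\<lambda>n. norm (qp_coeff \<omega> v n) * exp (s * norm (int_vec n))) summable_on UNIV"
    "(\<lambda>n. norm (qp_coeff \<omega> v n)) summable_on UNIV"
    "((\<lambda>n. qp_coeff \<omega> v n * wave \<omega> n x) has_sum v x) UNIV"
    using c ca by auto
qed

lemma qp_coeff_diff: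
  assumes ind: "int_independent \<omega>" and s: "0 \<le> s" and v: "v \<in> qp_space \<omega> s" and w: "w \<in> qp_space \<omega> s"
  shows "qp_coeff \<omega> (\<lambda>x. v x - w x) n = qp_coeff \<omega> v n - qp_coeff \<omega> w n"
proof -
  note v = qp_space_coeff[OF ind s v] and w = qp_space_coeff[OF ind s w]
  have "qp_coeff \<omega> (\<lambda>x. v x - w x) = (\<lambda>n. qp_coeff \<omega> v n - qp_coeff \<omega> w n)"
  proof (rule qp_coeff_eq[OF ind])
    show "(\<lambda>n. norm (qp_coeff \<omega> v n - qp_coeff \<omega> w n)) summable_on UNIV"
      using weighted_diff_summable[of "qp_coeff \<omega> v" "\<lambda>_. 1" "qp_coeff \<omega> w"] v(2) w(2) by simp
    show "((\<lambda>n. (qp_coeff \<omega> v n - qp_coeff \<omega> w n) * wave \<omega> n x) has_sum v x - w x) UNIV" for x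
      using has_sum_add[OF v(3)[of x] has_sum_uminusI[OF w(3)[of x]]] by (simp add: left_diff_distrib)
  qed
  then show ?thesis by simp
qed

lemma qp_norm_diff:
  assumes "int_independent \<omega>" "0 \<le> s" "v \<in> qp_space \<omega> s" "w \<in> qp_space \<omega> s"
  shows "qp_norm \<omega> s (\<lambda>x. v x - w x) =
    (\<Sum>\<^sub>\<infinity>n. norm (qp_coeff \<omega> v n - qp_coeff \<omega> w n) * exp (s * norm (int_vec n)))"
  unfolding qp_norm_def by (simp add: qp_coeff_diff[OF assms])

lemma qp_curves_iff:
  assumes ind: "int_independent \<omega>" and s: "0 \<le> s"
  shows "u \<in> qp_curves \<omega> s T \<longleftrightarrow> (\<forall>t\<in>{-T..T}. u t \<in> qp_space \<omega> s) \<and> l1_continuous {-T..T} s (\<lambda>t. qp_coeff \<omega> (u t))"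
proof (cases "\<forall>t\<in>{-T..T}. u t \<in> qp_space \<omega> s")
  case True
  have "((\<lambda>r. qp_norm \<omega> s (\<lambda>x. u r x - u t x)) \<longlongrightarrow> 0) (at t within {-T..T}) \<longleftrightarrow>
     ((\<lambda>r. \<Sum>\<^sub>\<infinity>n. norm (qp_coeff \<omega> (u r) n - qp_coeff \<omega> (u t) n) * exp (s * norm (int_vec n))) \<longlongrightarrow> 0) (at t within {-T..T})"
    if t: "t \<in> {-T..T}" for t
    using True t by (intro tendsto_cong) (auto simp: eventually_at_filter intro!: always_eventually qp_norm_diff[OF ind s])
  then show ?thesis
    using True qp_space_coeff(1)[OF ind s] unfolding qp_curves_def l1_continuous_def by auto
qed (auto simp: qp_curves_def)

lemma wave_series_derivative:
  assumes \<kappa>: "0 < \<kappa>" and b: "(\<lambda>n. norm (b n) * exp (\<kappa> * norm (int_vec n))) summable_on UNIV"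
    and v: "\<And>x. ((\<lambda>n. b n * wave \<omega> n x) has_sum v x) UNIV"
  shows "(\<lambda>n. norm (\<i> * (\<omega> \<bullet> int_vec n) * b n)) summable_on UNIV"
    and "(v has_vector_derivative (\<Sum>\<^sub>\<infinity>n. \<i> * (\<omega> \<bullet> int_vec n) * b n * wave \<omega> n x)) (at x)"
proof -
  show s: "(\<lambda>n. norm (\<i> * (\<omega> \<bullet> int_vec n) * b n)) summable_on UNIV"
    \<comment> \<open>Reached through the instance of the locale with zero symbol and identity
      nonlinearity.\<close>
    using qp_equation.frequency_weight_summable(1)[of "\<lambda>_. 0" "\<lambda>a. a" 0 \<kappa> b _ \<omega>, OF _ \<kappa> b order_refl]
    by (simp add: qp_equation_def tame_map_ident)
  have "(v has_vector_derivative (\<Sum>\<^sub>\<infinity>n. \<i> * (\<omega> \<bullet> int_vec n) * b n * wave \<omega> n x)) (at x within {x - 1..x + 1})"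
  proof (rule has_vector_derivative_has_sum[where f = "\<lambda>n x. b n * wave \<omega> n x" and
        f' = "\<lambda>n x. \<i> * (\<omega> \<bullet> int_vec n) * b n * wave \<omega> n x" and M = "\<lambda>n. norm (\<i> * (\<omega> \<bullet> int_vec n) * b n)"])
    show "((\<lambda>x. b n * wave \<omega> n x) has_vector_derivative \<i> * (\<omega> \<bullet> int_vec n) * b n * wave \<omega> n y) (at y within {x - 1..x + 1})" for n y
      using has_vector_derivative_mult_right[OF wave_has_vector_derivative[of \<omega> n y "{x - 1..x + 1}"], of "b n"]
      by (simp add: mult_ac)
    show "((\<lambda>n. \<i> * (\<omega> \<bullet> int_vec n) * b n * wave \<omega> n y) has_sum (\<Sum>\<^sub>\<infinity>n. \<i> * (\<omega> \<bullet> int_vec n) * b n * wave \<omega> n y)) UNIV" for y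
      by (intro has_sum_infsum summable_wave s)
  qed (use s v in \<open>auto simp: norm_mult intro!: continuous_intros\<close>)
  then show "(v has_vector_derivative (\<Sum>\<^sub>\<infinity>n. \<i> * (\<omega> \<bullet> int_vec n) * b n * wave \<omega> n x)) (at x)"
    using at_within_Icc_at[of "x - 1" x "x + 1"] by simp
qed

lemma is_series_qp_space:
  assumes "int_independent \<omega>" "0 \<le> s" "v \<in> qp_space \<omega> s"
  shows "is_series \<omega> (qp_coeff \<omega> v) x (v x)"
  using qp_space_coeff[OF assms] by (simp add: is_series_def)

lemma nonlinearity_derivative:
  assumes \<kappa>: "0 < \<kappa>" and a: "tame {t} (\<lambda>_. \<kappa>) (\<lambda>_. pcoeff P a) B" and u: "\<And>x. is_series \<omega> a x (u x)"
  shows "((\<lambda>y. poly2 P (u y) (cnj (u y))) has_vector_derivative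
     (\<Sum>\<^sub>\<infinity>n. \<i> * (\<omega> \<bullet> int_vec n) * pcoeff P a n * wave \<omega> n x)) (at x)"
proof (rule wave_series_derivative(2)[OF \<kappa> tame_weighted_summable[OF a singletonI]])
  show "((\<lambda>n. pcoeff P a n * wave \<omega> n x) has_sum poly2 P (u x) (cnj (u x))) UNIV" for x
    using is_series_pcoeff[OF u] by (simp add: is_series_def)
qed

section \<open>Classical solutions versus coefficient solutions\<close>

context
  fixes \<omega> :: "real ^ 'nu::finite" and m :: "real \<Rightarrow> complex" and P :: "complex poly poly"
  assumes ind: "int_independent \<omega>" and m: "\<And>\<xi>. Re (m \<xi>) = 0"
begin

interpretation qp_equation \<omega> "\<lambda>n. m (\<omega> \<bullet> int_vec n)" "pcoeff P"
  by (unfold_locales) (use m tame_map_pcoeff in auto)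

text \<open>An application of \<open>series_evolution\<close>: the equation itself, solved for the
  time derivative, supplies the wave series of \<open>ut\<close>.\<close>

lemma classical_solution_coefficients:
  assumes \<kappa>: "0 < \<kappa>" and w: "classical_solution \<omega> m P \<kappa> T w"
  shows "coefficient_solution {-T..T} (\<lambda>t. qp_coeff \<omega> (w t))"
    and "l1_continuous {-T..T} \<kappa> (\<lambda>t. qp_coeff \<omega> (w t))"
    and "\<And>t. t \<in> {-T..T} \<Longrightarrow> w t \<in> qp_space \<omega> \<kappa>"
proof -
  define c where "c t = qp_coeff \<omega> (w t)" for t
  have k0: "0 \<le> \<kappa>" using \<kappa> by simp
  have "w \<in> qp_curves \<omega> \<kappa> T" using w by (simp add: classical_solution_def)
  then have ws: "\<And>t. t \<in> {-T..T} \<Longrightarrow> w t \<in> qp_space \<omega> \<kappa>" and cc: "l1_continuous {-T..T} \<kappa> c"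
    unfolding qp_curves_iff[OF ind k0] c_def by auto
  then show "l1_continuous {-T..T} \<kappa> (\<lambda>t. qp_coeff \<omega> (w t))" "\<And>t. t \<in> {-T..T} \<Longrightarrow> w t \<in> qp_space \<omega> \<kappa>"
    unfolding c_def by auto
  obtain ut where ut: "continuous_on ({-T..T} \<times> UNIV) (\<lambda>(t, x). ut t x)"
    and u_deriv: "\<And>t x. t \<in> {-T..T} \<Longrightarrow> ((\<lambda>r. w r x) has_vector_derivative ut t x) (at t within {-T..T})"
    and m_sum: "\<And>t x. t \<in> {-T..T} \<Longrightarrow> (\<lambda>n. m (\<omega> \<bullet> int_vec n) * c t n * wave \<omega> n x) summable_on UNIV"
    and eq: "\<And>t x. t \<in> {-T..T} \<Longrightarrow> ut t x + multiplier \<omega> m (w t) x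
             + vector_derivative (\<lambda>y. poly2 P (w t y) (cnj (w t y))) (at x) = 0"
    using w unfolding classical_solution_def c_def by blast
  obtain R where R: "0 \<le> R" "\<And>t. t \<in> {-T..T} \<Longrightarrow> (\<Sum>\<^sub>\<infinity>n. norm (c t n) * exp (\<kappa> * norm (int_vec n))) \<le> R"
    by (rule l1_continuous_bounded[OF cc]) (rule that; blast)
  obtain B L where lip: "tame_lip (pcoeff P :: (int ^ 'nu \<Rightarrow> complex) \<Rightarrow> _) R B L"
    using tame_map_pcoeff[of P] unfolding tame_map_def by blast
  have FB: "tame {t} (\<lambda>_. \<kappa>) (\<lambda>_. pcoeff P (c t)) B" if t: "t \<in> {-T..T}" for t
  proof -
    have "tame {t} (\<lambda>_. \<kappa>) (\<lambda>_. c t) R"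
      using cc R(2) t by (intro tame_singletonI) (auto simp: l1_continuous_def)
    then show ?thesis by (intro tame_lipD(3)[OF lip]) (use k0 in auto)
  qed
  define f where "f t n = \<i> * (\<omega> \<bullet> int_vec n) * pcoeff P (c t) n" for t n
  have fs: "(\<lambda>n. norm (f t n)) summable_on UNIV" "(\<Sum>\<^sub>\<infinity>n. norm (f t n)) \<le> norm \<omega> / (\<kappa> - 0) * B"
    if t: "t \<in> {-T..T}" for t
    using frequency_weight_summable[OF \<kappa> tame_weighted_summable[OF FB[OF t] singletonI] tame_weighted_infsum[OF FB[OF t] singletonI]]
    unfolding f_def by simp_all
  have ms: "(\<lambda>n. norm (m (\<omega> \<bullet> int_vec n) * c t n)) summable_on UNIV" if t: "t \<in> {-T..T}" for t
  proof -
    \<comment> \<open>At x = 0 all waves equal 1, and a summable complex family is absolutely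
      summable, so convergence of the series of Lu at this one point suffices.\<close>
    have "wave \<omega> n 0 = 1" for n by (simp add: wave_def)
    then show ?thesis using m_sum[OF t, of 0] by (simp add: summable_on_iff_abs_summable_on_complex)
  qed
  note series = is_series_qp_space[OF ind k0 ws, folded c_def]
  have "((\<lambda>t. c t n) has_vector_derivative - (m (\<omega> \<bullet> int_vec n) * c t n + f t n)) (at t within {-T..T})"
    if t: "t \<in> {-T..T}" for t n
  proof (rule series_evolution.coefficient_ode[OF _ t])
    show "series_evolution \<omega> (\<lambda>n. m (\<omega> \<bullet> int_vec n)) c f w ut (- T) T (norm \<omega> / (\<kappa> - 0) * B)"
    proof
      show "continuous_on {-T..T} (\<lambda>t. c t n)" for n by (rule l1_continuous_coefficient[OF cc k0])
      show "continuous_on {-T..T} (\<lambda>t. f t n)" for n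
        unfolding f_def by (intro continuous_intros tame_map_coefficient_continuous[OF tame_map_pcoeff cc k0 R(2)])
      fix t x assume t: "t \<in> {-T..T}"
      show "(\<lambda>n. norm (c t n)) summable_on UNIV" "((\<lambda>n. c t n * wave \<omega> n x) has_sum w t x) UNIV"
        using series[OF t] by (auto simp: is_series_def)
      have "vector_derivative (\<lambda>y. poly2 P (w t y) (cnj (w t y))) (at x) = (\<Sum>\<^sub>\<infinity>n. f t n * wave \<omega> n x)"
        unfolding f_def by (intro vector_derivative_at nonlinearity_derivative[OF \<kappa> FB[OF t]] series t)
      then have ut_eq: "ut t x = - ((\<Sum>\<^sub>\<infinity>n. m (\<omega> \<bullet> int_vec n) * c t n * wave \<omega> n x) + (\<Sum>\<^sub>\<infinity>n. f t n * wave \<omega> n x))"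
        using eq[OF t, of x] by (simp add: multiplier_def c_def add_eq_0_iff2 add.assoc)
      have e: "- (m (\<omega> \<bullet> int_vec n) * c t n + f t n) * wave \<omega> n x =
          - (m (\<omega> \<bullet> int_vec n) * c t n * wave \<omega> n x + f t n * wave \<omega> n x)" for n
        by (simp add: algebra_simps)
      show "((\<lambda>n. - (m (\<omega> \<bullet> int_vec n) * c t n + f t n) * wave \<omega> n x) has_sum ut t x) UNIV"
        unfolding e ut_eq
        by (intro has_sum_uminusI has_sum_add has_sum_infsum m_sum[OF t] summable_wave[OF fs(1)[OF t]])
    qed (use ind m fs ms ut u_deriv in auto)
  qed
  then show "coefficient_solution {-T..T} (\<lambda>t. qp_coeff \<omega> (w t))"
    unfolding coefficient_solution_def f_def c_def by simp
qed

text \<open>At weight \<open>\<sigma>\<close> the majorant of \<open>z\<close> absorbs the symbol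
  and that of the nonlinearity absorbs the frequency factor. Their combination \<open>K\<close> is
  uniform in time and space, so the series of \<open>u\<close> may be differentiated termwise in
  time.\<close>

lemma classical_solution_of_coefficients:
  assumes \<kappa>: "0 < \<kappa>" "\<kappa> \<le> \<sigma>" and T: "0 \<le> T"
    and M: "\<And>n. norm (m (\<omega> \<bullet> int_vec n)) \<le> M * exp (\<sigma> * norm (int_vec n))"
    and z: "coefficient_solution {-T..T} z" "tame {-T..T} (\<lambda>_. \<sigma>) z R"
  defines "u \<equiv> \<lambda>t x. \<Sum>\<^sub>\<infinity>n. z t n * wave \<omega> n x"
  shows "classical_solution \<omega> m P \<kappa> T u"
    and "\<And>t. t \<in> {-T..T} \<Longrightarrow> qp_coeff \<omega> (u t) = z t"
    and "\<And>t. t \<in> {-T..T} \<Longrightarrow> u t \<in> qp_space \<omega> \<kappa>"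
proof -
  define J where "J = {-T..T}"
  have \<sigma>: "0 < \<sigma>" using \<kappa> by simp
  note zJ = z[folded J_def]
  have z\<kappa>: "tame J (\<lambda>_. \<kappa>) z R" by (rule tame_weight_mono[OF zJ(2)]) (use \<kappa> in auto)
  have zs: "(\<lambda>n. norm (z t n)) summable_on UNIV" if "t \<in> J" for t
    by (rule tame_abs_summable[OF zJ(2) that]) (use \<sigma> in simp)
  have hs: "((\<lambda>n. z t n * wave \<omega> n x) has_sum u t x) UNIV" if "t \<in> J" for t x
    unfolding u_def by (rule has_sum_infsum[OF summable_wave[OF zs[OF that]]])
  have series: "is_series \<omega> (z t) x (u t x)" if "t \<in> J" for t x
    using zs hs that by (simp add: is_series_def)
  have uq: "u t \<in> qp_space \<omega> \<kappa>" if t: "t \<in> J" for t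
    unfolding qp_space_def using tame_weighted_summable[OF z\<kappa> t] hs[OF t] by blast
  then show "\<And>t. t \<in> {-T..T} \<Longrightarrow> u t \<in> qp_space \<omega> \<kappa>" by (simp add: J_def)
  have uc: "qp_coeff \<omega> (u t) = z t" if t: "t \<in> J" for t
    by (rule qp_coeff_eq[OF ind zs[OF t] hs[OF t]])
  then show "\<And>t. t \<in> {-T..T} \<Longrightarrow> qp_coeff \<omega> (u t) = z t" by (simp add: J_def)
  have zc: "continuous_on J (\<lambda>t. z t n)" for n
    using coefficient_solution_cont[OF z(1)] by (simp add: J_def)
  have "l1_continuous J \<kappa> z" by (rule tame_l1_continuous[OF zJ(2) _ zc]) (use \<kappa> in simp)
  moreover have "l1_continuous J \<kappa> (\<lambda>t. qp_coeff \<omega> (u t)) \<longleftrightarrow> l1_continuous J \<kappa> z"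
    unfolding l1_continuous_def
    by (intro arg_cong2[where f = "(\<and>)"] ball_cong refl tendsto_cong)
      (auto simp: uc eventually_at_filter)
  ultimately have curves: "u \<in> qp_curves \<omega> \<kappa> T"
    using uq \<kappa> by (subst qp_curves_iff[OF ind]) (auto simp: J_def)
  obtain B L where lip: "tame_lip (pcoeff P :: (int ^ 'nu \<Rightarrow> complex) \<Rightarrow> _) R B L"
    using tame_map_pcoeff[of P] unfolding tame_map_def by blast
  have FB: "tame J (\<lambda>_. \<sigma>) (\<lambda>t. pcoeff P (z t)) B"
    by (rule tame_lipD(3)[OF lip _ zJ(2)]) (use \<sigma> in auto)
  obtain \<alpha> where a: "\<And>n. 0 \<le> \<alpha> n" "\<alpha> summable_on UNIV" "infsum \<alpha> UNIV \<le> R"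
    "\<And>t n. t \<in> J \<Longrightarrow> norm (z t n) * exp (\<sigma> * norm (int_vec n)) \<le> \<alpha> n"
    by (rule tameE[OF zJ(2)]) (rule that; blast)
  obtain \<beta> where b: "\<And>n. 0 \<le> \<beta> n" "\<beta> summable_on UNIV" "infsum \<beta> UNIV \<le> B"
    "\<And>t n. t \<in> J \<Longrightarrow> norm (pcoeff P (z t) n) * exp (\<sigma> * norm (int_vec n)) \<le> \<beta> n"
    by (rule tameE[OF FB]) (rule that; blast)
  define f where "f t n = \<i> * (\<omega> \<bullet> int_vec n) * pcoeff P (z t) n" for t n
  have M0: "0 \<le> M" using order_trans[OF norm_ge_zero M[of 0]] by simp
  have mz: "norm (m (\<omega> \<bullet> int_vec n) * z t n) \<le> M * \<alpha> n" if t: "t \<in> J" for t n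
  proof -
    have "norm (m (\<omega> \<bullet> int_vec n) * z t n) \<le> (M * exp (\<sigma> * norm (int_vec n))) * norm (z t n)"
      unfolding norm_mult by (intro mult_right_mono M) simp
    also have "\<dots> = M * (norm (z t n) * exp (\<sigma> * norm (int_vec n)))" by simp
    also have "\<dots> \<le> M * \<alpha> n" by (intro mult_left_mono a(4) t M0)
    finally show ?thesis .
  qed
  have fb: "norm (f t n) \<le> norm \<omega> / \<sigma> * \<beta> n" if t: "t \<in> J" for t n
  proof -
    have "norm (f t n) \<le> norm \<omega> * norm (int_vec n) * norm (pcoeff P (z t) n)"
      using freq_le[of \<omega> n] by (auto simp: f_def norm_mult intro!: mult_right_mono)
    also have "\<dots> \<le> norm \<omega> * (exp (\<sigma> * norm (int_vec n)) / \<sigma>) * norm (pcoeff P (z t) n)"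
      by (intro mult_right_mono mult_left_mono linear_le_exp \<sigma>) auto
    also have "\<dots> = norm \<omega> / \<sigma> * (norm (pcoeff P (z t) n) * exp (\<sigma> * norm (int_vec n)))" by simp
    also have "\<dots> \<le> norm \<omega> / \<sigma> * \<beta> n"
      by (intro mult_left_mono b(4) t) (use \<sigma> in auto)
    finally show ?thesis .
  qed
  define K where "K n = M * \<alpha> n + norm \<omega> / \<sigma> * \<beta> n" for n
  have Ks: "K summable_on UNIV"
    unfolding K_def by (intro summable_on_add summable_on_cmult_right a(2) b(2))
  define g where "g n t x = - (m (\<omega> \<bullet> int_vec n) * z t n + f t n) * wave \<omega> n x" for n t x
  have gK: "norm (g n t x) \<le> K n" if t: "t \<in> J" for n t x
    using norm_triangle_ineq[of "m (\<omega> \<bullet> int_vec n) * z t n" "f t n"] mz[OF t, of n] fb[OF t, of n]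
    unfolding g_def K_def norm_mult norm_minus_cancel norm_wave mult_1_right by linarith
  have gs: "((\<lambda>n. g n t x) has_sum (\<Sum>\<^sub>\<infinity>n. g n t x)) UNIV" if t: "t \<in> J" for t x
    by (rule has_sum_infsum[OF abs_summable_summable[OF summable_on_comparison_test[OF Ks gK[OF t]]]]) simp
  have fc: "continuous_on J (\<lambda>t. f t n)" for n
    unfolding f_def using F_continuous[OF zJ(2) _ zc] \<sigma> by (intro continuous_intros) auto
  have ms: "(\<lambda>n. m (\<omega> \<bullet> int_vec n) * z t n * wave \<omega> n x) summable_on UNIV" if t: "t \<in> J" for t x
    by (intro summable_wave summable_on_comparison_test[OF summable_on_cmult_right[OF a(2)] mz[OF t]]) simp
  have fs: "(\<lambda>n. f t n * wave \<omega> n x) summable_on UNIV" if t: "t \<in> J" for t x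
    by (intro summable_wave summable_on_comparison_test[OF summable_on_cmult_right[OF b(2)] fb[OF t]]) simp
  define ut where "ut t x = (\<Sum>\<^sub>\<infinity>n. g n t x)" for t x
  have ut_cont: "continuous_on (J \<times> UNIV) (\<lambda>(t, x). ut t x)"
    unfolding case_prod_beta
  proof (rule continuous_on_has_sum[where f = "\<lambda>n y. g n (fst y) (snd y)" and M = K])
    show "continuous_on (J \<times> UNIV) (\<lambda>y. g n (fst y) (snd y))" for n
      unfolding g_def
      by (intro continuous_intros continuous_on_compose2[OF zc] continuous_on_compose2[OF fc]) auto
  qed (use gK gs Ks in \<open>auto simp: ut_def\<close>)
  have nd: "((\<lambda>y. poly2 P (u t y) (cnj (u t y))) has_vector_derivative (\<Sum>\<^sub>\<infinity>n. f t n * wave \<omega> n x)) (at x)"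
    if t: "t \<in> J" for t x
    unfolding f_def
    by (rule nonlinearity_derivative[OF \<sigma> _ series[OF t], of t _ B])
      (rule tame_mono[OF FB order_refl], use t in auto)
  have "((\<lambda>r. u r x) has_vector_derivative ut t x) (at t within J) \<and>
      (\<lambda>n. m (\<omega> \<bullet> int_vec n) * qp_coeff \<omega> (u t) n * wave \<omega> n x) summable_on UNIV \<and>
      (\<lambda>y. poly2 P (u t y) (cnj (u t y))) differentiable (at x) \<and>
      ut t x + multiplier \<omega> m (u t) x + vector_derivative (\<lambda>y. poly2 P (u t y) (cnj (u t y))) (at x) = 0"
    if t: "t \<in> J" for t x
  proof (intro conjI)
    show "((\<lambda>r. u r x) has_vector_derivative ut t x) (at t within J)"
      unfolding J_def
    proof (rule has_vector_derivative_has_sum[where f = "\<lambda>n t. z t n * wave \<omega> n x" and f' = "\<lambda>n t. g n t x" and M = K])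
      show "((\<lambda>t. z t n * wave \<omega> n x) has_vector_derivative g n r x) (at r within {-T..T})" if "r \<in> {-T..T}" for n r
        unfolding g_def f_def
        using z(1) that unfolding coefficient_solution_def
        by (intro has_vector_derivative_mult_left) blast
      show "continuous_on {-T..T} (\<lambda>t. g n t x)" for n
        unfolding g_def J_def[symmetric] by (intro continuous_intros zc fc)
    qed (use t gK gs Ks hs in \<open>auto simp: J_def ut_def\<close>)
    show "(\<lambda>n. m (\<omega> \<bullet> int_vec n) * qp_coeff \<omega> (u t) n * wave \<omega> n x) summable_on UNIV"
      unfolding uc[OF t] by (rule ms[OF t])
    show "(\<lambda>y. poly2 P (u t y) (cnj (u t y))) differentiable (at x)"
      using nd[OF t, of x] unfolding has_vector_derivative_def differentiable_def by blast
    have "ut t x = - ((\<Sum>\<^sub>\<infinity>n. m (\<omega> \<bullet> int_vec n) * z t n * wave \<omega> n x) + (\<Sum>\<^sub>\<infinity>n. f t n * wave \<omega> n x))"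
      unfolding ut_def g_def infsum_add[OF ms[OF t] fs[OF t], symmetric] infsum_uminus[symmetric]
      by (simp add: algebra_simps)
    then show "ut t x + multiplier \<omega> m (u t) x + vector_derivative (\<lambda>y. poly2 P (u t y) (cnj (u t y))) (at x) = 0"
      unfolding multiplier_def uc[OF t] vector_derivative_at[OF nd[OF t]] by simp
  qed
  then show "classical_solution \<omega> m P \<kappa> T u"
    unfolding classical_solution_def J_def[symmetric] using curves ut_cont by blast
qed

end

lemma symbol_growth:
  assumes bdd: "bdd_above (range (\<lambda>\<xi>. norm (m \<xi>) * exp (- ((k - \<epsilon>) / norm \<omega>) * \<bar>\<xi>\<bar>)))"
    and \<sigma>: "0 \<le> \<sigma>" "k - \<epsilon> \<le> \<sigma>"
  obtains M where "\<And>n. norm (m (\<omega> \<bullet> int_vec n) :: complex) \<le> M * exp (\<sigma> * norm (int_vec n))"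
proof -
  obtain M where M: "\<And>\<xi>. norm (m \<xi>) * exp (- ((k - \<epsilon>) / norm \<omega>) * \<bar>\<xi>\<bar>) \<le> M"
    using bdd unfolding bdd_above_def by auto
  have M0: "0 \<le> M" using order_trans[OF _ M[of 0]] by simp
  have "norm (m (\<omega> \<bullet> int_vec n)) \<le> M * exp (\<sigma> * norm (int_vec n))" for n
  proof -
    define \<xi> where "\<xi> = \<omega> \<bullet> int_vec n"
    \<comment> \<open>\<open>k - \<epsilon>\<close> may be negative, so it is first replaced by the
      nonnegative \<open>\<sigma>\<close>; multiplying the Cauchy-Schwarz bound by it then preserves
      the inequality.\<close>
    have "(k - \<epsilon>) / norm \<omega> * \<bar>\<xi>\<bar> \<le> \<sigma> / norm \<omega> * \<bar>\<xi>\<bar>"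
      using \<sigma> by (intro mult_right_mono divide_right_mono) auto
    also have "\<dots> \<le> \<sigma> / norm \<omega> * (norm \<omega> * norm (int_vec n))"
      using freq_le[of \<omega> n] \<sigma> by (intro mult_left_mono) (auto simp: \<xi>_def)
    \<comment> \<open>For zero \<open>\<omega>\<close> the quotient is 0 by the convention on
      division.\<close>
    also have "\<dots> \<le> \<sigma> * norm (int_vec n)" using \<sigma> by (cases "norm \<omega> = 0") auto
    finally have e: "(k - \<epsilon>) / norm \<omega> * \<bar>\<xi>\<bar> \<le> \<sigma> * norm (int_vec n)" .
    have "norm (m \<xi>) = norm (m \<xi>) * exp (- ((k - \<epsilon>) / norm \<omega>) * \<bar>\<xi>\<bar>) * exp ((k - \<epsilon>) / norm \<omega> * \<bar>\<xi>\<bar>)"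
      by (simp add: mult.assoc flip: exp_add)
    also have "\<dots> \<le> M * exp (\<sigma> * norm (int_vec n))"
      using e M0 by (intro mult_mono M) auto
    finally show ?thesis by (simp add: \<xi>_def)
  qed
  then show ?thesis by (rule that)
qed

lemma qp_ball_coeff:
  assumes ind: "int_independent \<omega>" and k: "0 \<le> k" and u: "u \<in> qp_space \<omega> k" and v: "v \<in> qp_ball \<omega> k u r"
  shows "v \<in> qp_space \<omega> k"
    and "(\<Sum>\<^sub>\<infinity>n. norm (qp_coeff \<omega> v n) * exp (k * norm (int_vec n))) \<le> qp_norm \<omega> k u + r"
proof -
  show vk: "v \<in> qp_space \<omega> k" using v by (simp add: qp_ball_def)
  note su = qp_space_coeff(1)[OF ind k u] and sv = qp_space_coeff(1)[OF ind k vk]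
  have sd: "(\<lambda>n. norm (qp_coeff \<omega> v n - qp_coeff \<omega> u n) * exp (k * norm (int_vec n))) summable_on UNIV"
    by (rule weighted_diff_summable[OF sv su]) simp
  have "(\<Sum>\<^sub>\<infinity>n. norm (qp_coeff \<omega> v n) * exp (k * norm (int_vec n))) \<le>
     (\<Sum>\<^sub>\<infinity>n. norm (qp_coeff \<omega> u n) * exp (k * norm (int_vec n)) + norm (qp_coeff \<omega> v n - qp_coeff \<omega> u n) * exp (k * norm (int_vec n)))"
    using norm_triangle_sub by (intro infsum_mono sv summable_on_add su sd) (simp flip: distrib_right)
  also have "\<dots> = qp_norm \<omega> k u + qp_norm \<omega> k (\<lambda>x. v x - u x)"
    unfolding infsum_add[OF su sd] qp_norm_diff[OF ind k vk u] by (simp add: qp_norm_def)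
  also have "\<dots> \<le> qp_norm \<omega> k u + r" using v by (simp add: qp_ball_def)
  finally show "(\<Sum>\<^sub>\<infinity>n. norm (qp_coeff \<omega> v n) * exp (k * norm (int_vec n))) \<le> qp_norm \<omega> k u + r" .
qed

theorem theorem1p2:
  fixes \<omega> :: "real ^ 'nu::finite"
    and P :: "complex poly poly"
    and k \<kappa> :: real
    and m :: "real \<Rightarrow> complex"
  assumes "int_independent \<omega>"
    and "0 < \<kappa>" and "\<kappa> < k"
    and "\<forall>\<xi>. Re (m \<xi>) = 0"
    and "\<exists>\<epsilon>>0. bdd_above (range (\<lambda>\<xi>. norm (m \<xi>) * exp (- ((k - \<epsilon>) / norm \<omega>) * \<bar>\<xi>\<bar>)))"
  shows "\<forall>u\<^sub>0 \<in> qp_space \<omega> k. \<exists>a \<in> qp_space \<omega> k. \<exists>r>0. \<exists>T>0.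
    u\<^sub>0 \<in> qp_ball \<omega> k a r \<and>
    (\<exists>S :: (real \<Rightarrow> complex) \<Rightarrow> real \<Rightarrow> real \<Rightarrow> complex.
      (\<forall>v\<^sub>0 \<in> qp_ball \<omega> k a r.
         classical_solution \<omega> m P \<kappa> T (S v\<^sub>0) \<and> S v\<^sub>0 0 = v\<^sub>0 \<and>
         (\<forall>w. classical_solution \<omega> m P \<kappa> T w \<and> w 0 = v\<^sub>0 \<longrightarrow> (\<forall>t\<in>{-T..T}. w t = S v\<^sub>0 t))) \<and>
      (\<exists>C. \<forall>v\<^sub>0 \<in> qp_ball \<omega> k a r. \<forall>v\<^sub>1 \<in> qp_ball \<omega> k a r.
         qp_curve_norm \<omega> \<kappa> T (\<lambda>t x. S v\<^sub>0 t x - S v\<^sub>1 t x)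
           \<le> C * qp_norm \<omega> k (\<lambda>x. v\<^sub>0 x - v\<^sub>1 x)))"
proof
  fix u0 assume u0: "u0 \<in> qp_space \<omega> k"
  note ind = assms(1) and \<kappa> = assms(2) and \<kappa>k = assms(3)
  have m: "Re (m \<xi>) = 0" for \<xi> using assms(4) by blast
  have k0: "0 \<le> k" and \<kappa>0: "0 \<le> \<kappa>" using \<kappa> \<kappa>k by auto
  interpret qp_equation \<omega> "\<lambda>n. m (\<omega> \<bullet> int_vec n)" "pcoeff P"
    by (unfold_locales) (use m tame_map_pcoeff in auto)
  obtain \<epsilon> where \<epsilon>: "\<epsilon> > 0" "bdd_above (range (\<lambda>\<xi>. norm (m \<xi>) * exp (- ((k - \<epsilon>) / norm \<omega>) * \<bar>\<xi>\<bar>)))"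
    using assms(5) by blast
  \<comment> \<open>The weight must stay above \<open>\<kappa>\<close>, where solutions are
    measured, and above \<open>k - \<epsilon>\<close>, to absorb the symbol; being below
    \<open>k\<close>, it leaves room for the weight to shrink.\<close>
  define \<sigma> where "\<sigma> = max \<kappa> (k - \<epsilon>)"
  have \<sigma>: "0 < \<sigma>" "\<kappa> \<le> \<sigma>" "\<sigma> < k" "k - \<epsilon> \<le> \<sigma>" using \<kappa> \<kappa>k \<epsilon> by (auto simp: \<sigma>_def)
  obtain M where M: "\<And>n. norm (m (\<omega> \<bullet> int_vec n)) \<le> M * exp (\<sigma> * norm (int_vec n))"
    by (rule symbol_growth[OF \<epsilon>(2) less_imp_le[OF \<sigma>(1)] \<sigma>(4)]) (rule that; blast)
  \<comment> \<open>Bounds the size of all data in the ball of radius 1 around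
    \<open>u0\<close>.\<close>
  define R where "R = qp_norm \<omega> k u0 + 1"
  have "0 \<le> qp_norm \<omega> k u0" unfolding qp_norm_def by (intro infsum_nonneg) simp
  then have R: "0 < R" by (simp add: R_def)
  obtain B L where lip: "tame_lip (pcoeff P :: (int ^ 'nu \<Rightarrow> complex) \<Rightarrow> _) (2 * R) B L"
    using tame_map_pcoeff[of P] unfolding tame_map_def by blast
  \<comment> \<open>The summands secure, in this order, the self-mapping condition
    \<open>BR\<close>, the contraction factor in \<open>L\<close>, and positivity.\<close>
  define \<rho> where "\<rho> = norm \<omega> * B / R + 2 * (norm \<omega> * L) + 1"
  have nB: "0 \<le> norm \<omega> * B" and nL: "0 \<le> norm \<omega> * L" using tame_lipD(1,2)[OF lip] by auto
  have "0 \<le> norm \<omega> * B / R" using nB R by simp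
  then have \<rho>: "0 < \<rho>" "norm \<omega> * B / R \<le> \<rho>" "2 * (norm \<omega> * L) \<le> \<rho>" using nL by (auto simp: \<rho>_def)
  have BR: "norm \<omega> / \<rho> * B \<le> R" using \<rho>(1,2) R by (simp add: field_simps)
  have L: "norm \<omega> / \<rho> * L \<le> 1 / 2" using \<rho>(1,3) by (simp add: field_simps)
  \<comment> \<open>The time in which the weight falls from \<open>k\<close> to
    \<open>\<sigma>\<close> at rate \<open>\<rho>\<close>.\<close>
  define T where "T = (k - \<sigma>) / \<rho>"
  have T: "0 < T" "\<rho> * T = k - \<sigma>" using \<rho> \<sigma> by (auto simp: T_def)
  have weight: "\<sigma> \<le> k - \<rho> * \<bar>t - 0\<bar>" if "t \<in> {-T..T}" for t
  proof -
    have "\<rho> * \<bar>t\<bar> \<le> \<rho> * T" using that \<rho> by (intro mult_left_mono) auto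
    then show ?thesis using T(2) by simp
  qed
  define Ball where "Ball = qp_ball \<omega> k u0 1"
  note ball = qp_ball_coeff[OF ind k0 u0, where r = 1, folded Ball_def R_def]
  have u0_ball: "u0 \<in> Ball"
  proof -
    have "qp_norm \<omega> k (\<lambda>x. u0 x - u0 x) = 0" unfolding qp_norm_diff[OF ind k0 u0 u0] by simp
    then show ?thesis using u0 by (simp add: Ball_def qp_ball_def)
  qed
  \<comment> \<open>The \<open>tame\<close> bound is recorded with the solution because the
    Lipschitz estimate starts from weight \<open>k\<close>, which a classical solution in the
    \<open>\<kappa>\<close> space does not provide by itself.\<close>
  define good where "good v u \<longleftrightarrow> classical_solution \<omega> m P \<kappa> T u \<and> u 0 = v \<and>
    tame {-T..T} (\<lambda>t. k - \<rho> * \<bar>t - 0\<bar>) (\<lambda>t. qp_coeff \<omega> (u t)) (2 * R)" for v and u :: "real \<Rightarrow> real \<Rightarrow> complex"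
  have "\<exists>u. good v u" if v: "v \<in> Ball" for v
  proof -
    note vc = qp_space_coeff[OF ind k0 ball(1)[OF v]]
    obtain z where z: "z 0 = qp_coeff \<omega> v" "coefficient_solution {-T..T} z"
      "tame {-T..T} (\<lambda>t. k - \<rho> * \<bar>t - 0\<bar>) z (2 * R)"
      by (rule coefficient_solution_exists[OF \<rho>(1) less_imp_le[OF T(1)] _ lip BR L vc(1) ball(2)[OF v]])
        (use T(2) \<sigma> in simp, rule that)
    have z\<sigma>: "tame {-T..T} (\<lambda>_. \<sigma>) z (2 * R)" by (rule tame_weight_mono[OF z(3) weight])
    define u where "u t x = (\<Sum>\<^sub>\<infinity>n. z t n * wave \<omega> n x)" for t x
    note uz = classical_solution_of_coefficients[OF ind m \<kappa> \<sigma>(2) less_imp_le[OF T(1)] M z(2) z\<sigma>, folded u_def]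
    have "u 0 x = v x" for x
      unfolding u_def z(1) by (rule infsumI[OF vc(3)])
    then have "u 0 = v" by (simp add: fun_eq_iff)
    moreover have "tame {-T..T} (\<lambda>t. k - \<rho> * \<bar>t - 0\<bar>) (\<lambda>t. qp_coeff \<omega> (u t)) (2 * R)"
      by (rule tame_cong[OF z(3)]) (simp add: uz(2))
    ultimately show ?thesis using uz(1) unfolding good_def by blast
  qed
  then obtain S where S: "\<And>v. v \<in> Ball \<Longrightarrow> good v (S v)" by metis
  have coeff: "coefficient_solution {-T..T} (\<lambda>t. qp_coeff \<omega> (w t))" "l1_continuous {-T..T} \<kappa> (\<lambda>t. qp_coeff \<omega> (w t))"
    "\<And>t. t \<in> {-T..T} \<Longrightarrow> w t \<in> qp_space \<omega> \<kappa>" if "classical_solution \<omega> m P \<kappa> T w" for w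
    using classical_solution_coefficients[OF ind m \<kappa> that] by auto
  have T0: "0 \<in> {-T..T}" using T by simp
  have unique: "w t = S v t" if v: "v \<in> Ball" and w: "classical_solution \<omega> m P \<kappa> T w" "w 0 = v" and t: "t \<in> {-T..T}" for v w t
  proof
    fix x
    have Sv: "classical_solution \<omega> m P \<kappa> T (S v)" "S v 0 = v" using S[OF v] by (auto simp: good_def)
    have "qp_coeff \<omega> (w t) = qp_coeff \<omega> (S v t)"
      by (rule coefficient_solution_unique[OF \<kappa> T0 coeff(1,2)[OF w(1)] coeff(1,2)[OF Sv(1)] _ t]) (simp add: w Sv)
    then show "w t x = S v t x"
      using qp_space_coeff(3)[OF ind \<kappa>0 coeff(3)[OF w(1) t], of x] qp_space_coeff(3)[OF ind \<kappa>0 coeff(3)[OF Sv(1) t], of x]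
        has_sum_unique by fastforce
  qed
  have lipschitz: "qp_curve_norm \<omega> \<kappa> T (\<lambda>t x. S v t x - S v' t x) \<le> 2 * qp_norm \<omega> k (\<lambda>x. v x - v' x)"
    if v: "v \<in> Ball" and v': "v' \<in> Ball" for v v'
    unfolding qp_curve_norm_def
  proof (rule cSUP_least)
    show "{-T..T} \<noteq> {}" using T by simp
    fix t assume t: "t \<in> {-T..T}"
    have Sv: "classical_solution \<omega> m P \<kappa> T (S v)" "S v 0 = v" "tame {-T..T} (\<lambda>t. k - \<rho> * \<bar>t - 0\<bar>) (\<lambda>t. qp_coeff \<omega> (S v t)) (2 * R)"
      and Sv': "classical_solution \<omega> m P \<kappa> T (S v')" "S v' 0 = v'" "tame {-T..T} (\<lambda>t. k - \<rho> * \<bar>t - 0\<bar>) (\<lambda>t. qp_coeff \<omega> (S v' t)) (2 * R)"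
      using S[OF v] S[OF v'] by (auto simp: good_def)
    have sd: "(\<lambda>n. norm (qp_coeff \<omega> (S v t) n - qp_coeff \<omega> (S v' t) n) * exp ((k - \<rho> * \<bar>t - 0\<bar>) * norm (int_vec n))) summable_on UNIV"
      by (intro weighted_diff_summable tame_weighted_summable[OF Sv(3) t] tame_weighted_summable[OF Sv'(3) t]) simp
    have "qp_norm \<omega> \<kappa> (\<lambda>x. S v t x - S v' t x) =
      (\<Sum>\<^sub>\<infinity>n. norm (qp_coeff \<omega> (S v t) n - qp_coeff \<omega> (S v' t) n) * exp (\<kappa> * norm (int_vec n)))"
      by (rule qp_norm_diff[OF ind \<kappa>0 coeff(3)[OF Sv(1) t] coeff(3)[OF Sv'(1) t]])
    \<comment> \<open>The shrunken weight is still at least \<open>\<sigma>\<close>, hence at least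
      \<open>\<kappa>\<close>, and it equals \<open>k\<close> at time 0; stability in this weight
      therefore compares the \<open>\<kappa>\<close> norm of solutions with the \<open>k\<close>
      norm of data.\<close>
    also have "\<dots> \<le> (\<Sum>\<^sub>\<infinity>n. norm (qp_coeff \<omega> (S v t) n - qp_coeff \<omega> (S v' t) n) * exp ((k - \<rho> * \<bar>t - 0\<bar>) * norm (int_vec n)))"
    proof (rule infsum_mono[OF _ sd])
      show "(\<lambda>n. norm (qp_coeff \<omega> (S v t) n - qp_coeff \<omega> (S v' t) n) * exp (\<kappa> * norm (int_vec n))) summable_on UNIV"
        using qp_space_coeff(1)[OF ind \<kappa>0 coeff(3)[OF Sv(1) t]] qp_space_coeff(1)[OF ind \<kappa>0 coeff(3)[OF Sv'(1) t]]
        by (intro weighted_diff_summable) auto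
    qed (use weight[OF t] \<sigma>(2) in \<open>auto intro!: mult_left_mono mult_right_mono\<close>)
    also have "\<dots> \<le> 2 * qp_norm \<omega> k (\<lambda>x. v x - v' x)"
    proof (rule solution_stability[OF T0 \<rho>(1) _ lip L coeff(1)[OF Sv(1)] Sv(3) coeff(1)[OF Sv'(1)] Sv'(3) _ _ t])
      show "0 \<le> k - \<rho> * \<bar>t - 0\<bar>" if "t \<in> {-T..T}" for t using weight[OF that] \<sigma> by simp
      show "(\<lambda>n. norm (qp_coeff \<omega> (S v 0) n - qp_coeff \<omega> (S v' 0) n) * exp (k * norm (int_vec n))) summable_on UNIV"
        unfolding Sv(2) Sv'(2)
        using qp_space_coeff(1)[OF ind k0 ball(1)[OF v]] qp_space_coeff(1)[OF ind k0 ball(1)[OF v']]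
        by (intro weighted_diff_summable) auto
      show "(\<Sum>\<^sub>\<infinity>n. norm (qp_coeff \<omega> (S v 0) n - qp_coeff \<omega> (S v' 0) n) * exp (k * norm (int_vec n))) \<le> qp_norm \<omega> k (\<lambda>x. v x - v' x)"
        unfolding Sv(2) Sv'(2) qp_norm_diff[OF ind k0 ball(1)[OF v] ball(1)[OF v']] by simp
    qed
    finally show "qp_norm \<omega> \<kappa> (\<lambda>x. S v t x - S v' t x) \<le> 2 * qp_norm \<omega> k (\<lambda>x. v x - v' x)" .
  qed
  show "\<exists>a \<in> qp_space \<omega> k. \<exists>r>0. \<exists>T>0. u0 \<in> qp_ball \<omega> k a r \<and>
    (\<exists>S :: (real \<Rightarrow> complex) \<Rightarrow> real \<Rightarrow> real \<Rightarrow> complex.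
      (\<forall>v\<^sub>0 \<in> qp_ball \<omega> k a r.
         classical_solution \<omega> m P \<kappa> T (S v\<^sub>0) \<and> S v\<^sub>0 0 = v\<^sub>0 \<and>
         (\<forall>w. classical_solution \<omega> m P \<kappa> T w \<and> w 0 = v\<^sub>0 \<longrightarrow> (\<forall>t\<in>{-T..T}. w t = S v\<^sub>0 t))) \<and>
      (\<exists>C. \<forall>v\<^sub>0 \<in> qp_ball \<omega> k a r. \<forall>v\<^sub>1 \<in> qp_ball \<omega> k a r.
         qp_curve_norm \<omega> \<kappa> T (\<lambda>t x. S v\<^sub>0 t x - S v\<^sub>1 t x)
           \<le> C * qp_norm \<omega> k (\<lambda>x. v\<^sub>0 x - v\<^sub>1 x)))"
  proof (rule bexI[OF _ u0], rule exI[of _ 1], rule conjI[OF zero_less_one], rule exI[of _ T],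
      intro conjI T(1) exI[of _ S] exI[of _ 2] ballI allI impI)
    show "u0 \<in> qp_ball \<omega> k u0 1" using u0_ball by (simp add: Ball_def)
    fix v assume v: "v \<in> qp_ball \<omega> k u0 1"
    show "classical_solution \<omega> m P \<kappa> T (S v)" "S v 0 = v"
      using S[of v] v by (simp_all add: good_def Ball_def)
    show "w t = S v t" if "classical_solution \<omega> m P \<kappa> T w \<and> w 0 = v" "t \<in> {-T..T}" for w t
      by (rule unique) (use that v in \<open>auto simp: Ball_def\<close>)
    show "qp_curve_norm \<omega> \<kappa> T (\<lambda>t x. S v t x - S v' t x) \<le> 2 * qp_norm \<omega> k (\<lambda>x. v x - v' x)"
      if "v' \<in> qp_ball \<omega> k u0 1" for v'
      by (rule lipschitz) (use that v in \<open>auto simp: Ball_def\<close>)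
  qed
qed

end
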